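(* Let $p\in\mathbb{N}^+$, $T_0>0$, let $\phi,\gamma$ be real-valued functions on $[a,b]$ independent of $\varepsilon$, and for every $\varepsilon\in(0,1]$ let $u$ (depending on $\varepsilon$) be the exact solution of $$\partial_{tt}u-\partial_{xx}u+u+\varepsilon^p u^{p+1}=0,\quad x\in(a,b),\ t>0,\qquad u(x,0)=\phi(x),\ \ \partial_t u(x,0)=\gamma(x),\ \ x\in[a,b],$$ with periodic boundary conditions. Assume that $$u\in C([0,T_0/\varepsilon^p];W^{6,\infty}_p)\cap C^2([0,T_0/\varepsilon^p];W^{4,\infty})\cap C^4([0,T_0/\varepsilon^p];W^{2,\infty}),$$ $$\left\|\frac{\partial^{r+q}}{\partial t^r\partial x^q}u(x,t)\right\|_{L^\infty}\lesssim 1,\qquad 0\le r\le 4,\ 0\le r+q\le 6,$$ on $[a,b]\times[0,T_0/\varepsilon^p]$. Let $M_0=\sup_{\varepsilon\in(0,1]}\|u(x,t)\|_{L^\infty}$. Let $u^n\in X_M$ be the numerical solution given by the semi-implicit fourth-order compact finite difference scheme $$\delta_t^2u^n_j-\mathcal{A}^{-1}\delta_x^2u^{[n]}_j+u^{[n]}_j+\varepsilon^p(u^n_j)^{p+1}=0,\qquad 0\le j\le M-1,\ n\ge1,$$ with $u^0_j=\phi(x_j)$ and $$u^1_j=\phi(x_j)+\tau\gamma(x_j)+\frac{\tau^2}{2}\left[\phi''(x_j)-\phi(x_j)-\varepsilon^p(\phi(x_j))^{p+1}\right],\qquad 0\le j\le M,$$ and let $e^n_j=u(x_j,t_n)-u^n_j$.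 Let $\sigma_{\max}=\max_{0\le n\le T_0\varepsilon^{-p}/\tau}\|u^n\|_{l^\infty}^p$. Then there exist constants $h_0>0$ and $\tau_0>0$, sufficiently small and independent of $\varepsilon$, such that for any $0<\varepsilon\le1$, whenever $0<h\le h_0\varepsilon^{p/4}$, $0<\tau\le\tau_0\varepsilon^{p/2}$ and the stability condition $$0<\tau<\frac{2}{\sqrt{\varepsilon^p\sigma_{\max}-1}}\qquad(\text{required only when }\sigma_{\max}>\varepsilon^{-p})$$ holds, one has $$\|e^n\|_{l^2}+\|\delta_x^+e^n\|_{l^2}\lesssim\frac{h^4}{\varepsilon^p}+\frac{\tau^2}{\varepsilon^p},\qquad \|u^n\|_{l^\infty}\le 1+M_0,\qquad 0\le n\le\frac{T_0/\varepsilon^p}{\tau}.$$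
   Context: Notation. $A\lesssim B$ means $|A|\le CB$ with a constant $C>0$ independent of the mesh size $h$, the time step $\tau$ and $\varepsilon$. $\tau>0$ is the time step, $h=(b-a)/M>0$ the mesh size with $M$ a positive integer, $x_j=a+jh$ ($0\le j\le M$), $t_n=n\tau$ ($n\ge 0$). $X_M=\{u=(u_0,\dots,u_M)^T\in\mathbb{R}^{M+1}: u_0=u_M\}$, with the periodic convention $u_{-1}=u_{M-1}$, $u_{M+1}=u_1$. Norms: $\|u\|_{l^2}^2=h\sum_{j=0}^{M-1}|u_j|^2$, $\|\delta_x^+u\|_{l^2}^2=h\sum_{j=0}^{M-1}|\delta_x^+u_j|^2$, $\|u\|_{l^\infty}=\max_{0\le j\le M-1}|u_j|$. Difference operators: $\delta_x^+u_j=(u_{j+1}-u_j)/h$, $\delta_x^2u_j=(u_{j+1}-2u_j+u_{j-1})/h^2$, $\delta_t^2u^n_j=(u^{n+1}_j-2u^n_j+u^{n-1}_j)/\tau^2$, $\mathcal{A}u_j=(1+\frac{h^2}{12}\delta_x^2)u_j=\frac1{12}(u_{j-1}+10u_j+u_{j+1})$; $\mathcal{A}^{-1}$ is the inverse of $\mathcal{A}$ on $X_M$. Also $u^{[n]}_j=(u^{n+1}_j+u^{n-1}_j)/2$. $W^{m,\infty}_p=\{u\in W^{m,\infty}(a,b): \frac{\partial^l}{\partial x^l}u(a)=\frac{\partial^l}{\partial x^l}u(b),\ 0\le l<m\}$ for $m\ge1$ (this subscript $p$ means "periodic"). *)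

theory Defs
  imports "HOL-Analysis.Analysis" "HOL-Probability.Essential_Supremum"
begin

text \<open>The derivative relative to a set: on a closed interval it is one-sided at the end points,
  and it depends only on the values of the function on that interval.\<close>

definition deriv_on :: "real set \<Rightarrow> (real \<Rightarrow> real) \<Rightarrow> real \<Rightarrow> real" where
  "deriv_on S f = (\<lambda>x. vector_derivative f (at x within S))"

definition test_functions :: "real \<Rightarrow> real \<Rightarrow> (real \<Rightarrow> real) set" where
  "test_functions a b =
    {\<psi>. (\<forall>k x. (deriv ^^ k) \<psi> field_differentiable at x) \<and>
         (\<exists>c d. a < c \<and> c \<le> d \<and> d < b \<and> (\<forall>x. x \<notin> {c..d} \<longrightarrow> \<psi> x = 0))}"

definition locally_integrable :: "real \<Rightarrow> real \<Rightarrow> (real \<Rightarrow> real) \<Rightarrow> bool" where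
  "locally_integrable a b f \<longleftrightarrow> (\<forall>c d. a < c \<and> d < b \<longrightarrow> set_integrable lebesgue {c..d} f)"

definition has_weak_deriv :: "real \<Rightarrow> real \<Rightarrow> nat \<Rightarrow> (real \<Rightarrow> real) \<Rightarrow> (real \<Rightarrow> real) \<Rightarrow> bool" where
  "has_weak_deriv a b k f g \<longleftrightarrow>
    locally_integrable a b f \<and> locally_integrable a b g \<and>
    (\<forall>\<psi> \<in> test_functions a b.
      (LINT x:{a<..<b}|lebesgue. f x * (deriv ^^ k) \<psi> x) =
      (-1) ^ k * (LINT x:{a<..<b}|lebesgue. g x * \<psi> x))"

text \<open>Determined almost everywhere on \<open>(a,b)\<close> as soon as a weak derivative exists.\<close>

definition weak_deriv :: "real \<Rightarrow> real \<Rightarrow> nat \<Rightarrow> (real \<Rightarrow> real) \<Rightarrow> real \<Rightarrow> real" where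
  "weak_deriv a b k f = (SOME g. has_weak_deriv a b k f g)"

definition Linf_norm :: "real \<Rightarrow> real \<Rightarrow> (real \<Rightarrow> real) \<Rightarrow> ereal" where
  "Linf_norm a b f = esssup (lebesgue_on {a<..<b}) (\<lambda>x. ereal \<bar>f x\<bar>)"

definition Linf :: "real \<Rightarrow> real \<Rightarrow> (real \<Rightarrow> real) set" where
  "Linf a b = {f \<in> borel_measurable (lebesgue_on {a<..<b}). Linf_norm a b f < \<infinity>}"

text \<open>Elements are functions rather than classes modulo null sets; as point values are used,
  for \<open>m \<ge> 1\<close> the element of the class that is continuous on \<open>[a,b]\<close> is taken.\<close>

definition Winf :: "real \<Rightarrow> real \<Rightarrow> nat \<Rightarrow> (real \<Rightarrow> real) set" where
  "Winf a b m =
    {f. (0 < m \<longrightarrow> continuous_on {a..b} f) \<and>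
        (\<forall>k\<le>m. \<exists>g \<in> Linf a b. has_weak_deriv a b k f g)}"

definition Winf_norm :: "real \<Rightarrow> real \<Rightarrow> nat \<Rightarrow> (real \<Rightarrow> real) \<Rightarrow> ereal" where
  "Winf_norm a b m f = (SUP k\<in>{..m}. Linf_norm a b (weak_deriv a b k f))"

text \<open>The boundary values of the derivative of order \<open>l < m\<close> are those of its continuous
  representative.\<close>

definition Winf_per :: "real \<Rightarrow> real \<Rightarrow> nat \<Rightarrow> (real \<Rightarrow> real) set" where
  "Winf_per a b m =
    {f \<in> Winf a b m.
      \<forall>l<m. \<exists>g. has_weak_deriv a b l f g \<and> continuous_on {a..b} g \<and> g a = g b}"

text \<open>\<open>C\<^sup>k([0,T]; X)\<close> for a space \<open>X\<close> of functions of \<open>x\<close> with norm \<open>N\<close>; an element is written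
  \<open>v t x\<close>, and time derivatives are limits of difference quotients in the norm \<open>N\<close>.\<close>

primrec C_time ::
  "(real \<Rightarrow> real) set \<Rightarrow> ((real \<Rightarrow> real) \<Rightarrow> ereal) \<Rightarrow> real \<Rightarrow> nat \<Rightarrow> (real \<Rightarrow> real \<Rightarrow> real) set" where
  "C_time X N T 0 =
    {v. \<forall>t\<in>{0..T}. v t \<in> X \<and>
          ((\<lambda>s. N (\<lambda>x. v s x - v t x)) \<longlongrightarrow> 0) (at t within {0..T})}"
| "C_time X N T (Suc k) =
    {v. \<exists>v' \<in> C_time X N T k. \<forall>t\<in>{0..T}. v t \<in> X \<and>
          ((\<lambda>s. N (\<lambda>x. (v s x - v t x) / (s - t) - v' t x)) \<longlongrightarrow> 0) (at t within {0..T})}"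

text \<open>The unknown is written \<open>u t x\<close>, so that \<open>u t\<close> is the function \<open>u(\<cdot>,t)\<close>.\<close>

definition dt :: "real \<Rightarrow> nat \<Rightarrow> (real \<Rightarrow> real \<Rightarrow> real) \<Rightarrow> real \<Rightarrow> real \<Rightarrow> real" where
  "dt T r u = (\<lambda>t x. (deriv_on {0..T} ^^ r) (\<lambda>s. u s x) t)"

definition dx :: "real \<Rightarrow> real \<Rightarrow> nat \<Rightarrow> (real \<Rightarrow> real) \<Rightarrow> real \<Rightarrow> real" where
  "dx a b q f = (deriv_on {a..b} ^^ q) f"

definition exact_solution ::
  "real \<Rightarrow> real \<Rightarrow> nat \<Rightarrow> (real \<Rightarrow> real) \<Rightarrow> (real \<Rightarrow> real) \<Rightarrow> real \<Rightarrow> real \<Rightarrow> (real \<Rightarrow> real \<Rightarrow> real) \<Rightarrow> bool"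
where
  "exact_solution a b p \<phi> \<gamma> \<epsilon> T u \<longleftrightarrow>
    (\<forall>t\<in>{0<..T}. \<forall>x\<in>{a<..<b}.
       dt T 2 u t x - dx a b 2 (u t) x + u t x + \<epsilon> ^ p * u t x ^ (p + 1) = 0) \<and>
    (\<forall>x\<in>{a..b}. u 0 x = \<phi> x \<and> dt T 1 u 0 x = \<gamma> x) \<and>
    (\<forall>t\<in>{0..T}. u t a = u t b \<and> dx a b 1 (u t) a = dx a b 1 (u t) b)"

text \<open>A vector \<open>(u\<^sub>0, \<dots>, u\<^sub>M)\<close> with \<open>u\<^sub>0 = u\<^sub>M\<close> is represented by its \<open>M\<close>-periodic extension to all
  integer indices, which is the convention \<open>u\<^sub>-\<^sub>1 = u\<^sub>M\<^sub>-\<^sub>1\<close>, \<open>u\<^sub>M\<^sub>+\<^sub>1 = u\<^sub>1\<close>.\<close>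

definition XM :: "nat \<Rightarrow> (int \<Rightarrow> real) set" where
  "XM M = {u. \<forall>j. u (j + int M) = u j}"

definition grid :: "real \<Rightarrow> real \<Rightarrow> int \<Rightarrow> real" where
  "grid a h j = a + of_int j * h"

definition l2_norm :: "real \<Rightarrow> nat \<Rightarrow> (int \<Rightarrow> real) \<Rightarrow> real" where
  "l2_norm h M u = sqrt (h * (\<Sum>j\<in>{0..<int M}. \<bar>u j\<bar>\<^sup>2))"

definition linf_norm :: "nat \<Rightarrow> (int \<Rightarrow> real) \<Rightarrow> real" where
  "linf_norm M u = Max ((\<lambda>j. \<bar>u j\<bar>) ` {0..<int M})"

definition delta_x_plus :: "real \<Rightarrow> (int \<Rightarrow> real) \<Rightarrow> int \<Rightarrow> real" where
  "delta_x_plus h u j = (u (j + 1) - u j) / h"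

definition delta_x2 :: "real \<Rightarrow> (int \<Rightarrow> real) \<Rightarrow> int \<Rightarrow> real" where
  "delta_x2 h u j = (u (j + 1) - 2 * u j + u (j - 1)) / h\<^sup>2"

definition delta_t2 :: "real \<Rightarrow> (nat \<Rightarrow> int \<Rightarrow> real) \<Rightarrow> nat \<Rightarrow> int \<Rightarrow> real" where
  "delta_t2 \<tau> U n j = (U (n + 1) j - 2 * U n j + U (n - 1) j) / \<tau>\<^sup>2"

definition compact_op :: "real \<Rightarrow> (int \<Rightarrow> real) \<Rightarrow> int \<Rightarrow> real" where
  "compact_op h u j = u j + h\<^sup>2 / 12 * delta_x2 h u j"

definition compact_op_inv :: "real \<Rightarrow> nat \<Rightarrow> (int \<Rightarrow> real) \<Rightarrow> int \<Rightarrow> real" where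
  "compact_op_inv h M = inv_into (XM M) (compact_op h)"

definition time_avg :: "(nat \<Rightarrow> int \<Rightarrow> real) \<Rightarrow> nat \<Rightarrow> int \<Rightarrow> real" where
  "time_avg U n j = (U (n + 1) j + U (n - 1) j) / 2"

definition numerical_solution ::
  "real \<Rightarrow> real \<Rightarrow> nat \<Rightarrow> (real \<Rightarrow> real) \<Rightarrow> (real \<Rightarrow> real) \<Rightarrow> real \<Rightarrow> nat \<Rightarrow> real \<Rightarrow> (nat \<Rightarrow> int \<Rightarrow> real) \<Rightarrow> bool"
where
  "numerical_solution a b p \<phi> \<gamma> \<epsilon> M \<tau> U \<longleftrightarrow>
    (let h = (b - a) / real M; x = grid a h in
      (\<forall>n. U n \<in> XM M) \<and>
      (\<forall>n\<ge>1. \<forall>j\<in>{0..int M - 1}.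
         delta_t2 \<tau> U n j - compact_op_inv h M (delta_x2 h (time_avg U n)) j
           + time_avg U n j + \<epsilon> ^ p * U n j ^ (p + 1) = 0) \<and>
      (\<forall>j\<in>{0..int M}. U 0 j = \<phi> (x j)) \<and>
      (\<forall>j\<in>{0..int M}. U 1 j = \<phi> (x j) + \<tau> * \<gamma> (x j)
         + \<tau>\<^sup>2 / 2 * (dx a b 2 \<phi> (x j) - \<phi> (x j) - \<epsilon> ^ p * \<phi> (x j) ^ (p + 1))))"

definition grid_error ::
  "real \<Rightarrow> real \<Rightarrow> real \<Rightarrow> (real \<Rightarrow> real \<Rightarrow> real) \<Rightarrow> (nat \<Rightarrow> int \<Rightarrow> real) \<Rightarrow> nat \<Rightarrow> int \<Rightarrow> real" where
  "grid_error a h \<tau> u U n j = u (real n * \<tau>) (grid a h j) - U n j"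

definition sigma_max :: "nat \<Rightarrow> real \<Rightarrow> real \<Rightarrow> nat \<Rightarrow> (nat \<Rightarrow> int \<Rightarrow> real) \<Rightarrow> real" where
  "sigma_max p T \<tau> M U = Max ((\<lambda>n. linf_norm M (U n) ^ p) ` {n. real n \<le> T / \<tau>})"

end

theory Submission
  imports Defs "HOL-Computational_Algebra.Polynomial"
begin

text \<open>
  Write \<open>A\<close> for the compact averaging operator, \<open>U\<close> for the numerical solution and \<open>e\<close> for the error.
  Since the scheme is linear up to its power term, \<open>e\<close> satisfies
  \<open>\<delta>\<^sub>t\<^sup>2 e - A\<^sup>-\<^sup>1 \<delta>\<^sub>x\<^sup>2 e\<^sup>[\<^sup>n\<^sup>] + e\<^sup>[\<^sup>n\<^sup>] = \<xi> - \<epsilon>\<^sup>p (u\<^sup>p\<^sup>+\<^sup>1 - U\<^sup>p\<^sup>+\<^sup>1)\<close>, where \<open>\<xi>\<close> is the consistency error.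
  The linear part averages over the levels \<open>n + 1\<close> and \<open>n - 1\<close>, so the inner product with
  \<open>e\<^sup>n\<^sup>+\<^sup>1 - e\<^sup>n\<^sup>-\<^sup>1\<close> telescopes into the increment of a discrete energy (\<open>energy_identity\<close>). The
  operator \<open>A\<close> is symmetric with spectrum in \<open>[2/3, 1]\<close>; hence \<open>- A\<^sup>-\<^sup>1 \<delta>\<^sub>x\<^sup>2\<close> dominates \<open>- \<delta>\<^sub>x\<^sup>2\<close>, and the
  energy controls both norms in the estimate (\<open>compact_op_bounds\<close>, \<open>stiffness_bounds\<close>).

  One time step enlarges the square root of the energy by at most \<open>\<tau>\<close> times the norm of the right-hand
  side (\<open>energy_step\<close>). As long as \<open>U\<close> is bounded, the power term contributes \<open>\<epsilon>\<^sup>p\<close> times a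
  Lipschitz constant, so over a time of length \<open>T\<^sub>0 / \<epsilon>\<^sup>p\<close> it costs a factor independent of \<open>\<epsilon>\<close>, while
  the consistency error of size \<open>\<tau>\<^sup>2 + h\<^sup>4\<close> accumulates to \<open>(\<tau>\<^sup>2 + h\<^sup>4) / \<epsilon>\<^sup>p\<close>. The bound on \<open>U\<close>
  propagates along: the energy controls the maximum of \<open>\<bar>e\<bar>\<close> at the next level
  (\<open>discrete_sobolev\<close>), and \<open>h\<^sup>4\<close> and \<open>\<tau>\<^sup>2\<close> are at most a small multiple of \<open>\<epsilon>\<^sup>p\<close>, which keeps this maximum
  below \<open>1\<close> (\<open>energy_bootstrap\<close>).

  The bound on \<open>\<xi>\<close> (\<open>consistency\<close>) is Taylor expansion, which needs derivatives at points, whereas the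
  hypotheses speak of weak derivatives. Testing against smooth approximations of indicator functions
  shows that a continuous function with a continuous weak derivative is differentiable, and that it
  is Lipschitz if the weak derivative is bounded (\<open>weak_derivative_classical\<close>,
  \<open>weak_derivative_lipschitz\<close>). Expansion across the end points \<open>a\<close> and \<open>b\<close> uses that the spatial
  derivatives take the same values there. For \<open>u\<^sub>t\<^sub>t\<close> this, and the bound on \<open>u\<^sub>t\<^sub>t\<^sub>x\<^sub>x\<close>, is read off from
  the equation, which expresses \<open>u\<^sub>t\<^sub>t\<close> through \<open>u\<close> and \<open>u\<^sub>x\<^sub>x\<close> (\<open>exact_solution_classical\<close>, \<open>q_bound\<close>).
\<close>

section \<open>Smooth bump functions\<close>

text \<open>Counting the derivatives, instead of demanding all of them at once, turns each closure property of
  smooth functions into an induction.\<close>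

primrec times_differentiable :: "nat \<Rightarrow> (real \<Rightarrow> real) \<Rightarrow> bool" where
  "times_differentiable 0 f = True"
| "times_differentiable (Suc k) f =
     (\<exists>f'. (\<forall>x. (f has_real_derivative f' x) (at x)) \<and> times_differentiable k f')"

lemma times_differentiable_SucI:
  assumes "\<And>x. (f has_real_derivative f' x) (at x)" "times_differentiable k f'"
  shows "times_differentiable (Suc k) f"
  using assms by (simp only: times_differentiable.simps) blast

definition smooth :: "(real \<Rightarrow> real) \<Rightarrow> bool" where
  "smooth f \<longleftrightarrow> (\<forall>k. times_differentiable k f)"

lemma times_differentiable_mono:
  assumes "times_differentiable (Suc k) f"
  shows "times_differentiable k f"
  using assms
proof (induction k arbitrary: f)
  case 0 then show ?case by simp
next
  case (Suc k)
  from Suc.prems obtain f' where f': "\<And>x. (f has_real_derivative f' x) (at x)" "times_differentiable (Suc k) f'"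
    by auto
  then have "times_differentiable k f'" by (intro Suc.IH)
  with f'(1) show ?case by (rule times_differentiable_SucI)
qed

lemma times_differentiable_add:
  assumes "times_differentiable k f" "times_differentiable k g"
  shows "times_differentiable k (\<lambda>x. f x + g x)"
  using assms
proof (induction k arbitrary: f g)
  case 0 then show ?case by simp
next
  case (Suc k)
  obtain f' where f': "\<And>x. (f has_real_derivative f' x) (at x)" "times_differentiable k f'"
    using Suc.prems(1) by auto
  obtain g' where g': "\<And>x. (g has_real_derivative g' x) (at x)" "times_differentiable k g'"
    using Suc.prems(2) by auto
  have "((\<lambda>x. f x + g x) has_real_derivative f' x + g' x) (at x)" for x
    by (intro DERIV_add f' g')
  moreover have "times_differentiable k (\<lambda>x. f' x + g' x)"
    by (intro Suc.IH f' g')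
  ultimately show ?case by (rule times_differentiable_SucI)
qed

lemma times_differentiable_mult:
  assumes "times_differentiable k f" "times_differentiable k g"
  shows "times_differentiable k (\<lambda>x. f x * g x)"
  using assms
proof (induction k arbitrary: f g)
  case 0 then show ?case by simp
next
  case (Suc k)
  obtain f' where f': "\<And>x. (f has_real_derivative f' x) (at x)" "times_differentiable k f'"
    using Suc.prems(1) by auto
  obtain g' where g': "\<And>x. (g has_real_derivative g' x) (at x)" "times_differentiable k g'"
    using Suc.prems(2) by auto
  have "((\<lambda>x. f x * g x) has_real_derivative f' x * g x + g' x * f x) (at x)" for x
    by (intro DERIV_mult f' g')
  moreover have "times_differentiable k (\<lambda>x. f' x * g x + g' x * f x)"
    by (intro times_differentiable_add Suc.IH f' g' Suc.prems[THEN times_differentiable_mono])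
  ultimately show ?case by (rule times_differentiable_SucI)
qed

lemma times_differentiable_const: "times_differentiable k (\<lambda>x. c)"
proof (induction k arbitrary: c)
  case 0 show ?case by simp
next
  case (Suc k)
  show ?case
    by (rule times_differentiable_SucI[where f'="\<lambda>x. 0"]) (rule DERIV_const, rule Suc.IH)
qed

lemma times_differentiable_affine:
  assumes "times_differentiable k f"
  shows "times_differentiable k (\<lambda>x. f (c * x + d))"
  using assms
proof (induction k arbitrary: f)
  case 0 then show ?case by simp
next
  case (Suc k)
  obtain f' where f': "\<And>x. (f has_real_derivative f' x) (at x)" "times_differentiable k f'"
    using Suc.prems(1) by auto
  show ?case
  proof (rule times_differentiable_SucI[where f'="\<lambda>x. f' (c * x + d) * c"])
    have "((\<lambda>x. c * x + d) has_real_derivative c) (at x)" for x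
      by (auto intro!: derivative_eq_intros)
    from DERIV_chain2[OF f'(1) this]
    show "((\<lambda>x. f (c * x + d)) has_real_derivative f' (c * x + d) * c) (at x)" for x .
    show "times_differentiable k (\<lambda>x. f' (c * x + d) * c)"
      by (rule times_differentiable_mult[OF Suc.IH[OF f'(2)] times_differentiable_const])
  qed
qed

lemma smooth_add: "smooth f \<Longrightarrow> smooth g \<Longrightarrow> smooth (\<lambda>x. f x + g x)"
  by (simp add: smooth_def times_differentiable_add)

lemma smooth_mult: "smooth f \<Longrightarrow> smooth g \<Longrightarrow> smooth (\<lambda>x. f x * g x)"
  by (simp add: smooth_def times_differentiable_mult)

lemma smooth_const: "smooth (\<lambda>x. c)"
  by (simp add: smooth_def times_differentiable_const)

lemma smooth_affine: "smooth f \<Longrightarrow> smooth (\<lambda>x. f (c * x + d))"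
  using times_differentiable_affine[of _ f c d] unfolding smooth_def by blast

lemma smooth_antideriv:
  assumes "\<And>x. (f has_real_derivative f' x) (at x)" "smooth f'"
  shows "smooth f"
proof -
  have "times_differentiable k f" for k
    using assms by (cases k) (auto intro: times_differentiable_SucI simp: smooth_def simp del: times_differentiable.simps(2))
  then show ?thesis by (simp add: smooth_def)
qed

lemma smooth_deriv:
  assumes "smooth f"
  shows "smooth (deriv f)" and "(f has_real_derivative deriv f x) (at x)"
proof -
  have *: "times_differentiable k (deriv f) \<and> (\<forall>x. (f has_real_derivative deriv f x) (at x))" for k
  proof -
    obtain f' where f': "\<And>x. (f has_real_derivative f' x) (at x)" "times_differentiable k f'"
      using assms unfolding smooth_def by (metis times_differentiable.simps(2))
    have "deriv f = f'" using f'(1) by (intro ext DERIV_imp_deriv)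
    with f' show ?thesis by simp
  qed
  show "smooth (deriv f)" "(f has_real_derivative deriv f x) (at x)"
    using * by (auto simp: smooth_def)
qed

lemma smooth_iterated_deriv: "smooth f \<Longrightarrow> smooth ((deriv ^^ k) f)"
  by (induction k) (auto intro: smooth_deriv)

text \<open>The family \<open>p(1/x) exp (-1/x)\<close> is closed under differentiation, so smoothness at \<open>0\<close> reduces
  to a single difference quotient for all members at once.\<close>

definition flat_exp :: "real poly \<Rightarrow> real \<Rightarrow> real" where
  "flat_exp p x = (if x > 0 then poly p (1 / x) * exp (- 1 / x) else 0)"

lemma poly_over_exp_tendsto_0:
  "((\<lambda>y. poly p y * exp (- y)) \<longlongrightarrow> 0) at_top" for p :: "real poly"
proof -
  have "((\<lambda>y. \<Sum>i\<le>degree p. coeff p i * (y ^ i / exp y)) \<longlongrightarrow> (\<Sum>i\<le>degree p. coeff p i * 0)) at_top"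
    by (intro tendsto_intros tendsto_power_div_exp_0)
  then show ?thesis
    by (simp add: poly_altdef sum_divide_distrib exp_minus field_simps)
qed

lemma flat_exp_has_derivative:
  "(flat_exp p has_real_derivative flat_exp ([:0, 0, 1:] * (p - pderiv p)) x) (at x)"
proof -
  consider "x > 0" | "x < 0" | "x = 0" by linarith
  then show ?thesis
  proof cases
    case 1
    have "((\<lambda>x. poly p (1 / x) * exp (- 1 / x)) has_real_derivative
        flat_exp ([:0, 0, 1:] * (p - pderiv p)) x) (at x)"
      using 1 by (auto intro!: derivative_eq_intros poly_DERIV simp: flat_exp_def field_simps power2_eq_square)
    then show ?thesis
      using 1 by (subst has_field_derivative_cong_eventually[where g="\<lambda>x. poly p (1 / x) * exp (- 1 / x)"])
        (auto simp: flat_exp_def eventually_at_filter intro!: eventually_mono[OF eventually_gt_at_top] 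
          eventually_nhds_in_open[of "{0<..}" x, THEN eventually_mono])
  next
    case 2
    have "((\<lambda>x. 0) has_real_derivative flat_exp ([:0, 0, 1:] * (p - pderiv p)) x) (at x)"
      using 2 by (simp add: flat_exp_def)
    then show ?thesis
      using 2 by (subst has_field_derivative_cong_eventually[where g="\<lambda>x. 0"])
        (auto simp: flat_exp_def eventually_at_filter intro!: 
          eventually_nhds_in_open[of "{..<0}" x, THEN eventually_mono])
  next
    case 3
    have "((\<lambda>y. flat_exp p y / y) \<longlongrightarrow> 0) (at_right 0)"
    proof -
      have "((\<lambda>y. poly ([:0, 1:] * p) (inverse y) * exp (- inverse y)) \<longlongrightarrow> 0) (at_right 0)"
        by (rule filterlim_compose[OF poly_over_exp_tendsto_0 filterlim_inverse_at_top_right])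
      then show ?thesis
        by (rule Lim_transform_eventually)
          (auto simp: flat_exp_def eventually_at_filter field_simps)
    qed
    moreover have "((\<lambda>y. flat_exp p y / y) \<longlongrightarrow> 0) (at_left 0)"
      by (rule tendsto_eventually) (auto simp: flat_exp_def eventually_at_filter)
    ultimately have "((\<lambda>y. flat_exp p y / y) \<longlongrightarrow> 0) (at 0)"
      by (rule filterlim_split_at_real[rotated])
    then show ?thesis
      using 3 by (simp add: has_field_derivative_iff) (simp add: flat_exp_def)
  qed
qed

lemma smooth_flat_exp: "smooth (flat_exp p)"
proof -
  have "times_differentiable k (flat_exp p)" for k
  proof (induction k arbitrary: p)
    case (Suc k)
    then show ?case by (intro times_differentiable_SucI[OF flat_exp_has_derivative])
  qed simp
  then show ?thesis by (simp add: smooth_def)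
qed

lemma smooth_continuous_on: "smooth f \<Longrightarrow> continuous_on S f"
  using smooth_deriv(2)[of f] by (meson DERIV_isCont continuous_at_imp_continuous_on)

text \<open>The product of \<open>flat_exp\<close> with its reflection is a bump on \<open>[-1, 1]\<close>. Its normalised
  antiderivative is the step; the derivative of the step is again the bump.\<close>

lemma smooth_step_exists:
  obtains H :: "real \<Rightarrow> real" where "smooth H" "\<And>x. 0 \<le> deriv H x"
    "\<And>x. x \<le> -1 \<Longrightarrow> H x = 0" "\<And>x. 1 \<le> x \<Longrightarrow> H x = 1"
    "\<And>x. \<bar>x\<bar> \<ge> 1 \<Longrightarrow> deriv H x = 0"
proof -
  define \<eta> where "\<eta> x = flat_exp 1 (1 * x + 1) * flat_exp 1 ((-1) * x + 1)" for x
  have sm: "smooth \<eta>" unfolding \<eta>_def by (rule smooth_mult[OF smooth_affine smooth_affine]) (rule smooth_flat_exp)+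
  have nn: "\<eta> x \<ge> 0" for x by (simp add: \<eta>_def flat_exp_def)
  have z: "\<eta> x = 0" if "\<bar>x\<bar> \<ge> 1" for x using that by (auto simp: \<eta>_def flat_exp_def)
  have pos: "\<eta> x > 0" if "\<bar>x\<bar> < 1" for x using that by (auto simp: \<eta>_def flat_exp_def)
  define F where "F x = integral {-2..x} \<eta>" for x
  have int: "\<eta> integrable_on {c..d}" for c d
    by (intro integrable_continuous_interval smooth_continuous_on sm)
  have F0: "F x = 0" if "x \<le> -1" for x
  proof -
    have "integral {-2..x} \<eta> = integral {-2..x} (\<lambda>_. 0)"
      using that by (intro Henstock_Kurzweil_Integration.integral_cong) (auto simp: z)
    then show ?thesis by (simp add: F_def)
  qed
  have dF: "(F has_real_derivative \<eta> x) (at x)" for x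
  proof (cases "x < -1")
    case True
    have "((\<lambda>x. 0) has_real_derivative \<eta> x) (at x)"
      using True by (simp add: z)
    then show ?thesis
      using True by (subst has_field_derivative_cong_eventually[where g="\<lambda>x. 0"])
        (auto simp: F0 eventually_at_filter intro!: 
          eventually_nhds_in_open[of "{..<-1}" x, THEN eventually_mono])
  next
    case False
    have "(F has_real_derivative \<eta> x) (at x within {-2..x+1})"
      unfolding F_def using False
      by (intro integral_has_real_derivative smooth_continuous_on sm) auto
    moreover have "x \<in> interior {-2..x+1}" using False by simp
    ultimately show ?thesis by (metis at_within_interior)
  qed
  have smF: "smooth F" by (rule smooth_antideriv[OF dF sm])
  have Fc: "F x = F 1" if "x \<ge> 1" for x
  proof -
    have "F 1 + integral {1..x} \<eta> = F x" unfolding F_def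
      using that by (intro Henstock_Kurzweil_Integration.integral_combine int) auto
    moreover have "integral {1..x} \<eta> = integral {1..x} (\<lambda>_. 0)"
      by (intro Henstock_Kurzweil_Integration.integral_cong) (auto simp: z)
    ultimately show ?thesis by simp
  qed
  have F1: "F 1 > 0"
  proof -
    have "F (-1) < F 1"
      by (rule DERIV_pos_imp_increasing_open[where f=F])
        (use dF pos in \<open>auto intro!: exI smooth_continuous_on smF\<close>)
    then show ?thesis by (simp add: F0)
  qed
  define H where "H x = (1 / F 1) * F x" for x
  have dH: "(H has_real_derivative (1 / F 1) * \<eta> x) (at x)" for x
    unfolding H_def by (intro DERIV_cmult dF)
  then have [simp]: "deriv H x = (1 / F 1) * \<eta> x" for x by (rule DERIV_imp_deriv)
  show ?thesis
  proof (rule that[of H])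
    show "smooth H" unfolding H_def by (intro smooth_mult smooth_const smF)
    show "H x = 1" if "1 \<le> x" for x
      using F1 by (simp only: H_def Fc[OF that]) simp
  qed (use F1 nn z F0 in \<open>auto simp: H_def\<close>)
qed

section \<open>Weak derivatives with continuous representatives\<close>

lemma test_functionsI:
  assumes "smooth \<psi>" "a < c" "c \<le> d" "d < b" "\<And>x. x \<notin> {c..d} \<Longrightarrow> \<psi> x = 0"
  shows "\<psi> \<in> test_functions a b"
proof -
  have "(deriv ^^ k) \<psi> field_differentiable at x" for k x
    using smooth_deriv(2)[OF smooth_iterated_deriv[OF assms(1)]]
    by (auto simp: field_differentiable_def)
  with assms show ?thesis unfolding test_functions_def by blast
qed

lemma deriv_test_functions:
  assumes "\<psi> \<in> test_functions a b"
  shows "deriv \<psi> \<in> test_functions a b"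
proof -
  obtain c d where cd: "a < c" "c \<le> d" "d < b" "\<And>x. x \<notin> {c..d} \<Longrightarrow> \<psi> x = 0"
    and sm: "\<And>k x. (deriv ^^ k) \<psi> field_differentiable at x"
    using assms unfolding test_functions_def by blast
  have "deriv \<psi> x = 0" if x: "x \<notin> {c..d}" for x
  proof -
    have "open (- {c..d})" by (simp add: open_Compl)
    have "(\<psi> has_field_derivative 0) (at x)"
      by (rule has_field_derivative_transform_within_open[where f="\<lambda>_. 0" and S="- {c..d}"])
        (use x cd(4) \<open>open (- {c..d})\<close> in auto)
    then show ?thesis by (rule DERIV_imp_deriv)
  qed
  moreover have "(deriv ^^ k) (deriv \<psi>) field_differentiable at x" for k x
    using sm[of "Suc k" x] by (simp add: funpow_swap1)
  ultimately show ?thesis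
    using cd unfolding test_functions_def by blast
qed

lemma test_function_continuous_on:
  assumes "\<psi> \<in> test_functions a b"
  shows "continuous_on S \<psi>"
proof -
  have "(deriv ^^ 0) \<psi> field_differentiable at x" for x
    using assms unfolding test_functions_def by blast
  then show ?thesis
    by (auto intro!: continuous_at_imp_continuous_on field_differentiable_imp_continuous_at)
qed

lemma test_function_has_derivative:
  assumes "\<psi> \<in> test_functions a b"
  shows "(\<psi> has_real_derivative deriv \<psi> x) (at x)"
proof -
  have "(deriv ^^ 0) \<psi> field_differentiable at x"
    using assms unfolding test_functions_def by blast
  then show ?thesis by (simp add: DERIV_deriv_iff_field_differentiable)
qed

text \<open>One fixed step is chosen, so that all test functions below are its translates and dilates.\<close>

definition smooth_step :: "real \<Rightarrow> real" where
  "smooth_step = (SOME H. smooth H \<and> (\<forall>x. 0 \<le> deriv H x) \<and> (\<forall>x\<le>-1. H x = 0) \<and>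
     (\<forall>x\<ge>1. H x = 1) \<and> (\<forall>x. \<bar>x\<bar> \<ge> 1 \<longrightarrow> deriv H x = 0))"

lemma smooth_step:
  shows "smooth smooth_step" "0 \<le> deriv smooth_step x"
    "x \<le> -1 \<Longrightarrow> smooth_step x = 0" "1 \<le> x \<Longrightarrow> smooth_step x = 1"
    "\<bar>x\<bar> \<ge> 1 \<Longrightarrow> deriv smooth_step x = 0"
proof -
  have "\<exists>H. smooth H \<and> (\<forall>x. 0 \<le> deriv H x) \<and> (\<forall>x\<le>-1. H x = 0) \<and>
     (\<forall>x\<ge>1. H x = 1) \<and> (\<forall>x. \<bar>x\<bar> \<ge> 1 \<longrightarrow> deriv H x = 0)"
    using smooth_step_exists by metis
  from someI_ex[OF this, folded smooth_step_def]
  show "smooth smooth_step" "0 \<le> deriv smooth_step x"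
    "x \<le> -1 \<Longrightarrow> smooth_step x = 0" "1 \<le> x \<Longrightarrow> smooth_step x = 1"
    "\<bar>x\<bar> \<ge> 1 \<Longrightarrow> deriv smooth_step x = 0"
    by auto
qed

lemma mono_smooth_step: "x \<le> y \<Longrightarrow> smooth_step x \<le> smooth_step y"
  using DERIV_nonneg_imp_nondecreasing[of x y smooth_step] smooth_step(2) smooth_deriv(2)[OF smooth_step(1)]
  by blast

definition step_at :: "real \<Rightarrow> real \<Rightarrow> real \<Rightarrow> real" where
  "step_at \<delta> x s = smooth_step ((1 / \<delta>) * s + - (x / \<delta>))"

definition kernel_at :: "real \<Rightarrow> real \<Rightarrow> real \<Rightarrow> real" where
  "kernel_at \<delta> x s = deriv smooth_step ((1 / \<delta>) * s + - (x / \<delta>)) * (1 / \<delta>)"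

lemma smooth_step_at: "smooth (step_at \<delta> x)"
  unfolding step_at_def by (rule smooth_affine[OF smooth_step(1)])

lemma smooth_kernel_at: "smooth (kernel_at \<delta> x)"
  unfolding kernel_at_def
  by (rule smooth_mult[OF smooth_affine[OF smooth_deriv(1)[OF smooth_step(1)]] smooth_const])

lemma step_at_has_derivative: "(step_at \<delta> x has_real_derivative kernel_at \<delta> x s) (at s)"
proof -
  have "((\<lambda>s. (1 / \<delta>) * s + - (x / \<delta>)) has_real_derivative 1 / \<delta>) (at s)"
    by (auto intro!: derivative_eq_intros simp: divide_inverse)
  from DERIV_chain2[OF smooth_deriv(2)[OF smooth_step(1)] this]
  show ?thesis unfolding step_at_def kernel_at_def .
qed

lemma step_at_values:
  assumes "\<delta> > 0"
  shows "s \<le> x - \<delta> \<Longrightarrow> step_at \<delta> x s = 0" "x + \<delta> \<le> s \<Longrightarrow> step_at \<delta> x s = 1"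
    "x \<le> y \<Longrightarrow> step_at \<delta> y s \<le> step_at \<delta> x s" "kernel_at \<delta> x s \<ge> 0"
    "\<bar>s - x\<bar> \<ge> \<delta> \<Longrightarrow> kernel_at \<delta> x s = 0"
proof -
  have eq: "(1 / \<delta>) * s + - (x / \<delta>) = (s - x) / \<delta>" for s x by (simp add: diff_divide_distrib)
  show "s \<le> x - \<delta> \<Longrightarrow> step_at \<delta> x s = 0" "x + \<delta> \<le> s \<Longrightarrow> step_at \<delta> x s = 1"
    using assms unfolding step_at_def eq
    by (auto intro!: smooth_step simp: field_simps)
  show "x \<le> y \<Longrightarrow> step_at \<delta> y s \<le> step_at \<delta> x s"
    using assms unfolding step_at_def eq
    by (auto intro!: mono_smooth_step simp: divide_right_mono)
  show "kernel_at \<delta> x s \<ge> 0"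
    using assms smooth_step(2) unfolding kernel_at_def by simp
  show "\<bar>s - x\<bar> \<ge> \<delta> \<Longrightarrow> kernel_at \<delta> x s = 0"
    using assms smooth_step(5)[of "(s - x) / \<delta>"] unfolding kernel_at_def eq by simp
qed

lemma integral_kernel_at:
  assumes "\<delta> > 0" "a \<le> x - \<delta>" "x + \<delta> \<le> b"
  shows "integral {a..b} (kernel_at \<delta> x) = 1"
proof -
  have "(kernel_at \<delta> x has_integral (step_at \<delta> x b - step_at \<delta> x a)) {a..b}"
    using assms step_at_has_derivative
    by (intro fundamental_theorem_of_calculus)
      (auto simp: has_real_derivative_iff_has_vector_derivative[symmetric] has_field_derivative_at_within)
  then show ?thesis
    using assms step_at_values[OF assms(1)] by (simp add: integral_unique)
qed

text \<open>The kernels are an approximate identity at interior points: they are nonnegative with integral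
  \<open>1\<close>, and on their support a continuous function is nearly constant.\<close>

lemma kernel_at_approximates:
  assumes f: "continuous_on {a..b} f" and x: "a < x" "x < b" and e: "e > 0"
  obtains \<delta>0 where "\<delta>0 > 0" "\<And>\<delta>. 0 < \<delta> \<Longrightarrow> \<delta> < \<delta>0 \<Longrightarrow> a < x - \<delta> \<and> x + \<delta> < b \<and>
      \<bar>integral {a..b} (\<lambda>s. f s * kernel_at \<delta> x s) - f x\<bar> \<le> e"
proof -
  obtain d where d: "d > 0" "\<And>s. s \<in> {a..b} \<Longrightarrow> dist s x < d \<Longrightarrow> dist (f s) (f x) < e"
    using f x e unfolding continuous_on_iff by (metis atLeastAtMost_iff less_imp_le)
  define \<delta>0 where "\<delta>0 = min d (min (x - a) (b - x))"
  have "a < x - \<delta> \<and> x + \<delta> < b \<and>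
      \<bar>integral {a..b} (\<lambda>s. f s * kernel_at \<delta> x s) - f x\<bar> \<le> e" if \<delta>: "0 < \<delta>" "\<delta> < \<delta>0" for \<delta>
  proof (intro conjI)
    show in_ab: "a < x - \<delta>" "x + \<delta> < b" using \<delta> by (auto simp: \<delta>0_def)
    have I: "integral {a..b} (kernel_at \<delta> x) = 1"
      using in_ab \<delta> by (intro integral_kernel_at) auto
    have ck: "continuous_on {a..b} (kernel_at \<delta> x)"
      by (rule smooth_continuous_on[OF smooth_kernel_at])
    have "integral {a..b} (\<lambda>s. f s * kernel_at \<delta> x s) - f x
        = integral {a..b} (\<lambda>s. f s * kernel_at \<delta> x s) - integral {a..b} (\<lambda>s. f x * kernel_at \<delta> x s)"
      by (simp add: I)
    also have "\<dots> = integral {a..b} (\<lambda>s. f s * kernel_at \<delta> x s - f x * kernel_at \<delta> x s)"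
      by (rule Henstock_Kurzweil_Integration.integral_diff[symmetric];
          intro integrable_continuous_interval continuous_intros f ck)
    also have "norm \<dots> \<le> integral {a..b} (\<lambda>s. e * kernel_at \<delta> x s)"
    proof (rule Henstock_Kurzweil_Integration.integral_norm_bound_integral)
      fix s assume s: "s \<in> {a..b}"
      show "norm (f s * kernel_at \<delta> x s - f x * kernel_at \<delta> x s) \<le> e * kernel_at \<delta> x s"
      proof (cases "\<bar>s - x\<bar> < \<delta>")
        case True
        then have "\<bar>f s - f x\<bar> \<le> e" using d(2)[OF s] \<delta> by (auto simp: dist_real_def \<delta>0_def)
        then show ?thesis
          using step_at_values(4)[OF \<delta>(1), of x s]
          by (simp add: left_diff_distrib[symmetric] abs_mult mult_right_mono)
      next
        case False
        then show ?thesis using step_at_values(5)[OF \<delta>(1), of s x] by simp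
      qed
    qed (intro integrable_continuous_interval continuous_intros f ck)+
    also have "\<dots> = e" by (simp add: I)
    finally show "\<bar>integral {a..b} (\<lambda>s. f s * kernel_at \<delta> x s) - f x\<bar> \<le> e" by simp
  qed
  moreover have "\<delta>0 > 0" using d x by (auto simp: \<delta>0_def)
  ultimately show ?thesis using that by blast
qed

lemma LINT_continuous_eq_integral:
  fixes f :: "real \<Rightarrow> real"
  assumes "continuous_on {a..b} f"
  shows "set_integrable lebesgue {a<..<b} f"
    and "(LINT x:{a<..<b}|lebesgue. f x) = integral {a..b} f"
proof -
  have "set_integrable lebesgue {a..b} f"
    using assms by (rule absolutely_integrable_continuous_real)
  then show *: "set_integrable lebesgue {a<..<b} f"
    by (rule set_integrable_subset) auto
  show "(LINT x:{a<..<b}|lebesgue. f x) = integral {a..b} f"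
    using set_lebesgue_integral_eq_integral(2)[OF *] by (simp add: integral_open_interval_real)
qed

lemma LINT_localise:
  fixes g \<psi> :: "real \<Rightarrow> real"
  assumes "a < c" "d < b" "\<And>x. x \<notin> {c..d} \<Longrightarrow> \<psi> x = 0"
  shows "(LINT x:{a<..<b}|lebesgue. g x * \<psi> x) = (LINT x:{c..d}|lebesgue. g x * \<psi> x)"
  unfolding set_lebesgue_integral_def
  using assms by (intro Bochner_Integration.integral_cong) (auto simp: indicator_def)

text \<open>A locally integrable function need not be integrable up to the end points, so the integral is
  first confined to a compact interval that carries the test function.\<close>

lemma LINT_test_bound:
  fixes g \<psi> :: "real \<Rightarrow> real"
  assumes g: "locally_integrable a b g" and K: "AE x in lebesgue. x \<in> {a<..<b} \<longrightarrow> \<bar>g x\<bar> \<le> K"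
    and \<psi>: "continuous_on UNIV \<psi>" "\<And>x. \<psi> x \<ge> 0"
    and cd: "a < c" "d < b" "\<And>x. x \<notin> {c..d} \<Longrightarrow> \<psi> x = 0"
  shows "\<bar>LINT x:{a<..<b}|lebesgue. g x * \<psi> x\<bar> \<le> K * integral {c..d} \<psi>"
proof -
  have \<psi>c: "continuous_on {c..d} \<psi>" using \<psi>(1) by (rule continuous_on_subset) simp
  have gi: "set_integrable lebesgue {c..d} g" using g cd unfolding locally_integrable_def by blast
  have "(\<lambda>x. \<psi> x * g x) absolutely_integrable_on {c..d}"
    by (rule absolutely_integrable_bounded_measurable_product_real)
      (use \<psi>c gi in \<open>auto intro!: continuous_imp_measurable_on_sets_lebesgue compact_imp_bounded compact_continuous_image\<close>)
  then have i1: "set_integrable lebesgue {c..d} (\<lambda>x. g x * \<psi> x)" by (simp add: mult.commute)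
  have i2: "set_integrable lebesgue {c..d} (\<lambda>x. K * \<psi> x)"
    by (intro absolutely_integrable_continuous_real continuous_intros \<psi>c)
  have "\<bar>LINT x:{c..d}|lebesgue. g x * \<psi> x\<bar> \<le> (LINT x:{c..d}|lebesgue. \<bar>g x * \<psi> x\<bar>)"
    using set_integral_norm_bound[OF i1] by simp
  also have "\<dots> \<le> (LINT x:{c..d}|lebesgue. K * \<psi> x)"
  proof (rule set_integral_mono_AE)
    show "AE x\<in>{c..d} in lebesgue. \<bar>g x * \<psi> x\<bar> \<le> K * \<psi> x"
      using K by eventually_elim (use cd \<psi>(2) in \<open>auto simp: abs_mult mult_right_mono\<close>)
  qed (use i1 i2 in \<open>auto simp: set_integrable_abs\<close>)
  also have "\<dots> = integral {c..d} (\<lambda>x. K * \<psi> x)"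
    by (rule set_lebesgue_integral_eq_integral(2)[OF i2])
  also have "\<dots> = K * integral {c..d} \<psi>" by simp
  finally show ?thesis by (subst LINT_localise[where c=c and d=d]) (use cd in auto)
qed

lemma Linf_norm_AE:
  assumes "Linf_norm a b g \<le> ereal K"
  shows "AE x in lebesgue. x \<in> {a<..<b} \<longrightarrow> \<bar>g x\<bar> \<le> K"
proof -
  have "AE x in lebesgue_on {a<..<b}. ereal \<bar>g x\<bar> \<le> Linf_norm a b g"
    unfolding Linf_norm_def by (rule esssup_AE)
  then have "AE x in lebesgue_on {a<..<b}. \<bar>g x\<bar> \<le> K"
    by eventually_elim (metis assms ereal_less_eq(3) order_trans)
  then show ?thesis by (simp add: AE_restrict_space_iff)
qed

lemma Linf_norm_le:
  assumes "continuous_on {a..b} f" "\<And>x. x \<in> {a<..<b} \<Longrightarrow> \<bar>f x\<bar> \<le> K"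
  shows "Linf_norm a b f \<le> ereal K"
  unfolding Linf_norm_def
proof (rule esssup_I)
  have "continuous_on {a<..<b} f" using assms(1) by (rule continuous_on_subset) auto
  then have "f \<in> borel_measurable (lebesgue_on {a<..<b})"
    by (intro continuous_imp_measurable_on_sets_lebesgue) auto
  then show "(\<lambda>x. ereal \<bar>f x\<bar>) \<in> borel_measurable (lebesgue_on {a<..<b})" by measurable
  show "AE x in lebesgue_on {a<..<b}. ereal \<bar>f x\<bar> \<le> ereal K"
    using assms(2) by (intro AE_I2) auto
qed

lemma continuous_locally_integrable:
  assumes "continuous_on {a..b} f"
  shows "locally_integrable a b f"
  unfolding locally_integrable_def
  by (auto intro!: absolutely_integrable_continuous_real continuous_on_subset[OF assms])

lemma has_weak_deriv_refl:
  assumes "continuous_on {a..b} f"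
  shows "has_weak_deriv a b 0 f f"
  using continuous_locally_integrable[OF assms] by (simp add: has_weak_deriv_def)

lemma has_weak_deriv_unique:
  assumes "has_weak_deriv a b k f g" "has_weak_deriv a b k f g'"
  shows "has_weak_deriv a b 0 g g'"
  using assms unfolding has_weak_deriv_def by auto

lemma has_weak_deriv_cong:
  assumes "\<And>x. x \<in> {a<..<b} \<Longrightarrow> f x = f' x" "has_weak_deriv a b k f g" "locally_integrable a b f'"
  shows "has_weak_deriv a b k f' g"
proof -
  have "(LINT x:{a<..<b}|lebesgue. f x * \<psi> x) = (LINT x:{a<..<b}|lebesgue. f' x * \<psi> x)" for \<psi>
    by (rule set_lebesgue_integral_cong) (use assms(1) in auto)
  then show ?thesis using assms(2,3) unfolding has_weak_deriv_def by simp
qed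

text \<open>The derivative of a test function is a test function; inserting it into the definition for order
  \<open>k\<close> gives the pairing for order \<open>k + 1\<close>.\<close>

lemma has_weak_deriv_Suc:
  assumes "has_weak_deriv a b k f g" "has_weak_deriv a b (Suc k) f g'"
  shows "has_weak_deriv a b 1 g g'"
proof -
  have "(LINT x:{a<..<b}|lebesgue. g x * deriv \<psi> x) = - (LINT x:{a<..<b}|lebesgue. g' x * \<psi> x)"
    if \<psi>: "\<psi> \<in> test_functions a b" for \<psi>
  proof -
    have "(LINT x:{a<..<b}|lebesgue. f x * (deriv ^^ k) (deriv \<psi>) x) =
      (-1) ^ k * (LINT x:{a<..<b}|lebesgue. g x * deriv \<psi> x)"
      using assms(1) deriv_test_functions[OF \<psi>] unfolding has_weak_deriv_def by blast
    moreover have "(LINT x:{a<..<b}|lebesgue. f x * (deriv ^^ Suc k) \<psi> x) =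
      (-1) ^ Suc k * (LINT x:{a<..<b}|lebesgue. g' x * \<psi> x)"
      using assms(2) \<psi> unfolding has_weak_deriv_def by blast
    ultimately have "(-1) ^ k * (LINT x:{a<..<b}|lebesgue. g x * deriv \<psi> x)
        = (-1) ^ k * (- (LINT x:{a<..<b}|lebesgue. g' x * \<psi> x))"
      by (simp add: funpow_swap1)
    then show ?thesis by (subst (asm) mult_cancel_left) auto
  qed
  then show ?thesis using assms unfolding has_weak_deriv_def by simp
qed

text \<open>Pairing with a kernel reproduces the value of \<open>f\<close> up to \<open>e\<close>, and the pairing of \<open>g\<close> with a kernel
  is at most its essential bound. This is how essential bounds become bounds at every point.\<close>

lemma bounded_by_weak_representative:
  assumes "a < b" and f: "continuous_on {a..b} f" and fg: "has_weak_deriv a b 0 f g"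
    and K: "Linf_norm a b g \<le> ereal K" and x: "x \<in> {a..b}"
  shows "\<bar>f x\<bar> \<le> K"
proof -
  have "\<bar>f y\<bar> \<le> K" if y: "a < y" "y < b" for y
  proof (rule field_le_epsilon)
    fix e :: real assume e: "e > 0"
    obtain \<delta>0 where \<delta>0: "\<delta>0 > 0" "\<And>\<delta>. 0 < \<delta> \<Longrightarrow> \<delta> < \<delta>0 \<Longrightarrow> a < y - \<delta> \<and> y + \<delta> < b \<and>
      \<bar>integral {a..b} (\<lambda>s. f s * kernel_at \<delta> y s) - f y\<bar> \<le> e"
      using kernel_at_approximates[OF f y e] by metis
    define \<delta> where "\<delta> = \<delta>0 / 2"
    have \<delta>: "\<delta> > 0" "a < y - \<delta>" "y + \<delta> < b"
      "\<bar>integral {a..b} (\<lambda>s. f s * kernel_at \<delta> y s) - f y\<bar> \<le> e"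
      using \<delta>0 by (auto simp: \<delta>_def)
    have z: "kernel_at \<delta> y s = 0" if "s \<notin> {y - \<delta>..y + \<delta>}" for s
      using that \<delta>(1) by (intro step_at_values(5)) auto
    have test: "kernel_at \<delta> y \<in> test_functions a b"
      by (rule test_functionsI[OF smooth_kernel_at \<delta>(2) _ \<delta>(3) z]) (use \<delta>(1) in auto)
    have ck: "continuous_on S (kernel_at \<delta> y)" for S
      by (rule smooth_continuous_on[OF smooth_kernel_at])
    have "integral {a..b} (\<lambda>s. f s * kernel_at \<delta> y s) = (LINT s:{a<..<b}|lebesgue. f s * kernel_at \<delta> y s)"
      by (rule LINT_continuous_eq_integral(2)[symmetric]) (intro continuous_intros f ck)
    also have "\<dots> = (LINT s:{a<..<b}|lebesgue. g s * kernel_at \<delta> y s)"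
      using fg test unfolding has_weak_deriv_def by simp
    also have "\<bar>\<dots>\<bar> \<le> K * integral {y - \<delta>..y + \<delta>} (kernel_at \<delta> y)"
      by (rule LINT_test_bound[OF _ Linf_norm_AE[OF K] ck])
        (use fg \<delta> z step_at_values(4)[OF \<delta>(1)] in \<open>auto simp: has_weak_deriv_def\<close>)
    also have "integral {y - \<delta>..y + \<delta>} (kernel_at \<delta> y) = 1"
      using \<delta> by (intro integral_kernel_at) auto
    finally show "\<bar>f y\<bar> \<le> K + e" using \<delta>(4) by linarith
  qed
  then show ?thesis
    using continuous_on_closure_norm_le[of "{a<..<b}" f K x] f x \<open>a < b\<close> by auto
qed

lemma le_on_closed_interval:
  fixes f :: "real \<Rightarrow> real"
  assumes "a < b" "continuous_on {a..b} f" "\<And>x. a < x \<Longrightarrow> x < b \<Longrightarrow> f x \<le> K" "x \<in> {a..b}"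
  shows "f x \<le> K"
  by (rule continuous_le_on_closure[of "{a<..<b}" f x K]) (use assms in auto)

text \<open>The test function is a smoothed indicator of \<open>[x, y]\<close>: its derivative is the difference of two
  kernels, which reproduces \<open>f x - f y\<close>, and its integral is close to \<open>y - x\<close>.\<close>

lemma weak_derivative_lipschitz:
  assumes "a < b" and f: "continuous_on {a..b} f" and fg: "has_weak_deriv a b 1 f g"
    and K: "Linf_norm a b g \<le> ereal K" "K \<ge> 0" and x: "x \<in> {a..b}" and y: "y \<in> {a..b}"
  shows "\<bar>f y - f x\<bar> \<le> K * \<bar>y - x\<bar>"
proof -
  have ordered: "\<bar>f y - f x\<bar> \<le> K * (y - x)" if xy: "a < x" "x < y" "y < b" for x y
  proof (rule field_le_epsilon)
    fix e :: real assume e: "e > 0"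
    obtain \<delta>1 where \<delta>1: "\<delta>1 > 0" "\<And>\<delta>. 0 < \<delta> \<Longrightarrow> \<delta> < \<delta>1 \<Longrightarrow> a < x - \<delta> \<and> x + \<delta> < b \<and>
      \<bar>integral {a..b} (\<lambda>s. f s * kernel_at \<delta> x s) - f x\<bar> \<le> e / 3"
      using kernel_at_approximates[OF f, of x "e / 3"] xy e by auto
    obtain \<delta>2 where \<delta>2: "\<delta>2 > 0" "\<And>\<delta>. 0 < \<delta> \<Longrightarrow> \<delta> < \<delta>2 \<Longrightarrow> a < y - \<delta> \<and> y + \<delta> < b \<and>
      \<bar>integral {a..b} (\<lambda>s. f s * kernel_at \<delta> y s) - f y\<bar> \<le> e / 3"
      using kernel_at_approximates[OF f, of y "e / 3"] xy e by auto
    \<comment> \<open>The last entry makes the smoothing error \<open>2 * \<delta> * K\<close> at most \<open>e / 3\<close>.\<close>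
    define \<delta> where "\<delta> = min (min \<delta>1 \<delta>2) (e / (3 * (K + 1))) / 2"
    have \<delta>: "\<delta> > 0" "a < x - \<delta>" "y + \<delta> < b"
      and fx: "\<bar>integral {a..b} (\<lambda>s. f s * kernel_at \<delta> x s) - f x\<bar> \<le> e / 3"
      and fy: "\<bar>integral {a..b} (\<lambda>s. f s * kernel_at \<delta> y s) - f y\<bar> \<le> e / 3"
    proof -
      show p: "\<delta> > 0" using \<delta>1(1) \<delta>2(1) e K(2) by (simp add: \<delta>_def)
      have "\<delta> < \<delta>1" "\<delta> < \<delta>2" using p \<delta>1(1) \<delta>2(1) by (auto simp: \<delta>_def)
      then show "a < x - \<delta>" "y + \<delta> < b"
        "\<bar>integral {a..b} (\<lambda>s. f s * kernel_at \<delta> x s) - f x\<bar> \<le> e / 3"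
        "\<bar>integral {a..b} (\<lambda>s. f s * kernel_at \<delta> y s) - f y\<bar> \<le> e / 3"
        using \<delta>1(2)[OF p] \<delta>2(2)[OF p] by auto
    qed
    have K\<delta>: "K * (2 * \<delta>) \<le> e / 3"
    proof -
      have "2 * \<delta> \<le> e / (3 * (K + 1))" by (simp add: \<delta>_def)
      then have "K * (2 * \<delta>) \<le> (K + 1) * (e / (3 * (K + 1)))"
        using e \<delta>(1) K(2) by (intro mult_mono) auto
      also have "\<dots> = e / 3" using K(2) by (simp add: divide_simps)
      finally show ?thesis .
    qed
    define \<psi> where "\<psi> s = step_at \<delta> x s + (-1) * step_at \<delta> y s" for s
    have sm: "smooth \<psi>"
      unfolding \<psi>_def
      by (rule smooth_add[OF smooth_step_at smooth_mult[OF smooth_const smooth_step_at]])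
    have z: "\<psi> s = 0" if "s \<notin> {x - \<delta>..y + \<delta>}" for s
    proof -
      from that consider "s \<le> x - \<delta>" | "y + \<delta> \<le> s" by fastforce
      then show ?thesis
      proof cases
        case 1
        then have "s \<le> y - \<delta>" using xy by linarith
        with 1 show ?thesis by (simp add: \<psi>_def step_at_values(1)[OF \<delta>(1)])
      next
        case 2
        then have "x + \<delta> \<le> s" using xy by linarith
        with 2 show ?thesis by (simp add: \<psi>_def step_at_values(2)[OF \<delta>(1)])
      qed
    qed
    have test: "\<psi> \<in> test_functions a b"
      by (rule test_functionsI[OF sm \<delta>(2) _ \<delta>(3) z]) (use xy \<delta>(1) in auto)
    have nn: "\<psi> s \<ge> 0" for s
      using step_at_values(3)[OF \<delta>(1), of x y s] xy by (simp add: \<psi>_def)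
    have le1: "\<psi> s \<le> 1" for s
    proof -
      have "0 \<le> step_at \<delta> y s" "step_at \<delta> x s \<le> 1"
        using mono_smooth_step[of "(1 / \<delta>) * s + - (x / \<delta>)" "max 1 ((1 / \<delta>) * s + - (x / \<delta>))"]
          mono_smooth_step[of "min (-1) ((1 / \<delta>) * s + - (y / \<delta>))" "(1 / \<delta>) * s + - (y / \<delta>)"]
        by (auto simp: step_at_def smooth_step(3,4))
      then show ?thesis by (simp add: \<psi>_def)
    qed
    have c\<psi>: "continuous_on S \<psi>" for S by (rule smooth_continuous_on[OF sm])
    have d\<psi>: "deriv \<psi> s = kernel_at \<delta> x s - kernel_at \<delta> y s" for s
      unfolding \<psi>_def
      by (rule DERIV_imp_deriv) (auto intro!: derivative_eq_intros step_at_has_derivative)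
    have ck: "continuous_on S (kernel_at \<delta> z)" for S z
      by (rule smooth_continuous_on[OF smooth_kernel_at])
    have int\<psi>: "integral {x - \<delta>..y + \<delta>} \<psi> \<le> y - x + 2 * \<delta>"
    proof -
      have "integral {x - \<delta>..y + \<delta>} \<psi> \<le> integral {x - \<delta>..y + \<delta>} (\<lambda>_. 1)"
        by (rule integral_le) (auto intro!: integrable_continuous_interval c\<psi> le1)
      then show ?thesis using xy \<delta>(1) by simp
    qed
    have "integral {a..b} (\<lambda>s. f s * kernel_at \<delta> x s) - integral {a..b} (\<lambda>s. f s * kernel_at \<delta> y s)
        = integral {a..b} (\<lambda>s. f s * kernel_at \<delta> x s - f s * kernel_at \<delta> y s)"
      by (rule Henstock_Kurzweil_Integration.integral_diff[symmetric];
          intro integrable_continuous_interval continuous_intros f ck)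
    also have "\<dots> = (LINT s:{a<..<b}|lebesgue. f s * kernel_at \<delta> x s - f s * kernel_at \<delta> y s)"
      by (rule LINT_continuous_eq_integral(2)[symmetric]) (intro continuous_intros f ck)
    also have "\<dots> = (LINT s:{a<..<b}|lebesgue. f s * (deriv ^^ 1) \<psi> s)"
      by (simp add: d\<psi> right_diff_distrib)
    also have "\<dots> = (-1) ^ 1 * (LINT s:{a<..<b}|lebesgue. g s * \<psi> s)"
      using fg test unfolding has_weak_deriv_def by blast
    finally have "\<bar>integral {a..b} (\<lambda>s. f s * kernel_at \<delta> x s) - integral {a..b} (\<lambda>s. f s * kernel_at \<delta> y s)\<bar>
        = \<bar>LINT s:{a<..<b}|lebesgue. g s * \<psi> s\<bar>" by simp
    also have "\<dots> \<le> K * integral {x - \<delta>..y + \<delta>} \<psi>"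
      by (rule LINT_test_bound[OF _ Linf_norm_AE[OF K(1)] c\<psi> nn])
        (use fg \<delta> z in \<open>auto simp: has_weak_deriv_def\<close>)
    also have "\<dots> \<le> K * (y - x) + e / 3"
    proof -
      have "K * integral {x - \<delta>..y + \<delta>} \<psi> \<le> K * (y - x + 2 * \<delta>)"
        using int\<psi> K(2) by (intro mult_left_mono) auto
      then show ?thesis using K\<delta> by (simp add: algebra_simps)
    qed
    finally show "\<bar>f y - f x\<bar> \<le> K * (y - x) + e" using fx fy by linarith
  qed
  have interior: "\<bar>f y - f x\<bar> - K * \<bar>y - x\<bar> \<le> 0" if "a < x" "x < b" "a < y" "y < b" for x y
    using ordered[of x y] ordered[of y x] that by (cases x y rule: linorder_cases) auto
  have half: "\<bar>f y - f x\<bar> - K * \<bar>y - x\<bar> \<le> 0" if "a < x" "x < b" "y \<in> {a..b}" for x y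
    by (rule le_on_closed_interval[OF \<open>a < b\<close>, where f="\<lambda>y. \<bar>f y - f x\<bar> - K * \<bar>y - x\<bar>"])
      (use interior that in \<open>auto intro!: continuous_intros f\<close>)
  have "\<bar>f y - f x\<bar> - K * \<bar>y - x\<bar> \<le> 0"
    by (rule le_on_closed_interval[OF \<open>a < b\<close>, where f="\<lambda>x. \<bar>f y - f x\<bar> - K * \<bar>y - x\<bar>"])
      (use half x y in \<open>auto intro!: continuous_intros f\<close>)
  then show ?thesis by simp
qed

text \<open>The difference of \<open>f\<close> and an antiderivative of \<open>g\<close> has weak derivative \<open>0\<close>, hence Lipschitz
  constant \<open>0\<close>.\<close>

lemma weak_derivative_classical:
  assumes "a < b" and f: "continuous_on {a..b} f" and g: "continuous_on {a..b} g"
    and fg: "has_weak_deriv a b 1 f g" and x: "x \<in> {a..b}"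
  shows "(f has_real_derivative g x) (at x within {a..b})"
proof -
  define P where "P x = integral {a..x} g" for x
  have dP: "(P has_real_derivative g x) (at x within {a..b})" if "x \<in> {a..b}" for x
    unfolding P_def using g that by (rule integral_has_real_derivative)
  have cP: "continuous_on {a..b} P"
    using dP DERIV_continuous_on by blast
  define h where "h x = f x - P x" for x
  have ch: "continuous_on {a..b} h" unfolding h_def by (intro continuous_intros f cP)
  have "has_weak_deriv a b 1 h (\<lambda>_. 0)"
    unfolding has_weak_deriv_def
  proof (intro conjI ballI)
    fix \<psi> assume \<psi>: "\<psi> \<in> test_functions a b"
    have c: "continuous_on {a..b} \<psi>" "continuous_on {a..b} (deriv \<psi>)"
      using \<psi> deriv_test_functions[OF \<psi>] by (auto intro: test_function_continuous_on)
    obtain c d where "a < c" "c \<le> d" "d < b" "\<And>x. x \<notin> {c..d} \<Longrightarrow> \<psi> x = 0"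
      using \<psi> unfolding test_functions_def by blast
    then have bd: "\<psi> a = 0" "\<psi> b = 0" by auto
    have "((\<lambda>s. P s * deriv \<psi> s + g s * \<psi> s) has_integral P b * \<psi> b - P a * \<psi> a) {a..b}"
      using \<open>a < b\<close> test_function_has_derivative[OF \<psi>]
      by (intro fundamental_theorem_of_calculus)
        (auto simp: has_real_derivative_iff_has_vector_derivative[symmetric]
          intro!: derivative_eq_intros dP intro: has_field_derivative_at_within)
    then have "integral {a..b} (\<lambda>s. P s * deriv \<psi> s + g s * \<psi> s) = 0"
      by (simp add: bd integral_unique)
    moreover have "integral {a..b} (\<lambda>s. P s * deriv \<psi> s + g s * \<psi> s)
        = integral {a..b} (\<lambda>s. P s * deriv \<psi> s) + integral {a..b} (\<lambda>s. g s * \<psi> s)"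
      by (rule Henstock_Kurzweil_Integration.integral_add;
          intro integrable_continuous_interval continuous_intros cP g c)
    moreover have "integral {a..b} (\<lambda>s. f s * deriv \<psi> s) = - integral {a..b} (\<lambda>s. g s * \<psi> s)"
    proof -
      have "(LINT s:{a<..<b}|lebesgue. f s * (deriv ^^ 1) \<psi> s) = (-1) ^ 1 * (LINT s:{a<..<b}|lebesgue. g s * \<psi> s)"
        using fg \<psi> unfolding has_weak_deriv_def by blast
      then show ?thesis
        by (subst (1 2) LINT_continuous_eq_integral(2)[symmetric]) (auto intro!: continuous_intros f g c)
    qed
    moreover have "integral {a..b} (\<lambda>s. h s * deriv \<psi> s)
        = integral {a..b} (\<lambda>s. f s * deriv \<psi> s) - integral {a..b} (\<lambda>s. P s * deriv \<psi> s)"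
      unfolding h_def left_diff_distrib
      by (rule Henstock_Kurzweil_Integration.integral_diff;
          intro integrable_continuous_interval continuous_intros cP f c)
    ultimately have "integral {a..b} (\<lambda>s. h s * deriv \<psi> s) = 0" by simp
    then have "(LINT s:{a<..<b}|lebesgue. h s * deriv \<psi> s) = 0"
      by (subst LINT_continuous_eq_integral(2)) (auto intro!: continuous_intros ch c)
    then show "(LINT s:{a<..<b}|lebesgue. h s * (deriv ^^ 1) \<psi> s)
        = (-1) ^ 1 * (LINT s:{a<..<b}|lebesgue. 0 * \<psi> s)"
      by simp
  qed (auto intro!: continuous_locally_integrable ch)
  note h_weak = this
  have "Linf_norm a b (\<lambda>_. 0) \<le> ereal 0"
    by (rule Linf_norm_le) auto
  then have h0: "\<bar>h y - h x\<bar> \<le> 0 * \<bar>y - x\<bar>" if "x \<in> {a..b}" "y \<in> {a..b}" for x y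
    by (rule weak_derivative_lipschitz[OF \<open>a < b\<close> ch h_weak _ order_refl that])
  have "((\<lambda>y. P y + h a) has_real_derivative g x) (at x within {a..b})"
    using dP[OF x] by (auto intro!: derivative_eq_intros)
  then show ?thesis
  proof (rule has_field_derivative_transform_within[OF _ zero_less_one x])
    show "P y + h a = f y" if "y \<in> {a..b}" for y
      using h0[of a y] that \<open>a < b\<close> by (simp add: h_def)
  qed
qed

section \<open>Classical regularity of the exact solution\<close>

lemma iterated_deriv_test_functions:
  "\<psi> \<in> test_functions a b \<Longrightarrow> (deriv ^^ k) \<psi> \<in> test_functions a b"
  by (induction k) (auto intro: deriv_test_functions)

lemma has_weak_deriv_diff:
  assumes c: "continuous_on {a..b} f" "continuous_on {a..b} f'" "continuous_on {a..b} g" "continuous_on {a..b} g'"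
    and w: "has_weak_deriv a b k f g" "has_weak_deriv a b k f' g'"
  shows "has_weak_deriv a b k (\<lambda>x. f x - f' x) (\<lambda>x. g x - g' x)"
  unfolding has_weak_deriv_def
proof (intro conjI ballI)
  fix \<psi> assume \<psi>: "\<psi> \<in> test_functions a b"
  define \<theta> where "\<theta> = (deriv ^^ k) \<psi>"
  have t: "continuous_on {a..b} \<psi>" "continuous_on {a..b} \<theta>"
    using \<psi> iterated_deriv_test_functions[OF \<psi>] by (auto simp: \<theta>_def intro: test_function_continuous_on)
  have d: "(LINT x:{a<..<b}|lebesgue. (F x - F' x) * G x)
      = (LINT x:{a<..<b}|lebesgue. F x * G x) - (LINT x:{a<..<b}|lebesgue. F' x * G x)"
    if "continuous_on {a..b} F" "continuous_on {a..b} F'" "continuous_on {a..b} G" for F F' G :: "real \<Rightarrow> real"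
    unfolding left_diff_distrib
    by (rule set_integral_diff(2); rule LINT_continuous_eq_integral(1); intro continuous_intros that)
  have "(LINT x:{a<..<b}|lebesgue. f x * \<theta> x) = (-1) ^ k * (LINT x:{a<..<b}|lebesgue. g x * \<psi> x)"
    "(LINT x:{a<..<b}|lebesgue. f' x * \<theta> x) = (-1) ^ k * (LINT x:{a<..<b}|lebesgue. g' x * \<psi> x)"
    using w \<psi> unfolding has_weak_deriv_def \<theta>_def by blast+
  then show "(LINT x:{a<..<b}|lebesgue. (f x - f' x) * (deriv ^^ k) \<psi> x)
      = (-1) ^ k * (LINT x:{a<..<b}|lebesgue. (g x - g' x) * \<psi> x)"
    unfolding \<theta>_def[symmetric] d[OF c(1,2) t(2)] d[OF c(3,4) t(1)] by (simp add: right_diff_distrib)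
qed (intro continuous_locally_integrable continuous_intros c)+

lemma abs_le_Linf_norm_weak:
  assumes "a < b" "continuous_on {a..b} f" "has_weak_deriv a b 0 f g" "x \<in> {a..b}"
  shows "ereal \<bar>f x\<bar> \<le> Linf_norm a b g"
proof (rule ereal_le_real)
  fix K assume "Linf_norm a b g \<le> ereal K"
  then show "ereal \<bar>f x\<bar> \<le> ereal K"
    using bounded_by_weak_representative[OF assms(1-3) _ assms(4)] by simp
qed

text \<open>The norm is built from an arbitrary choice of weak derivatives; a continuous weak derivative is
  bounded at every point by the essential bound of any other choice.\<close>

lemma abs_weak_derivative_le_Winf_norm:
  assumes "a < b" "continuous_on {a..b} g" "has_weak_deriv a b k f g" "k \<le> m" "x \<in> {a..b}"
  shows "ereal \<bar>g x\<bar> \<le> Winf_norm a b m f"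
proof -
  have "has_weak_deriv a b k f (weak_deriv a b k f)"
    unfolding weak_deriv_def using assms(3) by (rule someI[of "has_weak_deriv a b k f"])
  then have "has_weak_deriv a b 0 g (weak_deriv a b k f)"
    by (rule has_weak_deriv_unique[OF assms(3)])
  then have "ereal \<bar>g x\<bar> \<le> Linf_norm a b (weak_deriv a b k f)"
    by (rule abs_le_Linf_norm_weak[OF assms(1,2) _ assms(5)])
  also have "\<dots> \<le> Winf_norm a b m f"
    unfolding Winf_norm_def using assms(4) by (intro SUP_upper) auto
  finally show ?thesis .
qed

lemma weak_representative_eq:
  assumes "a < b" "continuous_on {a..b} f" "continuous_on {a..b} g" "has_weak_deriv a b 0 f g" "x \<in> {a..b}"
  shows "f x = g x"
proof -
  have r: "has_weak_deriv a b 0 f f" by (rule has_weak_deriv_refl[OF assms(2)])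
  have "has_weak_deriv a b 0 (\<lambda>x. f x - g x) (\<lambda>x. f x - f x)"
    by (rule has_weak_deriv_unique[OF has_weak_deriv_diff[OF _ _ _ _ r assms(4)]
        has_weak_deriv_diff[OF _ _ _ _ r r]]) (intro assms(2,3))+
  moreover have "Linf_norm a b (\<lambda>x. f x - f x) \<le> ereal 0"
    by (rule Linf_norm_le) auto
  ultimately have "\<bar>f x - g x\<bar> \<le> 0"
    using bounded_by_weak_representative[OF assms(1), of "\<lambda>x. f x - g x" "\<lambda>x. f x - f x" 0 x] assms
    by (auto intro!: continuous_intros)
  then show ?thesis by simp
qed

lemma tendsto_of_ereal_bound:
  fixes f :: "real \<Rightarrow> real" and N :: "real \<Rightarrow> ereal"
  assumes "(N \<longlongrightarrow> 0) F" "\<forall>\<^sub>F s in F. ereal \<bar>f s - l\<bar> \<le> N s"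
  shows "(f \<longlongrightarrow> l) F"
proof -
  have "((\<lambda>s. ereal \<bar>f s - l\<bar>) \<longlongrightarrow> 0) F"
    by (rule tendsto_sandwich[OF _ assms(2) tendsto_const assms(1)]) auto
  then have "((\<lambda>s. \<bar>f s - l\<bar>) \<longlongrightarrow> 0) F" by (simp add: zero_ereal_def)
  then show ?thesis
    by (metis (no_types) LIM_zero_iff tendsto_rabs_zero_iff)
qed

lemma C_time_in_space: "v \<in> C_time X N T k \<Longrightarrow> t \<in> {0..T} \<Longrightarrow> v t \<in> X"
  by (cases k) auto

text \<open>Convergence of difference quotients in the norm of the space implies uniform convergence, because
  the quotients are continuous in \<open>x\<close>.\<close>

lemma C_time_Winf_derivative:
  assumes ab: "a < b" and v: "v \<in> C_time (Winf a b m) (Winf_norm a b m) T (Suc k)" and m: "m \<ge> 1"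
  obtains v' where "v' \<in> C_time (Winf a b m) (Winf_norm a b m) T k"
    "\<And>t x. t \<in> {0..T} \<Longrightarrow> x \<in> {a..b} \<Longrightarrow>
       ((\<lambda>s. v s x) has_real_derivative v' t x) (at t within {0..T})"
proof -
  obtain v' where v': "v' \<in> C_time (Winf a b m) (Winf_norm a b m) T k"
    and lim: "\<And>t. t \<in> {0..T} \<Longrightarrow>
      ((\<lambda>s. Winf_norm a b m (\<lambda>x. (v s x - v t x) / (s - t) - v' t x)) \<longlongrightarrow> 0) (at t within {0..T})"
    using v by auto
  have cont: "continuous_on {a..b} (v t)" "continuous_on {a..b} (v' t)" if "t \<in> {0..T}" for t
    using C_time_in_space[OF v that] C_time_in_space[OF v' that] m by (auto simp: Winf_def)
  have "((\<lambda>s. v s x) has_real_derivative v' t x) (at t within {0..T})" if t: "t \<in> {0..T}" and x: "x \<in> {a..b}" for t x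
    unfolding has_field_derivative_iff
  proof (rule tendsto_of_ereal_bound[OF lim[OF t]])
    show "\<forall>\<^sub>F s in at t within {0..T}. ereal \<bar>(v s x - v t x) / (s - t) - v' t x\<bar>
        \<le> Winf_norm a b m (\<lambda>x. (v s x - v t x) / (s - t) - v' t x)"
      unfolding eventually_at_filter
    proof (rule always_eventually, intro allI impI)
      fix s assume "s \<noteq> t" "s \<in> {0..T}"
      then have "continuous_on {a..b} (\<lambda>x. (v s x - v t x) / (s - t) - v' t x)"
        using t by (intro continuous_intros cont) auto
      from abs_weak_derivative_le_Winf_norm[OF ab this has_weak_deriv_refl[OF this] _ x]
      show "ereal \<bar>(v s x - v t x) / (s - t) - v' t x\<bar>
        \<le> Winf_norm a b m (\<lambda>x. (v s x - v t x) / (s - t) - v' t x)" by simp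
    qed
  qed
  with v' show ?thesis by (rule that)
qed

lemma C_time_Winf_derivatives:
  assumes ab: "a < b" and v: "v \<in> C_time (Winf a b m) (Winf_norm a b m) T k" and m: "m \<ge> 1"
  shows "\<exists>w. w 0 = v \<and> (\<forall>r\<le>k. \<forall>t\<in>{0..T}. continuous_on {a..b} (w r t)) \<and>
    (\<forall>r<k. \<forall>t\<in>{0..T}. \<forall>x\<in>{a..b}. ((\<lambda>s. w r s x) has_real_derivative w (Suc r) t x) (at t within {0..T}))"
  using v
proof (induction k arbitrary: v)
  case 0
  have "continuous_on {a..b} (v t)" if "t \<in> {0..T}" for t
    using C_time_in_space[OF 0 that] m by (auto simp: Winf_def)
  then show ?case by (intro exI[of _ "\<lambda>_. v"]) auto
next
  case (Suc k)
  obtain v' where v': "v' \<in> C_time (Winf a b m) (Winf_norm a b m) T k"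
    "\<And>t x. t \<in> {0..T} \<Longrightarrow> x \<in> {a..b} \<Longrightarrow> ((\<lambda>s. v s x) has_real_derivative v' t x) (at t within {0..T})"
    using C_time_Winf_derivative[OF ab Suc.prems m] by blast
  obtain w where w: "w 0 = v'" "\<forall>r\<le>k. \<forall>t\<in>{0..T}. continuous_on {a..b} (w r t)"
    "\<forall>r<k. \<forall>t\<in>{0..T}. \<forall>x\<in>{a..b}. ((\<lambda>s. w r s x) has_real_derivative w (Suc r) t x) (at t within {0..T})"
    using Suc.IH[OF v'(1)] by blast
  have c: "continuous_on {a..b} (v t)" if "t \<in> {0..T}" for t
    using C_time_in_space[OF Suc.prems that] m by (auto simp: Winf_def)
  show ?case
  proof (intro exI[of _ "\<lambda>r. case r of 0 \<Rightarrow> v | Suc r \<Rightarrow> w r"] conjI allI impI ballI)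
    fix r t assume "r \<le> Suc k" "t \<in> {0..T}"
    then show "continuous_on {a..b} ((case r of 0 \<Rightarrow> v | Suc r \<Rightarrow> w r) t)"
      using c w(2) by (cases r) auto
  next
    fix r t x assume "r < Suc k" "t \<in> {0..T}" "x \<in> {a..b}"
    then show "((\<lambda>s. (case r of 0 \<Rightarrow> v | Suc r \<Rightarrow> w r) s x) has_real_derivative
        (case Suc r of 0 \<Rightarrow> v | Suc r \<Rightarrow> w r) t x) (at t within {0..T})"
      using v'(2) w(1,3) by (cases r) auto
  qed auto
qed

lemma deriv_on_Icc_eq:
  assumes "c < d" "\<And>s. s \<in> {c..d} \<Longrightarrow> f s = g s" "(g has_real_derivative D) (at t within {c..d})" "t \<in> {c..d}"
  shows "deriv_on {c..d} f t = D"
proof -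
  have "(f has_real_derivative D) (at t within {c..d})"
    by (rule has_field_derivative_transform_within[OF assms(3) zero_less_one assms(4)]) (use assms(2) in auto)
  then show ?thesis
    unfolding deriv_on_def has_real_derivative_iff_has_vector_derivative
    by (rule vector_derivative_within_closed_interval[OF assms(1,4)])
qed

lemma iterated_deriv_on_Icc_eq:
  assumes "c < d" "\<And>s. s \<in> {c..d} \<Longrightarrow> f s = w 0 s"
    "\<And>r s. r < k \<Longrightarrow> s \<in> {c..d} \<Longrightarrow> (w r has_real_derivative w (Suc r) s) (at s within {c..d})"
    "r \<le> k" "s \<in> {c..d}"
  shows "(deriv_on {c..d} ^^ r) f s = w r s"
  using assms(4,5)
proof (induction r arbitrary: s)
  case 0
  then show ?case using assms(2) by simp
next
  case (Suc r)
  have "deriv_on {c..d} ((deriv_on {c..d} ^^ r) f) s = w (Suc r) s"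
    by (rule deriv_on_Icc_eq[OF assms(1) _ assms(3)]) (use Suc in auto)
  then show ?case by simp
qed

text \<open>Here \<open>v r\<close> is the \<open>r\<close>-th time derivative and \<open>g l\<close> the \<open>l\<close>-th space derivative of \<open>u\<close>, and \<open>\<eta>\<close>
  stands for \<open>\<epsilon>\<^sup>p\<close>. The error bounds derived from these assumptions depend on \<open>\<eta>\<close> and \<open>T\<close> only
  through the product \<open>\<eta> T\<close> and the final division by \<open>\<eta>\<close>, which leaves constants independent of \<open>\<epsilon>\<close>.\<close>

locale classical_solution =
  fixes a b T K \<eta> :: real and p :: nat and u :: "real \<Rightarrow> real \<Rightarrow> real"
    and v g :: "nat \<Rightarrow> real \<Rightarrow> real \<Rightarrow> real"
  assumes ab: "a < b" and K: "K \<ge> 0" and \<eta>: "0 \<le> \<eta>" "\<eta> \<le> 1" and p: "p \<ge> 1"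
    and v_0: "v 0 = u"
    and v_deriv: "\<And>r t x. r < 4 \<Longrightarrow> t \<in> {0..T} \<Longrightarrow> x \<in> {a..b} \<Longrightarrow>
      ((\<lambda>s. v r s x) has_real_derivative v (Suc r) t x) (at t within {0..T})"
    and v_bound: "\<And>r t x. r \<le> 4 \<Longrightarrow> t \<in> {0..T} \<Longrightarrow> x \<in> {a..b} \<Longrightarrow> \<bar>v r t x\<bar> \<le> K"
    and g_0: "\<And>t x. t \<in> {0..T} \<Longrightarrow> x \<in> {a..b} \<Longrightarrow> g 0 t x = u t x"
    and g_deriv: "\<And>l t x. l < 5 \<Longrightarrow> t \<in> {0..T} \<Longrightarrow> x \<in> {a..b} \<Longrightarrow>
      (g l t has_real_derivative g (Suc l) t x) (at x within {a..b})"
    and g_bound: "\<And>l t x. l \<le> 5 \<Longrightarrow> t \<in> {0..T} \<Longrightarrow> x \<in> {a..b} \<Longrightarrow> \<bar>g l t x\<bar> \<le> K"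
    and g_lipschitz: "\<And>t x y. t \<in> {0..T} \<Longrightarrow> x \<in> {a..b} \<Longrightarrow> y \<in> {a..b} \<Longrightarrow> \<bar>g 5 t y - g 5 t x\<bar> \<le> K * \<bar>y - x\<bar>"
    and g_periodic: "\<And>l t. l \<le> 5 \<Longrightarrow> t \<in> {0..T} \<Longrightarrow> g l t a = g l t b"
    and pde: "\<And>t x. t \<in> {0..T} \<Longrightarrow> x \<in> {a..b} \<Longrightarrow> v 2 t x = g 2 t x - u t x - \<eta> * u t x ^ (p + 1)"

text \<open>The equation, given at interior points and positive times, extends to the end points by continuity in
  \<open>x\<close>, and to \<open>t = 0\<close> because \<open>u\<close> is continuous in time with respect to a norm that
  controls the second space derivative.\<close>

lemma exact_solution_classical:
  fixes u :: "real \<Rightarrow> real \<Rightarrow> real"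
  assumes ab: "a < b" and T: "T > 0" and p: "p \<ge> 1" and \<epsilon>: "0 \<le> \<epsilon> ^ p" "\<epsilon> ^ p \<le> 1"
    and sol: "exact_solution a b p \<phi> \<gamma> \<epsilon> T u"
    and reg6: "u \<in> C_time (Winf_per a b 6) (Winf_norm a b 6) T 0"
    and reg2: "u \<in> C_time (Winf a b 2) (Winf_norm a b 2) T 4"
    and K: "K \<ge> 0" and bounds: "\<And>t r q. t \<in> {0..T} \<Longrightarrow> r \<le> 4 \<Longrightarrow> r + q \<le> 6 \<Longrightarrow>
          \<exists>g. has_weak_deriv a b q (dt T r u t) g \<and> Linf_norm a b g \<le> ereal K"
  shows "\<exists>v g. classical_solution a b T K (\<epsilon> ^ p) p u v g \<and>
    (\<forall>x\<in>{a..b}. u 0 x = \<phi> x \<and> v 1 0 x = \<gamma> x \<and> dx a b 2 \<phi> x = g 2 0 x)"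
proof -
  obtain v where v0: "v 0 = u"
    and vc: "\<And>r t. r \<le> 4 \<Longrightarrow> t \<in> {0..T} \<Longrightarrow> continuous_on {a..b} (v r t)"
    and vd: "\<And>r t x. r < 4 \<Longrightarrow> t \<in> {0..T} \<Longrightarrow> x \<in> {a..b} \<Longrightarrow>
      ((\<lambda>s. v r s x) has_real_derivative v (Suc r) t x) (at t within {0..T})"
    using C_time_Winf_derivatives[OF ab reg2] by auto
  have dt_v: "dt T r u t x = v r t x" if "r \<le> 4" "t \<in> {0..T}" "x \<in> {a..b}" for r t x
    unfolding dt_def
    by (rule iterated_deriv_on_Icc_eq[OF T, where w="\<lambda>r s. v r s x" and k=4]) (use that v0 vd in auto)
  have vb: "\<bar>v r t x\<bar> \<le> K" if r: "r \<le> 4" and t: "t \<in> {0..T}" and x: "x \<in> {a..b}" for r t x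
  proof -
    obtain w where w: "has_weak_deriv a b 0 (dt T r u t) w" "Linf_norm a b w \<le> ereal K"
      using bounds[OF t r, of 0] r by auto
    have "has_weak_deriv a b 0 (v r t) w"
      by (rule has_weak_deriv_cong[OF _ w(1) continuous_locally_integrable[OF vc[OF r t]]])
        (use dt_v r t in auto)
    from bounded_by_weak_representative[OF ab vc[OF r t] this w(2) x] show ?thesis .
  qed
  have "\<exists>g. has_weak_deriv a b l (u t) g \<and> continuous_on {a..b} g \<and> g a = g b" if "l \<le> 5" "t \<in> {0..T}" for l t
    using C_time_in_space[OF reg6 that(2)] that(1) by (auto simp: Winf_per_def)
  then obtain g where g: "\<And>l t. l \<le> 5 \<Longrightarrow> t \<in> {0..T} \<Longrightarrow> has_weak_deriv a b l (u t) (g l t)"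
    and gc: "\<And>l t. l \<le> 5 \<Longrightarrow> t \<in> {0..T} \<Longrightarrow> continuous_on {a..b} (g l t)"
    and gp: "\<And>l t. l \<le> 5 \<Longrightarrow> t \<in> {0..T} \<Longrightarrow> g l t a = g l t b"
    by metis
  have uc: "continuous_on {a..b} (u t)" if "t \<in> {0..T}" for t using vc[of 0 t] that by (simp add: v0)
  have g0: "g 0 t x = u t x" if "t \<in> {0..T}" "x \<in> {a..b}" for t x
    using weak_representative_eq[OF ab uc gc g that(2)] that by simp
  have gd: "(g l t has_real_derivative g (Suc l) t x) (at x within {a..b})"
    if "l < 5" "t \<in> {0..T}" "x \<in> {a..b}" for l t x
    by (rule weak_derivative_classical[OF ab gc gc has_weak_deriv_Suc[OF g g]]) (use that in auto)
  have wb: "\<exists>w. has_weak_deriv a b l (u t) w \<and> Linf_norm a b w \<le> ereal K" if "l \<le> 6" "t \<in> {0..T}" for l t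
  proof -
    have "dt T 0 u t = u t" by (simp add: dt_def)
    then show ?thesis using bounds[OF that(2), of 0 l] that(1) by simp
  qed
  have gb: "\<bar>g l t x\<bar> \<le> K" if r: "l \<le> 5" "t \<in> {0..T}" "x \<in> {a..b}" for l t x
  proof -
    obtain w where w: "has_weak_deriv a b l (u t) w" "Linf_norm a b w \<le> ereal K"
      using wb[of l t] r by auto
    from bounded_by_weak_representative[OF ab gc has_weak_deriv_unique[OF g w(1)] w(2) r(3)] r
    show ?thesis by auto
  qed
  have gL: "\<bar>g 5 t y - g 5 t x\<bar> \<le> K * \<bar>y - x\<bar>" if r: "t \<in> {0..T}" "x \<in> {a..b}" "y \<in> {a..b}" for t x y
  proof -
    obtain w where w: "has_weak_deriv a b (Suc 5) (u t) w" "Linf_norm a b w \<le> ereal K"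
      using wb[of "Suc 5" t] r by auto
    show ?thesis
      by (rule weak_derivative_lipschitz[OF ab gc has_weak_deriv_Suc[OF g w(1)] w(2) K r(2,3)]) (use r in auto)
  qed
  have dx_g: "dx a b 2 f x = g 2 t x"
    if "t \<in> {0..T}" "x \<in> {a..b}" "\<And>y. y \<in> {a..b} \<Longrightarrow> f y = u t y" for f t x
    unfolding dx_def
    by (rule iterated_deriv_on_Icc_eq[OF ab, where w="\<lambda>l. g l t" and k=5]) (use that g0 gd in auto)
  define F where "F t x = v 2 t x - (g 2 t x - u t x - \<epsilon> ^ p * u t x ^ (p + 1))" for t x
  have Fint: "F t x = 0" if "t \<in> {0<..T}" "x \<in> {a<..<b}" for t x
  proof -
    have "dt T 2 u t x - dx a b 2 (u t) x + u t x + \<epsilon> ^ p * u t x ^ (p + 1) = 0"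
      using sol that unfolding exact_solution_def by blast
    moreover have "dt T 2 u t x = v 2 t x" using that by (intro dt_v) auto
    moreover have "dx a b 2 (u t) x = g 2 t x" using that by (intro dx_g) auto
    ultimately show ?thesis by (simp add: F_def)
  qed
  have Fpos: "F t x = 0" if t: "t \<in> {0<..T}" and x: "x \<in> {a..b}" for t x
  proof -
    have t': "t \<in> {0..T}" using t by auto
    have "continuous_on {a..b} (\<lambda>x. F t x)"
      unfolding F_def by (intro continuous_intros vc[OF _ t'] gc[OF _ t'] uc[OF t']) simp_all
    then have "continuous_on {a..b} (\<lambda>x. \<bar>F t x\<bar>)" by (rule continuous_on_rabs)
    from le_on_closed_interval[OF ab this, of 0 x] have "\<bar>F t x\<bar> \<le> 0"
      using Fint t x by simp
    then show ?thesis by simp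
  qed
  have t0: "0 \<in> {0..T}" using T by simp
  have F0: "F 0 x = 0" if x: "x \<in> {a..b}" for x
  proof -
    let ?at = "at 0 within {0..T}"
    have lim_v: "((\<lambda>s. v r s x) \<longlongrightarrow> v r 0 x) ?at" if "r < 4" for r
      using DERIV_continuous[OF vd[OF that t0 x]] by (simp add: continuous_within)
    have lim_u: "((\<lambda>s. u s x) \<longlongrightarrow> u 0 x) ?at" using lim_v[of 0] by (simp add: v0)
    have lim_g: "((\<lambda>s. g 2 s x) \<longlongrightarrow> g 2 0 x) ?at"
    proof (rule tendsto_of_ereal_bound)
      show "((\<lambda>s. Winf_norm a b 6 (\<lambda>x. u s x - u 0 x)) \<longlongrightarrow> 0) ?at"
        using reg6 t0 by simp
      show "\<forall>\<^sub>F s in ?at. ereal \<bar>g 2 s x - g 2 0 x\<bar> \<le> Winf_norm a b 6 (\<lambda>x. u s x - u 0 x)"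
        unfolding eventually_at_filter
      proof (rule always_eventually, intro allI impI)
        fix s assume s: "s \<in> {0..T}"
        show "ereal \<bar>g 2 s x - g 2 0 x\<bar> \<le> Winf_norm a b 6 (\<lambda>x. u s x - u 0 x)"
          by (rule abs_weak_derivative_le_Winf_norm[where g="\<lambda>x. g 2 s x - g 2 0 x",
                OF ab _ has_weak_deriv_diff[OF uc uc gc gc g g]])
            (use s t0 x in \<open>auto intro!: continuous_intros gc\<close>)
      qed
    qed
    have "((\<lambda>s. F s x) \<longlongrightarrow> F 0 x) ?at"
      unfolding F_def by (intro tendsto_intros lim_u lim_g lim_v) simp
    moreover have "((\<lambda>s. F s x) \<longlongrightarrow> 0) ?at"
    proof (rule tendsto_eventually)
      show "\<forall>\<^sub>F s in ?at. F s x = 0"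
        unfolding eventually_at_filter
        by (rule always_eventually) (use Fpos[OF _ x] in force)
    qed
    moreover have "?at \<noteq> bot" using T by (simp add: trivial_limit_within islimpt_Icc)
    ultimately show ?thesis using tendsto_unique by blast
  qed
  have pde: "v 2 t x = g 2 t x - u t x - \<epsilon> ^ p * u t x ^ (p + 1)" if "t \<in> {0..T}" "x \<in> {a..b}" for t x
    using F0[OF that(2)] Fpos[of t x] that by (cases "t = 0") (auto simp: F_def)
  have init: "u 0 x = \<phi> x" "v 1 0 x = \<gamma> x" if "x \<in> {a..b}" for x
    using sol that dt_v[OF _ t0 that, of 1] unfolding exact_solution_def by auto
  have "classical_solution a b T K (\<epsilon> ^ p) p u v g"
    by unfold_locales (fact ab K \<epsilon> p v0 vd vb g0 gd gb gL gp pde)+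
  moreover have "dx a b 2 \<phi> x = g 2 0 x" if "x \<in> {a..b}" for x
    using dx_g[OF t0 that] init by simp
  ultimately show ?thesis using init by blast
qed

section \<open>Periodic grid functions and the compact averaging operator\<close>

lemma XM_add: "f \<in> XM M \<Longrightarrow> g \<in> XM M \<Longrightarrow> (\<lambda>j. f j + g j) \<in> XM M"
  and XM_diff: "f \<in> XM M \<Longrightarrow> g \<in> XM M \<Longrightarrow> (\<lambda>j. f j - g j) \<in> XM M"
  and XM_mult: "f \<in> XM M \<Longrightarrow> g \<in> XM M \<Longrightarrow> (\<lambda>j. f j * g j) \<in> XM M"
  and XM_const: "(\<lambda>j. c) \<in> XM M"
  by (auto simp: XM_def)

lemma XM_shift:
  assumes "f \<in> XM M"
  shows "(\<lambda>j. f (j + k)) \<in> XM M"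
proof -
  have "f (j + int M + k) = f (j + k)" for j
  proof -
    have "f ((j + k) + int M) = f (j + k)" using assms by (simp add: XM_def)
    then show ?thesis by (simp add: algebra_simps)
  qed
  then show ?thesis by (simp add: XM_def)
qed

lemma XM_comp: "f \<in> XM M \<Longrightarrow> (\<lambda>j. F (f j)) \<in> XM M"
  by (auto simp: XM_def)

lemma XM_mod:
  assumes "f \<in> XM M"
  shows "f (j mod int M) = f j"
proof -
  have per: "f (i + int M) = f i" for i using assms by (auto simp: XM_def)
  have n: "f (i + int n * int M) = f i" for i n
  proof (induction n)
    case (Suc n)
    have "f (i + int (Suc n) * int M) = f ((i + int n * int M) + int M)" by (simp add: algebra_simps)
    then show ?case using per Suc by simp
  qed simp
  have "f (i + k * int M) = f i" for i k
  proof (cases "k \<ge> 0")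
    case True
    then show ?thesis using n[of i "nat k"] by simp
  next
    case False
    then show ?thesis using n[of "i + k * int M" "nat (- k)"] by (simp add: algebra_simps)
  qed
  from this[of "j mod int M" "j div int M"] show ?thesis by (simp add: mod_mult_div_eq mult.commute)
qed

lemma XM_eqI:
  assumes "f \<in> XM M" "g \<in> XM M" "M \<ge> 1" "\<And>j. j \<in> {0..<int M} \<Longrightarrow> f j = g j"
  shows "f = g"
proof
  fix j
  have "j mod int M \<in> {0..<int M}" using assms(3) by simp
  from assms(4)[OF this] show "f j = g j" by (simp only: XM_mod[OF assms(1)] XM_mod[OF assms(2)])
qed

text \<open>Summation by parts without boundary terms rests on this invariance of sums over one period.\<close>

lemma sum_shift:
  assumes "f \<in> XM M" "M \<ge> 1"
  shows "(\<Sum>j\<in>{0..<int M}. f (j + 1)) = (\<Sum>j\<in>{0..<int M}. f j)"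
proof -
  have "(\<Sum>j\<in>{0..<int M}. f (j + 1)) = (\<Sum>j\<in>{1..<int M + 1}. f j)"
    by (rule sum.reindex_bij_witness[where i="\<lambda>j. j - 1" and j="\<lambda>j. j + 1"]) auto
  also have "{1..<int M + 1} = insert (int M) {1..<int M}" using assms(2) by auto
  also have "(\<Sum>j\<in>insert (int M) {1..<int M}. f j) = f (0 + int M) + (\<Sum>j\<in>{1..<int M}. f j)" by simp
  also have "f (0 + int M) = f 0" using assms(1) unfolding XM_def by blast
  also have "f 0 + (\<Sum>j\<in>{1..<int M}. f j) = (\<Sum>j\<in>insert 0 {1..<int M}. f j)" by simp
  also have "insert 0 {1..<int M} = {0..<int M}" using assms(2) by auto
  finally show ?thesis .
qed

lemma sum_shift_back:
  assumes "f \<in> XM M" "M \<ge> 1"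
  shows "(\<Sum>j\<in>{0..<int M}. f (j - 1)) = (\<Sum>j\<in>{0..<int M}. f j)"
  using sum_shift[OF XM_shift[OF assms(1), of "-1"] assms(2)] by simp

lemma compact_op_stencil:
  assumes "h > 0"
  shows "compact_op h u j = (u (j - 1) + 10 * u j + u (j + 1)) / 12"
  using assms by (simp add: compact_op_def delta_x2_def field_simps)

lemma XM_delta_x2: "u \<in> XM M \<Longrightarrow> delta_x2 h u \<in> XM M"
  and XM_delta_x_plus: "u \<in> XM M \<Longrightarrow> delta_x_plus h u \<in> XM M"
proof -
  assume u: "u \<in> XM M"
  have s: "u (j + k + int M) = u (j + k)" for j k using u unfolding XM_def by blast
  have s': "u (j + int M + k) = u (j + k)" for j k using s[of j k] by (simp add: algebra_simps)
  have s'': "u (j + int M - 1) = u (j - 1)" for j using s'[of j "-1"] by simp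
  show "delta_x2 h u \<in> XM M" "delta_x_plus h u \<in> XM M"
    using s' s'' s[of _ 0] by (auto simp: XM_def delta_x2_def delta_x_plus_def)
qed

text \<open>All quadratic forms of the compact operator reduce to the three correlations of a periodic vector
  with its own shifts.\<close>

lemma compact_op_correlations:
  assumes v: "v \<in> XM M" and M: "M \<ge> 1" and h: "h > 0"
  defines "s \<equiv> \<Sum>j\<in>{0..<int M}. (v j)\<^sup>2"
    and "c \<equiv> \<Sum>j\<in>{0..<int M}. v j * v (j + 1)"
    and "d \<equiv> \<Sum>j\<in>{0..<int M}. v (j - 1) * v (j + 1)"
  shows "(\<Sum>j\<in>{0..<int M}. v j * compact_op h v j) = (10 * s + 2 * c) / 12"
    and "(\<Sum>j\<in>{0..<int M}. (compact_op h v j)\<^sup>2) = (102 * s + 40 * c + 2 * d) / 144"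
    and "(\<Sum>j\<in>{0..<int M}. (v j + v (j + 1))\<^sup>2) = 2 * s + 2 * c"
    and "(\<Sum>j\<in>{0..<int M}. (v j - v (j + 1))\<^sup>2) = 2 * s - 2 * c"
    and "(\<Sum>j\<in>{0..<int M}. (v (j - 1) - v (j + 1))\<^sup>2) = 2 * s - 2 * d"
    and "(\<Sum>j\<in>{0..<int M}. (v (j - 1) + 2 * v j + v (j + 1))\<^sup>2) = 6 * s + 8 * c + 2 * d"
proof -
  have sq: "(\<lambda>j. (v j)\<^sup>2) \<in> XM M" by (rule XM_comp[OF v])
  have s1: "(\<Sum>j\<in>{0..<int M}. (v (j + 1))\<^sup>2) = s" "(\<Sum>j\<in>{0..<int M}. (v (j - 1))\<^sup>2) = s"
    unfolding s_def using sum_shift[OF sq M] sum_shift_back[OF sq M] by auto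
  have c1: "(\<Sum>j\<in>{0..<int M}. v (j - 1) * v j) = c"
    unfolding c_def using sum_shift_back[OF XM_mult[OF v XM_shift[OF v, of 1]] M] by simp
  show "(\<Sum>j\<in>{0..<int M}. v j * compact_op h v j) = (10 * s + 2 * c) / 12"
  proof -
    have "(\<Sum>j\<in>{0..<int M}. v j * compact_op h v j)
        = (\<Sum>j\<in>{0..<int M}. (10 * (v j)\<^sup>2 + v (j - 1) * v j + v j * v (j + 1)) / 12)"
      by (rule sum.cong) (auto simp: compact_op_stencil[OF h] power2_eq_square field_simps)
    then show ?thesis
      by (simp add: sum_divide_distrib[symmetric] sum.distrib c1 sum_distrib_left[symmetric] flip: s_def c_def)
  qed
  show "(\<Sum>j\<in>{0..<int M}. (compact_op h v j)\<^sup>2) = (102 * s + 40 * c + 2 * d) / 144"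
  proof -
    have "(\<Sum>j\<in>{0..<int M}. (compact_op h v j)\<^sup>2)
        = (\<Sum>j\<in>{0..<int M}. ((v (j - 1))\<^sup>2 + 100 * (v j)\<^sup>2 + (v (j + 1))\<^sup>2
            + 20 * (v (j - 1) * v j) + 20 * (v j * v (j + 1)) + 2 * (v (j - 1) * v (j + 1))) / 144)"
      by (rule sum.cong) (auto simp: compact_op_stencil[OF h] power2_eq_square field_simps)
    then show ?thesis
      by (simp add: sum_divide_distrib[symmetric] sum.distrib c1 s1 sum_distrib_left[symmetric] flip: s_def c_def d_def)
  qed
  show "(\<Sum>j\<in>{0..<int M}. (v j + v (j + 1))\<^sup>2) = 2 * s + 2 * c"
    by (simp add: power2_sum sum.distrib s1 mult.assoc sum_distrib_left[symmetric] flip: s_def c_def)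
  show "(\<Sum>j\<in>{0..<int M}. (v j - v (j + 1))\<^sup>2) = 2 * s - 2 * c"
    by (simp add: power2_diff sum.distrib sum_subtractf s1 mult.assoc sum_distrib_left[symmetric] flip: s_def c_def)
  show "(\<Sum>j\<in>{0..<int M}. (v (j - 1) - v (j + 1))\<^sup>2) = 2 * s - 2 * d"
    by (simp add: power2_diff sum.distrib sum_subtractf s1 mult.assoc sum_distrib_left[symmetric] flip: s_def d_def)
  show "(\<Sum>j\<in>{0..<int M}. (v (j - 1) + 2 * v j + v (j + 1))\<^sup>2) = 6 * s + 8 * c + 2 * d"
  proof -
    have "(\<Sum>j\<in>{0..<int M}. (v (j - 1) + 2 * v j + v (j + 1))\<^sup>2)
        = (\<Sum>j\<in>{0..<int M}. (v (j - 1))\<^sup>2 + 4 * (v j)\<^sup>2 + (v (j + 1))\<^sup>2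
            + 4 * (v (j - 1) * v j) + 4 * (v j * v (j + 1)) + 2 * (v (j - 1) * v (j + 1)))"
      by (rule sum.cong) (auto simp: power2_eq_square field_simps)
    then show ?thesis
      by (simp add: sum.distrib c1 s1 sum_distrib_left[symmetric] flip: s_def c_def d_def)
  qed
qed

text \<open>In Fourier variables the operator has the symbol \<open>\<lambda> = (5 + cos \<theta>) / 6 \<in> [2/3, 1]\<close>, and the claims
  are \<open>1 \<le> 9/4 \<lambda>\<^sup>2\<close>, \<open>\<lambda>\<^sup>2 \<le> \<lambda>\<close> and \<open>\<lambda> \<le> 3/2 \<lambda>\<^sup>2\<close>. The proof writes each difference as a nonnegative
  combination of four sums of squares, which avoids diagonalisation.\<close>

lemma compact_op_bounds:
  assumes v: "v \<in> XM M" and M: "M \<ge> 1" and h: "h > 0"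
  shows compact_op_coercive:
      "(\<Sum>j\<in>{0..<int M}. (v j)\<^sup>2) \<le> 9 / 4 * (\<Sum>j\<in>{0..<int M}. (compact_op h v j)\<^sup>2)"
    and compact_op_form_lower:
      "(\<Sum>j\<in>{0..<int M}. (compact_op h v j)\<^sup>2) \<le> (\<Sum>j\<in>{0..<int M}. v j * compact_op h v j)"
    and compact_op_form_upper:
      "(\<Sum>j\<in>{0..<int M}. v j * compact_op h v j) \<le> 3 / 2 * (\<Sum>j\<in>{0..<int M}. (compact_op h v j)\<^sup>2)"
proof -
  note C = compact_op_correlations[OF v M h]
  have lin: "s \<le> 9 / 4 * ((102 * s + 40 * c + 2 * d) / 144) \<and>
      (102 * s + 40 * c + 2 * d) / 144 \<le> (10 * s + 2 * c) / 12 \<and>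
      (10 * s + 2 * c) / 12 \<le> 3 / 2 * ((102 * s + 40 * c + 2 * d) / 144)"
    if "0 \<le> 2 * s + 2 * c" "0 \<le> 2 * s - 2 * c" "0 \<le> 2 * s - 2 * d" "0 \<le> 6 * s + 8 * c + 2 * d"
    for s c d :: real
    using that by argo
  have nn: "(\<Sum>j\<in>{0..<int M}. (v j + v (j + 1))\<^sup>2) \<ge> 0" "(\<Sum>j\<in>{0..<int M}. (v j - v (j + 1))\<^sup>2) \<ge> 0"
    "(\<Sum>j\<in>{0..<int M}. (v (j - 1) - v (j + 1))\<^sup>2) \<ge> 0"
    "(\<Sum>j\<in>{0..<int M}. (v (j - 1) + 2 * v j + v (j + 1))\<^sup>2) \<ge> 0"
    by (auto intro!: sum_nonneg)
  note L = lin[OF nn[unfolded C]]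
  show "(\<Sum>j\<in>{0..<int M}. (v j)\<^sup>2) \<le> 9 / 4 * (\<Sum>j\<in>{0..<int M}. (compact_op h v j)\<^sup>2)"
    unfolding C by (rule L[THEN conjunct1])
  show "(\<Sum>j\<in>{0..<int M}. (compact_op h v j)\<^sup>2) \<le> (\<Sum>j\<in>{0..<int M}. v j * compact_op h v j)"
    unfolding C by (rule L[THEN conjunct2, THEN conjunct1])
  show "(\<Sum>j\<in>{0..<int M}. v j * compact_op h v j) \<le> 3 / 2 * (\<Sum>j\<in>{0..<int M}. (compact_op h v j)\<^sup>2)"
    unfolding C by (rule L[THEN conjunct2, THEN conjunct2])
qed

lemma compact_op_diff: "compact_op h (\<lambda>j. f j - g j) = (\<lambda>j. compact_op h f j - compact_op h g j)"
  unfolding compact_op_def delta_x2_def divide_inverse by (rule ext) (simp add: algebra_simps)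

lemma inj_on_compact_op:
  assumes M: "M \<ge> 1" and h: "h > 0"
  shows "inj_on (compact_op h) (XM M)"
proof (rule inj_onI)
  fix f g assume f: "f \<in> XM M" and g: "g \<in> XM M" and eq: "compact_op h f = compact_op h g"
  define v where "v j = f j - g j" for j
  have v: "v \<in> XM M" unfolding v_def by (rule XM_diff[OF f g])
  have "compact_op h v j = 0" for j unfolding v_def compact_op_diff eq by simp
  then have "(\<Sum>j\<in>{0..<int M}. (v j)\<^sup>2) \<le> 0" using compact_op_coercive[OF v M h] by simp
  then have "(\<Sum>j\<in>{0..<int M}. (v j)\<^sup>2) = 0"
    by (rule antisym) (simp add: sum_nonneg)
  then have "\<forall>j\<in>{0..<int M}. (v j)\<^sup>2 = 0"
    by (subst (asm) sum_nonneg_eq_0_iff) simp_all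
  show "f = g"
  proof (rule XM_eqI[OF f g M])
    fix j assume "j \<in> {0..<int M}"
    with \<open>\<forall>j\<in>{0..<int M}. (v j)\<^sup>2 = 0\<close> have "(v j)\<^sup>2 = 0" by blast
    then have "v j = 0" by simp
    then show "f j = g j" unfolding v_def by simp
  qed
qed

lemma XM_bounded:
  assumes "f \<in> XM M" "M \<ge> 1"
  obtains C where "\<And>j. \<bar>f j\<bar> \<le> C"
proof -
  have "\<bar>f j\<bar> \<le> Max ((\<lambda>j. \<bar>f j\<bar>) ` {0..<int M})" for j
  proof -
    have "\<bar>f (j mod int M)\<bar> \<le> Max ((\<lambda>j. \<bar>f j\<bar>) ` {0..<int M})"
      using assms(2) by (intro Max_ge) auto
    then show ?thesis by (simp add: XM_mod[OF assms(1)])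
  qed
  then show ?thesis by (rule that)
qed

text \<open>The inverse on bounded sequences is convolution with \<open>c * r ^ \<bar>k\<bar>\<close>, where \<open>r\<close> is the root inside
  the unit disc of the characteristic equation \<open>r\<^sup>2 + 10 r + 1 = 0\<close> of the stencil. Convolution
  preserves periodicity. The sums \<open>L\<close> and \<open>R\<close> are the two halves of the convolution; both contain
  the term for \<open>k = 0\<close>.\<close>

lemma compact_op_surj:
  assumes f: "f \<in> XM M" and M: "M \<ge> 1" and h: "h > 0"
  shows "\<exists>w\<in>XM M. compact_op h w = f"
proof -
  define r :: real where "r = -5 + 2 * sqrt 6"
  have s6: "(12/5)\<^sup>2 < (6::real)" "(6::real) < (5/2)\<^sup>2" by (auto simp: power2_eq_square)
  have s6: "12/5 < sqrt 6" "sqrt 6 < 5/2"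
    using real_less_rsqrt[OF s6(1)] real_less_lsqrt[OF _ s6(2)] by auto
  have r1: "\<bar>r\<bar> < 1" using s6 by (simp add: r_def abs_less_iff)
  have r3: "10 * r + 2 \<noteq> 0" using s6(1) by (simp add: r_def)
  have r2: "r * r + 10 * r + 1 = 0" by (simp add: r_def algebra_simps)
  obtain C where C: "\<And>j. \<bar>f j\<bar> \<le> C" using XM_bounded[OF f M] by blast
  have geo: "summable (\<lambda>k. C * \<bar>r\<bar> ^ k)" using r1 by (intro summable_mult summable_geometric) simp
  have su: "summable (\<lambda>k. r ^ k * f (\<sigma> k))" for \<sigma> :: "nat \<Rightarrow> int"
  proof (rule summable_comparison_test'[OF geo, of 0])
    show "norm (r ^ k * f (\<sigma> k)) \<le> C * \<bar>r\<bar> ^ k" for k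
      using C[of "\<sigma> k"] by (simp add: abs_mult power_abs mult.commute mult_right_mono)
  qed
  define L where "L j = (\<Sum>k. r ^ k * f (j - int k))" for j
  define R where "R j = (\<Sum>k. r ^ k * f (j + int k))" for j
  have L: "L j = f j + r * L (j - 1)" for j
  proof -
    have "L j = r ^ 0 * f (j - int 0) + (\<Sum>k. r ^ Suc k * f (j - int (Suc k)))"
      unfolding L_def using suminf_split_head[OF su[of "\<lambda>k. j - int k"]] by simp
    also have "(\<Sum>k. r ^ Suc k * f (j - int (Suc k))) = (\<Sum>k. r * (r ^ k * f (j - 1 - int k)))"
      by (simp add: algebra_simps)
    also have "\<dots> = r * L (j - 1)" unfolding L_def by (rule suminf_mult[OF su])
    finally show ?thesis by simp
  qed
  have R: "R j = f j + r * R (j + 1)" for j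
  proof -
    have "R j = r ^ 0 * f (j + int 0) + (\<Sum>k. r ^ Suc k * f (j + int (Suc k)))"
      unfolding R_def using suminf_split_head[OF su[of "\<lambda>k. j + int k"]] by simp
    also have "(\<Sum>k. r ^ Suc k * f (j + int (Suc k))) = (\<Sum>k. r * (r ^ k * f (j + 1 + int k)))"
      by (simp add: algebra_simps)
    also have "\<dots> = r * R (j + 1)" unfolding R_def by (rule suminf_mult[OF su])
    finally show ?thesis by simp
  qed
  have r0: "r \<noteq> 0" using r2 by auto
  have per: "L \<in> XM M" "R \<in> XM M"
  proof -
    have e: "f (j + int M - int k) = f (j - int k)" "f (j + int M + int k) = f (j + int k)" for j k
      using XM_shift[OF f, of "- int k"] XM_shift[OF f, of "int k"] by (auto simp: XM_def)
    show "L \<in> XM M" "R \<in> XM M" by (auto simp: XM_def L_def R_def e)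
  qed
  \<comment> \<open>The sum \<open>L + R - f\<close> counts the term \<open>k = 0\<close> once; the stencil maps it to \<open>- (10 * r + 2) / r\<close> times \<open>f\<close>.\<close>
  define c where "c = - (12 * r) / (10 * r + 2)"
  have c: "c * (10 * r + 2) = - (12 * r)" using r3 by (simp add: c_def)
  define w where "w j = c * (L j + R j - f j)" for j
  have "compact_op h w j = f j" for j
  proof -
    have l: "r * L (j - 1) = L j - f j" using L[of j] by linarith
    have l': "L (j + 1) = f (j + 1) + r * L j" using L[of "j + 1"] by simp
    have q: "r * R (j + 1) = R j - f j" using R[of j] by linarith
    have q': "R (j - 1) = f (j - 1) + r * R j" using R[of "j - 1"] by simp
    have st: "12 * compact_op h w j = w (j - 1) + 10 * w j + w (j + 1)"
      by (simp add: compact_op_stencil[OF h])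
    have "r * (12 * compact_op h w j) = c * (r * L (j - 1) + 10 * r * L j + r * L (j + 1)
        + (r * R (j - 1) + 10 * r * R j + r * R (j + 1)) - r * f (j - 1) - 10 * r * f j - r * f (j + 1))"
      unfolding st w_def by (simp add: algebra_simps)
    also have "\<dots> = c * ((r * r + 10 * r + 1) * (L j + R j) - (10 * r + 2) * f j)"
      unfolding l l' q q' by (simp add: algebra_simps)
    also have "\<dots> = - (c * (10 * r + 2)) * f j" unfolding r2 by (simp add: algebra_simps)
    also have "\<dots> = r * (12 * f j)" unfolding c by simp
    finally have "r * (12 * compact_op h w j) = r * (12 * f j)" .
    with r0 show ?thesis by simp
  qed
  then have "compact_op h w = f" by (rule ext)
  moreover have "w \<in> XM M" unfolding w_def
    using per f by (auto simp: XM_def)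
  ultimately show ?thesis by blast
qed

section \<open>The discrete energy and its growth\<close>

definition grid_inner :: "real \<Rightarrow> nat \<Rightarrow> (int \<Rightarrow> real) \<Rightarrow> (int \<Rightarrow> real) \<Rightarrow> real" where
  "grid_inner h M f g = h * (\<Sum>j\<in>{0..<int M}. f j * g j)"

lemma grid_inner_linear:
  shows "grid_inner h M (\<lambda>j. f j + f' j) g = grid_inner h M f g + grid_inner h M f' g"
    and "grid_inner h M (\<lambda>j. f j - f' j) g = grid_inner h M f g - grid_inner h M f' g"
    and "grid_inner h M (\<lambda>j. c * f j) g = c * grid_inner h M f g"
    and "grid_inner h M f (\<lambda>j. g j - g' j) = grid_inner h M f g - grid_inner h M f g'"
  by (simp_all add: grid_inner_def distrib_left distrib_right left_diff_distrib right_diff_distrib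
      sum.distrib sum_subtractf sum_distrib_left mult_ac)

lemma l2_norm_L2_set: "h \<ge> 0 \<Longrightarrow> l2_norm h M f = sqrt h * L2_set f {0..<int M}"
  by (simp add: l2_norm_def L2_set_def real_sqrt_mult)

lemma l2_norm_nonneg: "h \<ge> 0 \<Longrightarrow> l2_norm h M f \<ge> 0"
  by (simp add: l2_norm_def sum_nonneg)

lemma l2_norm_sq: "h \<ge> 0 \<Longrightarrow> (l2_norm h M f)\<^sup>2 = grid_inner h M f f"
  by (simp add: l2_norm_def grid_inner_def sum_nonneg power2_eq_square[symmetric])

lemma grid_inner_le: "h \<ge> 0 \<Longrightarrow> grid_inner h M f g \<le> l2_norm h M f * l2_norm h M g"
proof -
  assume h: "h \<ge> 0"
  have "grid_inner h M f g \<le> h * (\<Sum>j\<in>{0..<int M}. \<bar>f j\<bar> * \<bar>g j\<bar>)"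
    unfolding grid_inner_def using h
    by (intro mult_left_mono sum_mono) (auto simp: abs_mult[symmetric])
  also have "\<dots> \<le> h * (L2_set f {0..<int M} * L2_set g {0..<int M})"
    using h by (intro mult_left_mono L2_set_mult_ineq)
  also have "\<dots> = l2_norm h M f * l2_norm h M g"
    using h by (simp add: l2_norm_L2_set)
  finally show ?thesis .
qed

lemma l2_norm_triangle: "h \<ge> 0 \<Longrightarrow> l2_norm h M (\<lambda>j. f j + g j) \<le> l2_norm h M f + l2_norm h M g"
  using mult_left_mono[OF L2_set_triangle_ineq[of f g "{0..<int M}"], of "sqrt h"]
  by (simp add: l2_norm_L2_set distrib_left)

lemma l2_norm_mono:
  assumes "h \<ge> 0" "\<And>j. j \<in> {0..<int M} \<Longrightarrow> \<bar>f j\<bar> \<le> \<bar>g j\<bar>"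
  shows "l2_norm h M f \<le> l2_norm h M g"
  unfolding l2_norm_def using assms
  by (intro real_sqrt_le_mono mult_left_mono sum_mono power_mono) auto

lemma l2_norm_cmult: "h \<ge> 0 \<Longrightarrow> c \<ge> 0 \<Longrightarrow> l2_norm h M (\<lambda>j. c * f j) = c * l2_norm h M f"
  by (simp add: l2_norm_L2_set L2_set_right_distrib[symmetric])

lemma l2_norm_const_bound:
  assumes "h \<ge> 0" "C \<ge> 0" "\<And>j. j \<in> {0..<int M} \<Longrightarrow> \<bar>f j\<bar> \<le> C"
  shows "l2_norm h M f \<le> sqrt (h * real M) * C"
proof -
  have "l2_norm h M f \<le> l2_norm h M (\<lambda>_. C)"
    using assms by (intro l2_norm_mono) auto
  also have "\<dots> = sqrt (h * real M) * C"
    using assms by (simp add: l2_norm_def real_sqrt_mult mult.assoc)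
  finally show ?thesis .
qed

lemma l2_norm_cong: "(\<And>j. j \<in> {0..<int M} \<Longrightarrow> f j = g j) \<Longrightarrow> l2_norm h M f = l2_norm h M g"
  by (simp add: l2_norm_def)

lemma l2_norm_le_compact_op:
  assumes "f \<in> XM M" "M \<ge> 1" "h > 0"
  shows "l2_norm h M f \<le> 3 / 2 * l2_norm h M (compact_op h f)"
proof (rule power2_le_imp_le)
  have sq: "(l2_norm h M f)\<^sup>2 = h * (\<Sum>j\<in>{0..<int M}. (f j)\<^sup>2)" for f
    using assms(3) by (simp add: l2_norm_def sum_nonneg)
  have "h * (\<Sum>j\<in>{0..<int M}. (f j)\<^sup>2) \<le> h * (9 / 4 * (\<Sum>j\<in>{0..<int M}. (compact_op h f j)\<^sup>2))"
    using assms(3) by (intro mult_left_mono compact_op_coercive[OF assms]) simp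
  then show "(l2_norm h M f)\<^sup>2 \<le> (3 / 2 * l2_norm h M (compact_op h f))\<^sup>2"
    unfolding power_mult_distrib sq by (simp add: power2_eq_square[of "3::real"] mult.left_commute power_divide)
qed (use assms(3) in \<open>simp add: l2_norm_nonneg\<close>)

lemma compact_op_inv_in_XM:
  assumes "f \<in> XM M" "M \<ge> 1" "h > 0"
  shows "compact_op_inv h M f \<in> XM M"
    and compact_op_compact_op_inv: "compact_op h (compact_op_inv h M f) = f"
proof -
  have "f \<in> compact_op h ` XM M" using compact_op_surj[OF assms] by blast
  then show "compact_op_inv h M f \<in> XM M" "compact_op h (compact_op_inv h M f) = f"
    unfolding compact_op_inv_def by (rule inv_into_into, rule f_inv_into_f)
qed

lemma compact_op_inv_compact_op:
  assumes "w \<in> XM M" "M \<ge> 1" "h > 0"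
  shows "compact_op_inv h M (compact_op h w) = w"
  unfolding compact_op_inv_def using assms by (intro inv_into_f_f inj_on_compact_op)

lemma compact_op_linear:
  "compact_op h (\<lambda>j. c * f j + d * g j) = (\<lambda>j. c * compact_op h f j + d * compact_op h g j)"
  unfolding compact_op_def delta_x2_def divide_inverse by (rule ext) (simp add: algebra_simps)

lemma compact_op_delta_x2: "compact_op h (delta_x2 h w) = delta_x2 h (compact_op h w)"
  unfolding compact_op_def delta_x2_def divide_inverse by (rule ext) (simp add: algebra_simps)

lemma delta_x_plus_compact_op: "delta_x_plus h (compact_op h w) = compact_op h (delta_x_plus h w)"
  unfolding compact_op_def delta_x2_def delta_x_plus_def divide_inverse by (rule ext) (simp add: algebra_simps)

lemma compact_op_inv_delta_x2:
  assumes "f \<in> XM M" "M \<ge> 1" "h > 0"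
  shows "compact_op_inv h M (delta_x2 h f) = delta_x2 h (compact_op_inv h M f)"
  using compact_op_inv_compact_op[OF XM_delta_x2[OF compact_op_inv_in_XM(1)[OF assms]] assms(2,3), of h]
  by (simp add: compact_op_delta_x2 compact_op_compact_op_inv[OF assms])

lemma compact_op_inv_linear:
  assumes "f \<in> XM M" "g \<in> XM M" "M \<ge> 1" "h > 0"
  shows "compact_op_inv h M (\<lambda>j. c * f j + d * g j)
    = (\<lambda>j. c * compact_op_inv h M f j + d * compact_op_inv h M g j)"
proof -
  let ?f = "compact_op_inv h M f" and ?g = "compact_op_inv h M g"
  have "(\<lambda>j. c * ?f j + d * ?g j) \<in> XM M"
    by (intro XM_add XM_mult XM_const compact_op_inv_in_XM assms)
  from compact_op_inv_compact_op[OF this assms(3,4)] show ?thesis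
    by (simp add: compact_op_linear compact_op_compact_op_inv[OF assms(1,3,4)]
        compact_op_compact_op_inv[OF assms(2,3,4)])
qed

lemma grid_inner_delta_x2:
  assumes w: "w \<in> XM M" and f: "f \<in> XM M" and M: "M \<ge> 1"
  shows "grid_inner h M (delta_x2 h w) f = - grid_inner h M (delta_x_plus h w) (delta_x_plus h f)"
proof -
  define D where "D = delta_x_plus h w"
  have D: "D \<in> XM M" unfolding D_def by (rule XM_delta_x_plus[OF w])
  have "(\<lambda>j. D j * f (j + 1)) \<in> XM M" by (intro XM_mult D XM_shift f)
  from sum_shift_back[OF this M]
  have shift: "(\<Sum>j\<in>{0..<int M}. D (j - 1) * f j) = (\<Sum>j\<in>{0..<int M}. D j * f (j + 1))" by simp
  have "(\<Sum>j\<in>{0..<int M}. delta_x2 h w j * f j) = (\<Sum>j\<in>{0..<int M}. (D j * f j - D (j - 1) * f j) / h)"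
    by (rule sum.cong)
      (auto simp: D_def delta_x2_def delta_x_plus_def power2_eq_square diff_divide_distrib add_divide_distrib algebra_simps)
  also have "\<dots> = ((\<Sum>j\<in>{0..<int M}. D j * f j) - (\<Sum>j\<in>{0..<int M}. D (j - 1) * f j)) / h"
    by (simp add: sum_divide_distrib[symmetric] sum_subtractf)
  also have "\<dots> = (\<Sum>j\<in>{0..<int M}. - (D j * delta_x_plus h f j))"
    unfolding shift sum_subtractf[symmetric] sum_divide_distrib
    by (rule sum.cong) (simp_all add: delta_x_plus_def diff_divide_distrib algebra_simps)
  finally show ?thesis by (simp add: grid_inner_def D_def sum_negf)
qed

lemma grid_inner_compact_op_commute:
  assumes f: "f \<in> XM M" and g: "g \<in> XM M" and M: "M \<ge> 1" and h: "h > 0"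
  shows "grid_inner h M f (compact_op h g) = grid_inner h M g (compact_op h f)"
proof -
  have "(\<lambda>j. f (j + 1) * g j) \<in> XM M" "(\<lambda>j. g (j + 1) * f j) \<in> XM M" by (intro XM_mult XM_shift f g)+
  from sum_shift_back[OF this(1) M] sum_shift_back[OF this(2) M]
  have "(\<Sum>j\<in>{0..<int M}. f j * g (j - 1)) = (\<Sum>j\<in>{0..<int M}. f (j + 1) * g j)"
    "(\<Sum>j\<in>{0..<int M}. g j * f (j - 1)) = (\<Sum>j\<in>{0..<int M}. g (j + 1) * f j)" by simp_all
  then show ?thesis
    by (simp add: grid_inner_def compact_op_stencil[OF h] sum_divide_distrib[symmetric] distrib_left sum.distrib mult_ac)
qed

text \<open>This is \<open>\<langle>- A\<^sup>-\<^sup>1 \<delta>\<^sub>x\<^sup>2 e, e\<rangle>\<close> after summation by parts: with \<open>e = A w\<close> and \<open>v = \<delta>\<^sub>x\<^sup>+ w\<close> it equals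
  \<open>\<langle>v, A v\<rangle>\<close>, while \<open>\<delta>\<^sub>x\<^sup>+ e = A v\<close>.\<close>

definition stiffness :: "real \<Rightarrow> nat \<Rightarrow> (int \<Rightarrow> real) \<Rightarrow> real" where
  "stiffness h M e = (let v = delta_x_plus h (compact_op_inv h M e) in grid_inner h M v (compact_op h v))"

lemma stiffness_bounds:
  assumes "e \<in> XM M" "M \<ge> 1" "h > 0"
  shows "(l2_norm h M (delta_x_plus h e))\<^sup>2 \<le> stiffness h M e"
    and "stiffness h M e \<le> 3 / 2 * (l2_norm h M (delta_x_plus h e))\<^sup>2"
proof -
  define v where "v = delta_x_plus h (compact_op_inv h M e)"
  have v: "v \<in> XM M" unfolding v_def by (intro XM_delta_x_plus compact_op_inv_in_XM assms)
  have "delta_x_plus h e = compact_op h v"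
    unfolding v_def delta_x_plus_compact_op[symmetric] by (simp add: compact_op_compact_op_inv[OF assms])
  then have eq: "(l2_norm h M (delta_x_plus h e))\<^sup>2 = h * (\<Sum>j\<in>{0..<int M}. (compact_op h v j)\<^sup>2)"
    using assms(3) l2_norm_sq[of h M "compact_op h v"]
    by (simp add: grid_inner_def power2_eq_square[of "compact_op h v _"])
  have eq2: "stiffness h M e = h * (\<Sum>j\<in>{0..<int M}. v j * compact_op h v j)"
    by (simp add: stiffness_def v_def[symmetric] grid_inner_def)
  show "(l2_norm h M (delta_x_plus h e))\<^sup>2 \<le> stiffness h M e"
    unfolding eq eq2 using assms(3) compact_op_form_lower[OF v assms(2,3)] by (intro mult_left_mono) auto
  show "stiffness h M e \<le> 3 / 2 * (l2_norm h M (delta_x_plus h e))\<^sup>2"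
    unfolding eq eq2 using mult_left_mono[OF compact_op_form_upper[OF v assms(2,3)], of h] assms(3)
    by (simp only: mult.left_commute)
qed

definition scheme_op :: "real \<Rightarrow> real \<Rightarrow> nat \<Rightarrow> (nat \<Rightarrow> int \<Rightarrow> real) \<Rightarrow> nat \<Rightarrow> int \<Rightarrow> real" where
  "scheme_op h \<tau> M e n j =
    delta_t2 \<tau> e n j - compact_op_inv h M (delta_x2 h (time_avg e n)) j + time_avg e n j"

lemma scheme_op_diff:
  assumes U: "\<And>n. U n \<in> XM M" and V: "\<And>n. V n \<in> XM M" and M: "M \<ge> 1" and h: "h > 0"
  shows "scheme_op h \<tau> M (\<lambda>n j. V n j - U n j) n j = scheme_op h \<tau> M V n j - scheme_op h \<tau> M U n j"
proof -
  have avgX: "time_avg W n \<in> XM M" if "\<And>n. W n \<in> XM M" for W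
    unfolding time_avg_def[abs_def] divide_inverse by (intro XM_mult XM_add XM_const that)
  have dX: "delta_x2 h (time_avg V n) \<in> XM M" "delta_x2 h (time_avg U n) \<in> XM M"
    by (intro XM_delta_x2 avgX U V)+
  have "delta_x2 h (time_avg (\<lambda>n j. V n j - U n j) n)
      = (\<lambda>j. 1 * delta_x2 h (time_avg V n) j + (-1) * delta_x2 h (time_avg U n) j)"
    unfolding delta_x2_def time_avg_def divide_inverse by (rule ext) (simp add: algebra_simps)
  then have "compact_op_inv h M (delta_x2 h (time_avg (\<lambda>n j. V n j - U n j) n)) j
      = compact_op_inv h M (delta_x2 h (time_avg V n)) j - compact_op_inv h M (delta_x2 h (time_avg U n)) j"
    using compact_op_inv_linear[OF dX M h, of 1 "-1"] by simp
  then show ?thesis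
    unfolding scheme_op_def delta_t2_def time_avg_def divide_inverse by (simp add: algebra_simps)
qed

definition energy :: "real \<Rightarrow> real \<Rightarrow> nat \<Rightarrow> (nat \<Rightarrow> int \<Rightarrow> real) \<Rightarrow> nat \<Rightarrow> real" where
  "energy h \<tau> M e n =
    (l2_norm h M (\<lambda>j. (e (n + 1) j - e n j) / \<tau>))\<^sup>2
    + ((l2_norm h M (e (n + 1)))\<^sup>2 + (l2_norm h M (e n))\<^sup>2) / 2
    + (stiffness h M (e (n + 1)) + stiffness h M (e n)) / 2"

text \<open>With \<open>p\<close>, \<open>q\<close>, \<open>r\<close> the values of \<open>e\<close> at the levels \<open>n + 1\<close>, \<open>n\<close>, \<open>n - 1\<close>, each of the three terms
  of the scheme is a difference of squares when paired with \<open>p - r\<close>: the first because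
  \<open>p - 2 q + r = (p - q) - (q - r)\<close> and \<open>p - r = (p - q) + (q - r)\<close>, the others because they average
  \<open>p\<close> and \<open>r\<close> and the forms are symmetric.\<close>

lemma energy_identity:
  assumes e: "\<And>n. e n \<in> XM M" and M: "M \<ge> 1" and h: "h > 0" and n: "n \<ge> 1"
  shows "energy h \<tau> M e n - energy h \<tau> M e (n - 1)
    = grid_inner h M (scheme_op h \<tau> M e n) (\<lambda>j. e (n + 1) j - e (n - 1) j)"
proof -
  define p q r where "p = e (n + 1)" and "q = e n" and "r = e (n - 1)"
  define P R where "P = compact_op_inv h M p" and "R = compact_op_inv h M r"
  have XM: "p \<in> XM M" "q \<in> XM M" "r \<in> XM M" "P \<in> XM M" "R \<in> XM M"
    unfolding p_def q_def r_def P_def R_def by (intro e compact_op_inv_in_XM M h)+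
  have A: "compact_op h P = p" "compact_op h R = r"
    unfolding P_def R_def by (rule compact_op_compact_op_inv[OF _ M h], rule XM)+
  define D where "D = delta_x_plus h P"
  define G where "G = delta_x_plus h R"
  have DG: "D \<in> XM M" "G \<in> XM M" unfolding D_def G_def by (intro XM_delta_x_plus XM)+
  have inv_avg: "compact_op_inv h M (delta_x2 h (time_avg e n)) = delta_x2 h (\<lambda>j. 1/2 * P j + 1/2 * R j)"
  proof -
    have "time_avg e n = (\<lambda>j. 1/2 * p j + 1/2 * r j)"
      by (rule ext) (simp add: time_avg_def p_def r_def add_divide_distrib)
    moreover have "(\<lambda>j. 1/2 * p j + 1/2 * r j) \<in> XM M" by (intro XM_add XM_mult XM_const XM)
    ultimately show ?thesis
      by (simp only: compact_op_inv_delta_x2[OF _ M h] compact_op_inv_linear[OF XM(1,3) M h] P_def R_def)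
  qed
  have stiff: "grid_inner h M (delta_x2 h (\<lambda>j. 1/2 * P j + 1/2 * R j)) (\<lambda>j. p j - r j)
      = - (stiffness h M p - stiffness h M r) / 2"
  proof -
    have "grid_inner h M (delta_x2 h (\<lambda>j. 1/2 * P j + 1/2 * R j)) (\<lambda>j. p j - r j)
        = - grid_inner h M (delta_x_plus h (\<lambda>j. 1/2 * P j + 1/2 * R j)) (delta_x_plus h (\<lambda>j. p j - r j))"
      by (intro grid_inner_delta_x2 M XM_add XM_diff XM_mult XM_const XM)
    also have "delta_x_plus h (\<lambda>j. 1/2 * P j + 1/2 * R j) = (\<lambda>j. 1/2 * (D j + G j))"
      unfolding D_def G_def delta_x_plus_def divide_inverse by (rule ext) (simp add: algebra_simps)
    also have "delta_x_plus h (\<lambda>j. p j - r j) = (\<lambda>j. compact_op h D j - compact_op h G j)"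
    proof -
      have "delta_x_plus h (\<lambda>j. p j - r j) = (\<lambda>j. delta_x_plus h p j - delta_x_plus h r j)"
        unfolding delta_x_plus_def divide_inverse by (rule ext) (simp add: algebra_simps)
      then show ?thesis
        unfolding A[symmetric] by (simp add: delta_x_plus_compact_op D_def G_def)
    qed
    also have "grid_inner h M (\<lambda>j. 1/2 * (D j + G j)) (\<lambda>j. compact_op h D j - compact_op h G j)
        = 1/2 * (grid_inner h M D (compact_op h D) - grid_inner h M D (compact_op h G)
          + (grid_inner h M G (compact_op h D) - grid_inner h M G (compact_op h G)))"
      by (simp only: grid_inner_linear(1,3,4))
    also have "grid_inner h M D (compact_op h G) = grid_inner h M G (compact_op h D)"
      by (rule grid_inner_compact_op_commute[OF DG M h])
    finally show ?thesis
      unfolding stiffness_def Let_def P_def[symmetric] R_def[symmetric] D_def[symmetric] G_def[symmetric]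
      by argo
  qed
  have sch: "scheme_op h \<tau> M e n = (\<lambda>j. (p j - 2 * q j + r j) / \<tau>\<^sup>2
      - delta_x2 h (\<lambda>j. 1/2 * P j + 1/2 * R j) j + (p j + r j) / 2)"
    by (rule ext) (simp add: scheme_op_def inv_avg delta_t2_def time_avg_def p_def q_def r_def)
  have t1: "grid_inner h M (\<lambda>j. (p j - 2 * q j + r j) / \<tau>\<^sup>2) (\<lambda>j. p j - r j)
      = (l2_norm h M (\<lambda>j. (p j - q j) / \<tau>))\<^sup>2 - (l2_norm h M (\<lambda>j. (q j - r j) / \<tau>))\<^sup>2"
    using h
    by (simp add: l2_norm_sq grid_inner_def right_diff_distrib[symmetric] sum_subtractf[symmetric]
        del: right_diff_distrib_numeral)
      (intro disjI1 sum.cong refl, simp add: power2_eq_square divide_inverse algebra_simps)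
  have t3: "grid_inner h M (\<lambda>j. (p j + r j) / 2) (\<lambda>j. p j - r j)
      = ((l2_norm h M p)\<^sup>2 - (l2_norm h M r)\<^sup>2) / 2"
  proof -
    have eq: "(\<Sum>j\<in>{0..<int M}. (p j + r j) / 2 * (p j - r j)) = (\<Sum>j\<in>{0..<int M}. (p j * p j - r j * r j) / 2)"
      by (rule sum.cong) (auto simp: algebra_simps diff_divide_distrib)
    show ?thesis
      using h unfolding l2_norm_sq[OF less_imp_le[OF h]] grid_inner_def eq
      by (simp add: sum_divide_distrib[symmetric] sum_subtractf right_diff_distrib)
  qed
  have n': "n - 1 + 1 = n" using n by simp
  show ?thesis
    unfolding energy_def n' sch p_def[symmetric] q_def[symmetric] r_def[symmetric]
    unfolding grid_inner_linear(1,2)[of h M _ _ "\<lambda>j. p j - r j"] stiff t1 t3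
    by (simp add: field_simps)
qed

lemma energy_controls:
  assumes e: "\<And>n. e n \<in> XM M" and M: "M \<ge> 1" and h: "h > 0"
  shows "(l2_norm h M (\<lambda>j. (e (n + 1) j - e n j) / \<tau>))\<^sup>2 \<le> energy h \<tau> M e n"
    and "(l2_norm h M (e (n + 1)))\<^sup>2 \<le> 2 * energy h \<tau> M e n"
    and "(l2_norm h M (delta_x_plus h (e (n + 1))))\<^sup>2 \<le> 2 * energy h \<tau> M e n"
    and "energy h \<tau> M e n \<ge> 0"
proof -
  have s: "stiffness h M (e k) \<ge> (l2_norm h M (delta_x_plus h (e k)))\<^sup>2" "stiffness h M (e k) \<ge> 0" for k
    using stiffness_bounds(1)[OF e M h, of k] zero_le_power2[of "l2_norm h M (delta_x_plus h (e k))"] by linarith+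
  have q: "(l2_norm h M (e k))\<^sup>2 \<ge> 0" "(l2_norm h M (\<lambda>j. (e (n + 1) j - e n j) / \<tau>))\<^sup>2 \<ge> 0" for k by auto
  note facts = s[of n] s[of "n + 1"] q(1)[of n] q(1)[of "n + 1"] q(2)
  show "(l2_norm h M (\<lambda>j. (e (n + 1) j - e n j) / \<tau>))\<^sup>2 \<le> energy h \<tau> M e n"
    "(l2_norm h M (e (n + 1)))\<^sup>2 \<le> 2 * energy h \<tau> M e n"
    "(l2_norm h M (delta_x_plus h (e (n + 1))))\<^sup>2 \<le> 2 * energy h \<tau> M e n"
    "energy h \<tau> M e n \<ge> 0"
    using facts unfolding energy_def by argo+
qed

text \<open>The increment of the energy is at most \<open>\<tau> \<rho> (\<surd>E\<^sub>n + \<surd>E\<^sub>n\<^sub>-\<^sub>1)\<close>, where \<open>\<rho>\<close> is the norm of the residual,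
  because \<open>e\<^sup>n\<^sup>+\<^sup>1 - e\<^sup>n\<^sup>-\<^sup>1\<close> is \<open>\<tau>\<close> times a sum of two difference quotients in time. Cancelling the
  common factor leaves a linear recursion for the square root.\<close>

lemma energy_step:
  assumes e: "\<And>n. e n \<in> XM M" and M: "M \<ge> 1" and h: "h > 0" and n: "n \<ge> 1" and \<tau>: "\<tau> > 0"
  shows "sqrt (energy h \<tau> M e n)
    \<le> sqrt (energy h \<tau> M e (n - 1)) + \<tau> * l2_norm h M (scheme_op h \<tau> M e n)"
proof -
  define E where "E k = energy h \<tau> M e k" for k
  define \<rho> where "\<rho> = l2_norm h M (scheme_op h \<tau> M e n)"
  define d where "d k = (\<lambda>j. (e (k + 1) j - e k j) / \<tau>)" for k
  have E0: "E k \<ge> 0" for k unfolding E_def by (rule energy_controls(4)[OF e M h])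
  have d: "l2_norm h M (d k) \<le> sqrt (E k)" for k
    unfolding E_def d_def by (rule real_le_rsqrt[OF energy_controls(1)[OF e M h]])
  have \<rho>0: "\<rho> \<ge> 0" unfolding \<rho>_def using h by (simp add: l2_norm_nonneg)
  have split: "(\<lambda>j. e (n + 1) j - e (n - 1) j) = (\<lambda>j. \<tau> * (d n j + d (n - 1) j))"
    using \<tau> n by (auto simp: d_def field_simps)
  have "E n - E (n - 1) = grid_inner h M (scheme_op h \<tau> M e n) (\<lambda>j. \<tau> * (d n j + d (n - 1) j))"
    unfolding E_def split[symmetric] by (rule energy_identity[OF e M h n])
  also have "\<dots> \<le> \<rho> * l2_norm h M (\<lambda>j. \<tau> * (d n j + d (n - 1) j))"
    unfolding \<rho>_def using h by (intro grid_inner_le) simp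
  also have "l2_norm h M (\<lambda>j. \<tau> * (d n j + d (n - 1) j)) = \<tau> * l2_norm h M (\<lambda>j. d n j + d (n - 1) j)"
    using h \<tau> by (intro l2_norm_cmult) auto
  also have "\<rho> * (\<tau> * l2_norm h M (\<lambda>j. d n j + d (n - 1) j)) \<le> \<rho> * (\<tau> * (sqrt (E n) + sqrt (E (n - 1))))"
    using l2_norm_triangle[of h M "d n" "d (n - 1)"] d[of n] d[of "n - 1"] h \<tau> \<rho>0
    by (intro mult_left_mono) auto
  finally have *: "E n - E (n - 1) \<le> (\<tau> * \<rho>) * (sqrt (E n) + sqrt (E (n - 1)))" by (simp add: mult_ac)
  have "sqrt (E n) \<le> sqrt (E (n - 1)) + \<tau> * \<rho>"
  proof (cases "sqrt (E n) + sqrt (E (n - 1)) = 0")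
    case True
    then have "sqrt (E n) = 0" "sqrt (E (n - 1)) = 0" using E0[of n] E0[of "n - 1"] by (auto simp: add_nonneg_eq_0_iff)
    then show ?thesis using \<tau> \<rho>0 by simp
  next
    case False
    then have pos: "sqrt (E n) + sqrt (E (n - 1)) > 0"
      using E0[of n] E0[of "n - 1"] by (metis add_nonneg_nonneg order_le_less real_sqrt_ge_zero)
    have "(sqrt (E n) - sqrt (E (n - 1))) * (sqrt (E n) + sqrt (E (n - 1))) = E n - E (n - 1)"
      using E0[of n] E0[of "n - 1"] by (simp add: algebra_simps)
    with * have "(sqrt (E n) - sqrt (E (n - 1))) * (sqrt (E n) + sqrt (E (n - 1)))
        \<le> (\<tau> * \<rho>) * (sqrt (E n) + sqrt (E (n - 1)))" by simp
    then have "sqrt (E n) - sqrt (E (n - 1)) \<le> \<tau> * \<rho>" using pos by (rule mult_right_le_imp_le)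
    then show ?thesis by simp
  qed
  then show ?thesis unfolding E_def \<rho>_def .
qed

lemma telescope_int:
  fixes f :: "int \<Rightarrow> real"
  assumes "k \<le> j"
  shows "f j - f k = (\<Sum>i\<in>{k..<j}. f (i + 1) - f i)"
  using assms
proof (induction j rule: int_ge_induct)
  case (step j)
  have "{k..<j + 1} = insert j {k..<j}" using step.hyps by auto
  with step show ?case by simp
qed simp

text \<open>The smallest value of \<open>\<bar>f\<bar>\<close> is bounded by the quadratic mean, and the variation by the Cauchy-Schwarz
  inequality.\<close>

lemma discrete_sobolev:
  assumes M: "M \<ge> 1" and h: "h > 0" and j: "j \<in> {0..<int M}"
  shows "\<bar>f j\<bar> \<le> l2_norm h M f / sqrt (h * real M) + sqrt (h * real M) * l2_norm h M (delta_x_plus h f)"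
proof -
  let ?J = "{0..<int M}"
  define len where "len = h * real M"
  have len: "len > 0" using M h by (simp add: len_def)
  obtain k where k: "k \<in> ?J" "\<And>i. i \<in> ?J \<Longrightarrow> \<bar>f k\<bar> \<le> \<bar>f i\<bar>"
    using ex_is_arg_min_if_finite[of ?J "\<lambda>i. \<bar>f i\<bar>"] j
    unfolding is_arg_min_linorder by auto
  have "sqrt len * \<bar>f k\<bar> \<le> l2_norm h M f"
  proof -
    have "sqrt len * \<bar>f k\<bar> = l2_norm h M (\<lambda>_. f k)"
      using h by (simp add: l2_norm_def len_def real_sqrt_mult mult.assoc)
    also have "\<dots> \<le> l2_norm h M f" using h k by (intro l2_norm_mono) auto
    finally show ?thesis .
  qed
  then have fk: "\<bar>f k\<bar> \<le> l2_norm h M f / sqrt len" using len by (simp add: field_simps)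
  have var: "(\<Sum>i\<in>?J. \<bar>f (i + 1) - f i\<bar>) \<le> sqrt len * l2_norm h M (delta_x_plus h f)"
  proof -
    have "(\<Sum>i\<in>?J. \<bar>f (i + 1) - f i\<bar>) = grid_inner h M (\<lambda>_. 1) (\<lambda>i. \<bar>delta_x_plus h f i\<bar>)"
      using h by (simp add: grid_inner_def delta_x_plus_def sum_distrib_left)
    also have "\<dots> \<le> l2_norm h M (\<lambda>_. 1) * l2_norm h M (\<lambda>i. \<bar>delta_x_plus h f i\<bar>)"
      using h by (intro grid_inner_le) simp
    also have "\<dots> = sqrt len * l2_norm h M (delta_x_plus h f)" by (simp add: l2_norm_def len_def)
    finally show ?thesis .
  qed
  have diff: "\<bar>f y - f x\<bar> \<le> (\<Sum>i\<in>?J. \<bar>f (i + 1) - f i\<bar>)" if "x \<le> y" "x \<in> ?J" "y \<in> ?J" for x y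
  proof -
    have "\<bar>f y - f x\<bar> \<le> (\<Sum>i\<in>{x..<y}. \<bar>f (i + 1) - f i\<bar>)"
      unfolding telescope_int[OF that(1)] by (rule sum_abs)
    also have "\<dots> \<le> (\<Sum>i\<in>?J. \<bar>f (i + 1) - f i\<bar>)" using that by (intro sum_mono2) auto
    finally show ?thesis .
  qed
  have "\<bar>f j - f k\<bar> \<le> (\<Sum>i\<in>?J. \<bar>f (i + 1) - f i\<bar>)"
    using diff[of j k] diff[of k j] j k(1) by (cases "j \<le> k") (auto simp: abs_minus_commute)
  then show ?thesis using fk var unfolding len_def by linarith
qed

text \<open>The residual is controlled only while \<open>\<bar>e\<bar> \<le> 1\<close>. The induction yields this condition itself: the
  energy at level \<open>k\<close> contains the error at level \<open>k + 1\<close>, so the estimate up to level \<open>k\<close> gives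
  \<open>\<bar>e\<bar> \<le> 1\<close> at level \<open>k + 1\<close>, just what the next step needs. The growth factors \<open>q\<close> per step multiply
  up to the exponential in \<open>G\<close>.\<close>

lemma energy_bootstrap:
  assumes e: "\<And>n. e n \<in> XM M" and M: "M \<ge> 1" and h: "h > 0" and \<tau>: "\<tau> > 0"
    and nonneg: "c \<ge> 0" "B \<ge> 0"
    and residual: "\<And>n. 1 \<le> n \<Longrightarrow> real (n + 1) * \<tau> \<le> T \<Longrightarrow> (\<And>j. j \<in> {0..<int M} \<Longrightarrow> \<bar>e n j\<bar> \<le> 1) \<Longrightarrow>
      l2_norm h M (scheme_op h \<tau> M e n) \<le> c * l2_norm h M (e n) + B"
    and init: "sqrt (energy h \<tau> M e 0) \<le> a0" 
    and G: "G = exp (sqrt 2 * c * T) * (a0 + T * B)"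
    and small: "(1 / sqrt (h * real M) + sqrt (h * real M)) * (sqrt 2 * G) \<le> 1"
    and n: "real (n + 1) * \<tau> \<le> T"
  shows "l2_norm h M (e (n + 1)) \<le> sqrt 2 * G" (is ?A)
    and "l2_norm h M (delta_x_plus h (e (n + 1))) \<le> sqrt 2 * G" (is ?B)
    and "\<And>j. j \<in> {0..<int M} \<Longrightarrow> \<bar>e (n + 1) j\<bar> \<le> 1" (is "PROP ?C")
proof -
  define E where "E k = sqrt (energy h \<tau> M e k)" for k
  define q where "q = 1 + \<tau> * (c * sqrt 2)"
  have q1: "q \<ge> 1" using nonneg \<tau> by (simp add: q_def)
  have E0: "E k \<ge> 0" for k by (simp add: E_def energy_controls(4)[OF e M h])
  have a0: "a0 \<ge> 0" using init E0[of 0] unfolding E_def by linarith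
  have le_G: "E k \<le> G" if "E k \<le> q ^ k * (a0 + real k * \<tau> * B)" "real (k + 1) * \<tau> \<le> T" for k
  proof -
    have kT: "real k * \<tau> \<le> T" using that(2) \<tau> by (simp add: algebra_simps)
    have "q ^ k \<le> exp (\<tau> * (c * sqrt 2)) ^ k"
      using nonneg \<tau> exp_ge_add_one_self by (intro power_mono) (auto simp: q_def)
    also have "\<dots> = exp (sqrt 2 * c * (real k * \<tau>))"
      by (simp add: exp_of_nat_mult[symmetric] mult_ac)
    also have "\<dots> \<le> exp (sqrt 2 * c * T)" using kT nonneg by (simp add: mult_left_mono)
    finally have "q ^ k * (a0 + real k * \<tau> * B) \<le> G"
      unfolding G using kT nonneg a0 \<tau> q1 by (intro mult_mono add_mono mult_right_mono) auto
    with that(1) show ?thesis by linarith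
  qed
  have norms: "l2_norm h M (e (k + 1)) \<le> sqrt 2 * G" "l2_norm h M (delta_x_plus h (e (k + 1))) \<le> sqrt 2 * G"
    if "E k \<le> G" for k
  proof -
    have "l2_norm h M (e (k + 1)) \<le> sqrt (2 * energy h \<tau> M e k)"
      "l2_norm h M (delta_x_plus h (e (k + 1))) \<le> sqrt (2 * energy h \<tau> M e k)"
      by (rule real_le_rsqrt[OF energy_controls(2)[OF e M h]] real_le_rsqrt[OF energy_controls(3)[OF e M h]])+
    moreover have "sqrt (2 * energy h \<tau> M e k) \<le> sqrt 2 * G"
      using that by (simp add: real_sqrt_mult E_def)
    ultimately show "l2_norm h M (e (k + 1)) \<le> sqrt 2 * G" "l2_norm h M (delta_x_plus h (e (k + 1))) \<le> sqrt 2 * G"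
      by linarith+
  qed
  have sup: "\<bar>e (k + 1) j\<bar> \<le> 1" if k: "E k \<le> G" and j: "j \<in> {0..<int M}" for k j
  proof -
    have "\<bar>e (k + 1) j\<bar> \<le> l2_norm h M (e (k + 1)) / sqrt (h * real M)
        + sqrt (h * real M) * l2_norm h M (delta_x_plus h (e (k + 1)))"
      by (rule discrete_sobolev[OF M h j])
    also have "\<dots> \<le> (sqrt 2 * G) / sqrt (h * real M) + sqrt (h * real M) * (sqrt 2 * G)"
      using norms[OF k] h by (intro add_mono divide_right_mono mult_left_mono) auto
    also have "\<dots> = (1 / sqrt (h * real M) + sqrt (h * real M)) * (sqrt 2 * G)"
      by (simp add: field_simps)
    finally show ?thesis using small by linarith
  qed
  have "E n \<le> q ^ n * (a0 + real n * \<tau> * B)"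
    using n
  proof (induction n)
    case 0
    then show ?case using init by (simp add: E_def)
  next
    case (Suc k)
    have kT: "real (k + 1) * \<tau> \<le> T" using Suc.prems \<tau> by (simp add: algebra_simps)
    have IH: "E k \<le> q ^ k * (a0 + real k * \<tau> * B)" by (rule Suc.IH[OF kT])
    have kG: "E k \<le> G" by (rule le_G[OF IH kT])
    have "l2_norm h M (scheme_op h \<tau> M e (Suc k)) \<le> c * l2_norm h M (e (Suc k)) + B"
      using residual[of "Suc k"] Suc.prems sup[OF kG] by simp
    also have "l2_norm h M (e (Suc k)) \<le> sqrt 2 * E k"
      using real_le_rsqrt[OF energy_controls(2)[OF e M h, where n=k and \<tau>=\<tau>]] by (simp add: E_def real_sqrt_mult)
    finally have res: "l2_norm h M (scheme_op h \<tau> M e (Suc k)) \<le> c * (sqrt 2 * E k) + B"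
      using nonneg by (simp add: mult_left_mono)
    have "E (Suc k) \<le> E k + \<tau> * l2_norm h M (scheme_op h \<tau> M e (Suc k))"
      using energy_step[OF e M h _ \<tau>, of "Suc k"] by (simp add: E_def)
    also have "\<dots> \<le> E k + \<tau> * (c * (sqrt 2 * E k) + B)"
      using res \<tau> by (intro add_left_mono mult_left_mono) auto
    also have "\<dots> = q * E k + \<tau> * B" by (simp add: q_def algebra_simps)
    also have "\<dots> \<le> q * (q ^ k * (a0 + real k * \<tau> * B)) + q ^ Suc k * (\<tau> * B)"
      using IH q1 \<tau> nonneg mult_right_mono[OF one_le_power[OF q1], of "\<tau> * B" "Suc k"]
      by (intro add_mono mult_left_mono) auto
    also have "\<dots> = q ^ Suc k * (a0 + real (Suc k) * \<tau> * B)" by (simp add: algebra_simps)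
    finally show ?case .
  qed
  from le_G[OF this n] have nG: "E n \<le> G" .
  show ?A ?B by (rule norms[OF nG])+
  show "\<bar>e (n + 1) j\<bar> \<le> 1" if "j \<in> {0..<int M}" for j by (rule sup[OF nG that])
qed

section \<open>Taylor expansion on the periodic grid\<close>

text \<open>Assuming only that the top derivative is Lipschitz matches what an essentially bounded weak
  derivative of the next order provides. The constant is not optimal; only the order matters below.\<close>

lemma taylor_lipschitz:
  fixes G :: "nat \<Rightarrow> real \<Rightarrow> real"
  assumes "\<And>l z. l < m \<Longrightarrow> z \<in> {c..d} \<Longrightarrow> (G l has_real_derivative G (Suc l) z) (at z within {c..d})"
    and "\<And>z. z \<in> {c..d} \<Longrightarrow> \<bar>G m z - G m x\<bar> \<le> L * \<bar>z - x\<bar>"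
    and "x \<in> {c..d}" "y \<in> {c..d}" "L \<ge> 0"
  shows "\<bar>G 0 y - (\<Sum>l\<le>m. G l x * (y - x) ^ l / fact l)\<bar> \<le> L * \<bar>y - x\<bar> ^ (m + 1)"
  using assms
proof (induction m arbitrary: G y)
  case 0
  then show ?case by simp
next
  case (Suc m)
  define R where "R z = G 0 z - (\<Sum>l\<le>Suc m. G l x * (z - x) ^ l / fact l)" for z
  define R' where "R' z = G 1 z - (\<Sum>l\<le>m. G (Suc l) x * (z - x) ^ l / fact l)" for z
  have IH: "\<bar>R' z\<bar> \<le> L * \<bar>z - x\<bar> ^ (m + 1)" if "z \<in> {c..d}" for z
    using Suc.IH[of "\<lambda>l. G (Suc l)" z] Suc.prems that by (simp add: R'_def)
  have dR: "(R has_real_derivative R' z) (at z within {c..d})" if z: "z \<in> {c..d}" for z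
  proof -
    have split: "(\<Sum>l\<le>Suc m. G l x * (z - x) ^ l / fact l) =
        G 0 x + (\<Sum>l\<le>m. G (Suc l) x * (z - x) ^ Suc l / fact (Suc l))" for z
      by (simp add: sum.atMost_Suc_shift del: sum.atMost_Suc fact_Suc power_Suc)
    have trm: "((\<lambda>z. G (Suc l) x * (z - x) ^ Suc l / fact (Suc l)) has_real_derivative
        G (Suc l) x * (z - x) ^ l / fact l) (at z within {c..d})" for l
    proof -
      have "((\<lambda>z. (z - x) ^ Suc l) has_real_derivative real (Suc l) * (z - x) ^ l) (at z within {c..d})"
        by (auto intro!: derivative_eq_intros simp del: power_Suc of_nat_Suc)
      from DERIV_cdivide[OF DERIV_cmult[OF this, of "G (Suc l) x"], of "fact (Suc l)"]
      show ?thesis by (simp del: power_Suc of_nat_Suc)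
    qed
    from DERIV_diff[OF Suc.prems(1)[of 0 z] DERIV_add[OF DERIV_const DERIV_sum[OF trm]]] z
    show ?thesis
      unfolding R_def R'_def split by (simp del: fact_Suc power_Suc)
  qed
  define S where "S = {min x y..max x y}"
  have S: "S \<subseteq> {c..d}" using Suc.prems by (auto simp: S_def)
  have "norm (R y - R x) \<le> L * \<bar>y - x\<bar> ^ (m + 1) * norm (y - x)"
  proof (rule field_differentiable_bound)
    show "convex S" "y \<in> S" "x \<in> S" by (auto simp: S_def)
    fix z assume z: "z \<in> S"
    show "(R has_real_derivative R' z) (at z within S)"
      using dR[of z] z S by (meson DERIV_subset subsetD)
    have "\<bar>z - x\<bar> \<le> \<bar>y - x\<bar>" using z by (auto simp: S_def)
    then have "L * \<bar>z - x\<bar> ^ (m + 1) \<le> L * \<bar>y - x\<bar> ^ (m + 1)"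
      using Suc.prems by (intro mult_left_mono power_mono) auto
    then show "norm (R' z) \<le> L * \<bar>y - x\<bar> ^ (m + 1)"
      using IH[of z] z S by auto
  qed
  moreover have "R x = 0" by (simp add: R_def power_0_left sum.atMost_Suc_shift del: sum.atMost_Suc)
  ultimately show ?case by (simp add: R_def mult_ac)
qed

lemma lipschitz_of_bounded_derivative:
  fixes f :: "real \<Rightarrow> real"
  assumes "\<And>z. z \<in> {c..d} \<Longrightarrow> (f has_real_derivative f' z) (at z within {c..d})"
    "\<And>z. z \<in> {c..d} \<Longrightarrow> \<bar>f' z\<bar> \<le> K" "x \<in> {c..d}" "y \<in> {c..d}"
  shows "\<bar>f y - f x\<bar> \<le> K * \<bar>y - x\<bar>"
  using field_differentiable_bound[of "{c..d}" f f' K y x] assms by auto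

lemma taylor_bounded:
  fixes G :: "nat \<Rightarrow> real \<Rightarrow> real"
  assumes "\<And>l z. l \<le> m \<Longrightarrow> z \<in> {c..d} \<Longrightarrow> (G l has_real_derivative G (Suc l) z) (at z within {c..d})"
    and "\<And>z. z \<in> {c..d} \<Longrightarrow> \<bar>G (Suc m) z\<bar> \<le> K"
    and "x \<in> {c..d}" "y \<in> {c..d}" "K \<ge> 0"
  shows "\<bar>G 0 y - (\<Sum>l\<le>m. G l x * (y - x) ^ l / fact l)\<bar> \<le> K * \<bar>y - x\<bar> ^ (m + 1)"
proof (rule taylor_lipschitz)
  fix z assume z: "z \<in> {c..d}"
  show "\<bar>G m z - G m x\<bar> \<le> K * \<bar>z - x\<bar>"
    by (rule lipschitz_of_bounded_derivative[where f="G m" and f'="G (Suc m)", OF assms(1) assms(2) assms(3) z]) auto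
qed (use assms in auto)

text \<open>The odd terms of the two expansions cancel.\<close>

lemma time_average_taylor:
  assumes d: "\<And>l s. l \<le> 1 \<Longrightarrow> s \<in> {0..T} \<Longrightarrow> (G l has_real_derivative G (Suc l) s) (at s within {0..T})"
    and B: "\<And>s. s \<in> {0..T} \<Longrightarrow> \<bar>G 2 s\<bar> \<le> B" "B \<ge> 0"
    and t: "0 \<le> t - \<tau>" "t + \<tau> \<le> T" "\<tau> \<ge> 0"
  shows "\<bar>(G 0 (t + \<tau>) + G 0 (t - \<tau>)) / 2 - G 0 t\<bar> \<le> B * \<tau>\<^sup>2"
proof -
  have m: "\<bar>G 0 s - (\<Sum>l\<le>1. G l t * (s - t) ^ l / fact l)\<bar> \<le> B * \<bar>s - t\<bar> ^ (1 + 1)" if "s \<in> {0..T}" for s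
    by (rule taylor_bounded[where m=1 and c=0 and d=T]) (use d B t that in \<open>auto simp: numeral_2_eq_2\<close>)
  have "\<bar>G 0 (t + \<tau>) - (G 0 t + G 1 t * \<tau>)\<bar> \<le> B * \<tau>\<^sup>2" "\<bar>G 0 (t - \<tau>) - (G 0 t - G 1 t * \<tau>)\<bar> \<le> B * \<tau>\<^sup>2"
    using m[of "t + \<tau>"] m[of "t - \<tau>"] t by (auto simp: power2_eq_square)
  then show ?thesis unfolding abs_le_iff by argo
qed

text \<open>Reducing the index modulo \<open>M\<close> gives the periodic extension of the values on \<open>[a, b)\<close>, whatever
  \<open>f\<close> does outside that interval.\<close>

definition grid_values :: "real \<Rightarrow> real \<Rightarrow> nat \<Rightarrow> (real \<Rightarrow> real) \<Rightarrow> int \<Rightarrow> real" where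
  "grid_values a h M f j = f (grid a h (j mod int M))"

lemma grid_values_XM: "grid_values a h M f \<in> XM M"
  by (simp add: XM_def grid_values_def)

context
  fixes a b h :: real and M :: nat
  assumes ab: "a < b" and M: "M \<ge> 1" and h: "h = (b - a) / real M"
begin

lemma mesh_pos: "h > 0" and mesh_total: "h * real M = b - a"
  using ab M by (auto simp: h)

lemma grid_in: "0 \<le> i \<Longrightarrow> i \<le> int M \<Longrightarrow> grid a h i \<in> {a..b}"
proof -
  assume i: "0 \<le> i" "i \<le> int M"
  have "real_of_int i * h \<le> real M * h"
    using i mesh_pos by (intro mult_right_mono) linarith+
  then show "grid a h i \<in> {a..b}"
    using i mesh_pos mesh_total by (simp add: grid_def mult.commute)
qed

lemma grid_mod_in: "grid a h (j mod int M) \<in> {a..b}"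
  using M by (intro grid_in) (auto simp: less_imp_le)

lemma grid_values_cong:
  "(\<And>x. x \<in> {a..b} \<Longrightarrow> f x = g x) \<Longrightarrow> grid_values a h M f = grid_values a h M g"
  using grid_mod_in by (auto simp: grid_values_def)

lemma grid_values_nbr_right:
  "grid a h (j mod int M) + h \<in> {a..b}"
  "f a = f b \<Longrightarrow> grid_values a h M f (j + 1) = f (grid a h (j mod int M) + h)"
proof -
  define c where "c = j mod int M"
  have c: "0 \<le> c" "c < int M" using M by (auto simp: c_def)
  have g: "grid a h c + h = grid a h (c + 1)" by (simp add: grid_def algebra_simps)
  show "grid a h (j mod int M) + h \<in> {a..b}"
    unfolding c_def[symmetric] g using c by (intro grid_in) auto
  assume per: "f a = f b"
  have "(j + 1) mod int M = (c + 1) mod int M" by (simp add: c_def mod_simps)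
  show "grid_values a h M f (j + 1) = f (grid a h (j mod int M) + h)"
  proof (cases "c + 1 = int M")
    case True
    then have "(j + 1) mod int M = 0" using \<open>(j + 1) mod int M = (c + 1) mod int M\<close> by simp
    moreover have "grid a h (c + 1) = b" unfolding True using mesh_total by (simp add: grid_def mult.commute)
    ultimately show ?thesis unfolding grid_values_def c_def[symmetric] g using per by (simp add: grid_def)
  next
    case False
    then have "(j + 1) mod int M = c + 1" using \<open>(j + 1) mod int M = (c + 1) mod int M\<close> c by simp
    then show ?thesis unfolding grid_values_def c_def[symmetric] g by simp
  qed
qed

text \<open>At \<open>j = 0\<close> the left neighbour is reached from the other end point: for a function with equal
  boundary values, \<open>x = b\<close> serves in place of \<open>a\<close>.\<close>

lemma grid_values_nbr_left:
  obtains x where "x \<in> {a..b}" "x - h \<in> {a..b}"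
    "\<And>f. f a = f b \<Longrightarrow> f x = grid_values a h M f j \<and> grid_values a h M f (j - 1) = f (x - h)"
proof (cases "j mod int M = 0")
  case True
  have b: "grid a h (int M) = b" using mesh_total by (simp add: grid_def mult.commute)
  have g: "b - h = grid a h (int M - 1)" unfolding b[symmetric] by (simp add: grid_def algebra_simps)
  have "(j - 1) mod int M = (j mod int M - 1) mod int M" by (simp add: mod_simps)
  also have "\<dots> = int M - 1" unfolding True using M by (simp add: zmod_minus1)
  finally have "(j - 1) mod int M = int M - 1" .
  then show ?thesis
    using that[of b] True ab M g grid_in[of "int M - 1"] by (auto simp: grid_values_def grid_def)
next
  case False
  define c where "c = j mod int M"
  have c: "0 \<le> c" "c < int M" "c \<noteq> 0" using M False by (auto simp: c_def)
  have g: "grid a h c - h = grid a h (c - 1)" by (simp add: grid_def algebra_simps)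
  have "(j - 1) mod int M = (c - 1) mod int M" by (simp add: c_def mod_simps)
  then have "(j - 1) mod int M = c - 1" using c by simp
  then show ?thesis
    using that[of "grid a h c"] c grid_in[of c] grid_in[of "c - 1"] g
    by (auto simp: grid_values_def c_def[symmetric])
qed

text \<open>Both terms equal \<open>G\<^sub>2 + h\<^sup>2 G\<^sub>4 / 12\<close> up to \<open>O(h\<^sup>4)\<close>. The right neighbour is expanded at \<open>x\<close> and the left
  neighbour at \<open>y\<close>, which is either \<open>x\<close> or the opposite end point; all derivatives agree at \<open>x\<close> and
  \<open>y\<close>.\<close>

lemma compact_consistency:
  fixes G :: "nat \<Rightarrow> real \<Rightarrow> real"
  assumes d: "\<And>l z. l < 5 \<Longrightarrow> z \<in> {a..b} \<Longrightarrow> (G l has_real_derivative G (Suc l) z) (at z within {a..b})"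
    and lip: "\<And>y z. y \<in> {a..b} \<Longrightarrow> z \<in> {a..b} \<Longrightarrow> \<bar>G 5 z - G 5 y\<bar> \<le> K * \<bar>z - y\<bar>"
    and per: "\<And>l. l \<le> 5 \<Longrightarrow> G l a = G l b" and K: "K \<ge> 0"
  shows "\<bar>compact_op h (grid_values a h M (G 2)) j - delta_x2 h (grid_values a h M (G 0)) j\<bar> \<le> 3 * K * h ^ 4"
proof -
  define x where "x = grid a h (j mod int M)"
  have x: "x \<in> {a..b}" "x + h \<in> {a..b}" unfolding x_def by (rule grid_mod_in grid_values_nbr_right(1))+
  obtain y where y: "y \<in> {a..b}" "y - h \<in> {a..b}"
    "\<And>f. f a = f b \<Longrightarrow> f y = grid_values a h M f j \<and> grid_values a h M f (j - 1) = f (y - h)"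
    using grid_values_nbr_left[of j] by blast
  have h0: "h > 0" by (rule mesh_pos)
  define P where "P l = G l x" for l
  have Py: "G l y = P l" if "l \<le> 5" for l
    using y(3)[OF per[OF that]] by (simp add: P_def grid_values_def x_def)
  have R: "grid_values a h M (G l) (j + 1) = G l (x + h)" "grid_values a h M (G l) (j - 1) = G l (y - h)"
    "grid_values a h M (G l) j = P l" if "l \<le> 5" for l
    using y(3)[OF per[OF that]] grid_values_nbr_right(2)[OF per[OF that]]
    by (auto simp: P_def grid_values_def x_def)
  have t6: "\<bar>G 0 z' - (\<Sum>l\<le>5. G l z * (z' - z) ^ l / fact l)\<bar> \<le> K * \<bar>z' - z\<bar> ^ (5 + 1)"
    if "z \<in> {a..b}" "z' \<in> {a..b}" for z z'
    by (rule taylor_lipschitz) (use d lip K that in auto)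
  have t4: "\<bar>G (0 + 2) z' - (\<Sum>l\<le>3. G (l + 2) z * (z' - z) ^ l / fact l)\<bar> \<le> K * \<bar>z' - z\<bar> ^ (3 + 1)"
    if "z \<in> {a..b}" "z' \<in> {a..b}" for z z'
    by (rule taylor_lipschitz[where G="\<lambda>l. G (l + 2)"]) (use d lip K that in auto)
  have s5: "{..5::nat} = {0,1,2,3,4,5}" and s3: "{..3::nat} = {0,1,2,3}" by auto
  define e1 where "e1 = G 0 (x + h) - (P 0 + P 1 * h + P 2 * h^2 / 2 + P 3 * h^3 / 6 + P 4 * h^4 / 24 + P 5 * h^5 / 120)"
  define e2 where "e2 = G 0 (y - h) - (P 0 - P 1 * h + P 2 * h^2 / 2 - P 3 * h^3 / 6 + P 4 * h^4 / 24 - P 5 * h^5 / 120)"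
  define e3 where "e3 = G 2 (x + h) - (P 2 + P 3 * h + P 4 * h^2 / 2 + P 5 * h^3 / 6)"
  define e4 where "e4 = G 2 (y - h) - (P 2 - P 3 * h + P 4 * h^2 / 2 - P 5 * h^3 / 6)"
  have e1: "\<bar>e1\<bar> \<le> K * h ^ 6" using t6[OF x] h0 unfolding s5
    by (simp add: e1_def P_def fact_numeral add.assoc)
  have e2: "\<bar>e2\<bar> \<le> K * h ^ 6" using t6[OF y(1,2)] h0 unfolding s5
    by (simp add: e2_def Py fact_numeral add.assoc power_minus_odd power_minus_even)
  have e3: "\<bar>e3\<bar> \<le> K * h ^ 4" using t4[OF x] h0 unfolding s3
    by (simp add: e3_def P_def fact_numeral add.assoc eval_nat_numeral)
  have e4: "\<bar>e4\<bar> \<le> K * h ^ 4" using t4[OF y(1,2)] h0 unfolding s3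
    by (simp add: e4_def Py fact_numeral add.assoc eval_nat_numeral)
  have "compact_op h (grid_values a h M (G 2)) j = P 2 + h^2 * P 4 / 12 + (e3 + e4) / 12"
    by (simp only: compact_op_stencil[OF h0] R[of 2, simplified]) (simp add: e3_def e4_def field_simps)
  moreover have "delta_x2 h (grid_values a h M (G 0)) j = P 2 + h^2 * P 4 / 12 + (e1 + e2) / h^2"
    unfolding delta_x2_def R[of 0, simplified] using h0
    by (simp add: e1_def e2_def field_simps eval_nat_numeral)
  ultimately have eq: "compact_op h (grid_values a h M (G 2)) j - delta_x2 h (grid_values a h M (G 0)) j
      = (e3 + e4) / 12 - (e1 + e2) / h^2" by simp
  have "\<bar>e1 + e2\<bar> \<le> (2 * K * h ^ 4) * h^2"
    using e1 e2 by (simp add: eval_nat_numeral mult_ac)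
  then have "\<bar>(e1 + e2) / h^2\<bar> \<le> 2 * (K * h ^ 4)" using h0 by (simp add: field_simps abs_divide)
  moreover have "K * h ^ 4 \<ge> 0" using K h0 by simp
  moreover have "\<bar>(e3 + e4) / 12 - X\<bar> \<le> 3 * Y"
    if "\<bar>X\<bar> \<le> 2 * Y" "Y \<ge> 0" "\<bar>e3\<bar> \<le> Y" "\<bar>e4\<bar> \<le> Y" for X Y
    using that unfolding abs_le_iff by argo
  ultimately have "\<bar>(e3 + e4) / 12 - (e1 + e2) / h^2\<bar> \<le> 3 * (K * h ^ 4)"
    using e3 e4 by blast
  then show ?thesis unfolding eq by (simp add: mult.assoc)
qed

lemma second_difference_bound:
  fixes G :: "nat \<Rightarrow> real \<Rightarrow> real"
  assumes d: "\<And>z. z \<in> {a..b} \<Longrightarrow> (G 0 has_real_derivative G 1 z) (at z within {a..b})"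
    and lip: "\<And>y z. y \<in> {a..b} \<Longrightarrow> z \<in> {a..b} \<Longrightarrow> \<bar>G 1 z - G 1 y\<bar> \<le> K * \<bar>z - y\<bar>"
    and per: "G 0 a = G 0 b" "G 1 a = G 1 b" and K: "K \<ge> 0"
  shows "\<bar>delta_x2 h (grid_values a h M (G 0)) j\<bar> \<le> 2 * K"
proof -
  define x where "x = grid a h (j mod int M)"
  have x: "x \<in> {a..b}" "x + h \<in> {a..b}" unfolding x_def by (rule grid_mod_in grid_values_nbr_right(1))+
  obtain y where y: "y \<in> {a..b}" "y - h \<in> {a..b}"
    "\<And>f. f a = f b \<Longrightarrow> f y = grid_values a h M f j \<and> grid_values a h M f (j - 1) = f (y - h)"
    using grid_values_nbr_left[of j] by blast
  have h0: "h > 0" by (rule mesh_pos)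
  have Py: "G 0 y = G 0 x" "G 1 y = G 1 x"
    using y(3)[OF per(1)] y(3)[OF per(2)] by (auto simp: grid_values_def x_def)
  have R: "grid_values a h M (G 0) (j + 1) = G 0 (x + h)" "grid_values a h M (G 0) (j - 1) = G 0 (y - h)"
    "grid_values a h M (G 0) j = G 0 x"
    using y(3)[OF per(1)] grid_values_nbr_right(2)[OF per(1)] by (auto simp: grid_values_def x_def)
  have t2: "\<bar>G 0 z' - (\<Sum>l\<le>1. G l z * (z' - z) ^ l / fact l)\<bar> \<le> K * \<bar>z' - z\<bar> ^ (1 + 1)"
    if "z \<in> {a..b}" "z' \<in> {a..b}" for z z'
    by (rule taylor_lipschitz) (use d lip K that in auto)
  have e1: "\<bar>G 0 (x + h) - (G 0 x + G 1 x * h)\<bar> \<le> K * h^2"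
    using t2[OF x] h0 by (simp add: power2_eq_square)
  have e2: "\<bar>G 0 (y - h) - (G 0 x - G 1 x * h)\<bar> \<le> K * h^2"
    using t2[OF y(1,2)] h0 by (simp add: Py(1) Py(2)[simplified] power2_eq_square)
  have "\<bar>G 0 (x + h) - 2 * G 0 x + G 0 (y - h)\<bar> \<le> (2 * K) * h^2"
    using e1 e2 by linarith
  then show ?thesis unfolding delta_x2_def R using h0 by (simp add: field_simps abs_divide)
qed

end

section \<open>Consistency of the scheme\<close>

lemma compact_op_sup_bound:
  assumes "h > 0" "\<And>i. \<bar>f i\<bar> \<le> C"
  shows "\<bar>compact_op h f j\<bar> \<le> C"
proof -
  have "\<bar>f (j - 1) + 10 * f j + f (j + 1)\<bar> \<le> 12 * C"
    using assms(2)[of "j - 1"] assms(2)[of j] assms(2)[of "j + 1"] by linarith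
  then show ?thesis by (simp add: compact_op_stencil[OF assms(1)])
qed

text \<open>A bound for the first two space derivatives of \<open>u\<^sub>x\<^sub>x - u - \<eta> u\<^sup>p\<^sup>+\<^sup>1\<close> when those of \<open>u\<close> are bounded by \<open>K\<close>
  and \<open>0 \<le> \<eta> \<le> 1\<close>.\<close>

definition source_bound :: "nat \<Rightarrow> real \<Rightarrow> real" where
  "source_bound p K = 2 * K + (real p + 1)\<^sup>2 * K ^ (p + 1)"

context classical_solution
begin

abbreviation K2 :: real where "K2 \<equiv> source_bound p K"

text \<open>The space derivatives of \<open>u\<^sub>t\<^sub>t\<close>, computed from the right-hand side of the equation. Only the orders
  \<open>0\<close>, \<open>1\<close> and \<open>2\<close> are meant; the last branch stands for order \<open>2\<close>.\<close>

definition q :: "nat \<Rightarrow> real \<Rightarrow> real \<Rightarrow> real" where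
  "q l t x = g (l + 2) t x - g l t x - \<eta> *
    (if l = 0 then g 0 t x ^ (p + 1)
     else if l = 1 then real (p + 1) * g 0 t x ^ p * g 1 t x
     else real (p + 1) * (real p * g 0 t x ^ (p - 1) * g 1 t x * g 1 t x + g 0 t x ^ p * g 2 t x))"

lemma K2_nonneg: "K2 \<ge> 0"
  using K by (simp add: source_bound_def)

lemma v2_eq_q: "t \<in> {0..T} \<Longrightarrow> x \<in> {a..b} \<Longrightarrow> v 2 t x = q 0 t x"
  using pde g_0 by (simp add: q_def numeral_2_eq_2)

lemma q_periodic: "l \<le> 1 \<Longrightarrow> t \<in> {0..T} \<Longrightarrow> q l t a = q l t b"
  using g_periodic[of 0 t] g_periodic[of 1 t] g_periodic[of 2 t] g_periodic[of "l + 2" t] g_periodic[of l t]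
  by (simp add: q_def)

lemma q_deriv:
  assumes l: "l < 2" and t: "t \<in> {0..T}" and x: "x \<in> {a..b}"
  shows "(q l t has_real_derivative q (Suc l) t x) (at x within {a..b})"
proof -
  have d: "(g 0 t has_real_derivative g 1 t x) (at x within {a..b})"
    "(g 1 t has_real_derivative g 2 t x) (at x within {a..b})"
    "(g (l + 2) t has_real_derivative g (Suc l + 2) t x) (at x within {a..b})"
    "(g l t has_real_derivative g (Suc l) t x) (at x within {a..b})"
    using g_deriv[of 0 t x] g_deriv[of 1 t x] g_deriv[of "l + 2" t x] g_deriv[of l t x] l t x
    by (auto simp: numeral_2_eq_2)
  consider "l = 0" | "l = 1" using l by linarith
  then show ?thesis
  proof cases
    case 1
    have "((\<lambda>x. g (l + 2) t x - g l t x - \<eta> * g 0 t x ^ (p + 1)) has_real_derivative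
        g (Suc l + 2) t x - g (Suc l) t x - \<eta> * (real (p + 1) * g 0 t x ^ p * g 1 t x)) (at x within {a..b})"
      by (rule derivative_eq_intros d refl | simp)+
    then show ?thesis using 1 by (simp add: q_def[abs_def])
  next
    case 2
    have "((\<lambda>x. g (l + 2) t x - g l t x - \<eta> * (real (p + 1) * g 0 t x ^ p * g 1 t x)) has_real_derivative
        g (Suc l + 2) t x - g (Suc l) t x
          - \<eta> * (real (p + 1) * (real p * g 0 t x ^ (p - 1) * g 1 t x * g 1 t x + g 0 t x ^ p * g 2 t x))) (at x within {a..b})"
      by (rule derivative_eq_intros d refl | simp)+ (simp add: algebra_simps)
    then show ?thesis using 2 by (simp add: q_def[abs_def])
  qed
qed

lemma q_bound:
  assumes l: "l = 1 \<or> l = 2" and t: "t \<in> {0..T}" and x: "x \<in> {a..b}"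
  shows "\<bar>q l t x\<bar> \<le> K2"
proof -
  have G: "\<bar>g i t x\<bar> \<le> K" if "i \<le> 5" for i using g_bound[OF that t x] .
  have pw: "\<bar>g 0 t x ^ k\<bar> \<le> K ^ k" for k
    using power_mono[OF G[of 0], of k] by (simp add: power_abs)
  define N where "N = (if l = 1 then real (p + 1) * g 0 t x ^ p * g 1 t x
     else real (p + 1) * (real p * g 0 t x ^ (p - 1) * g 1 t x * g 1 t x + g 0 t x ^ p * g 2 t x))"
  have a1: "\<bar>g 0 t x ^ p * g i t x\<bar> \<le> K ^ (p + 1)" if "i \<le> 5" for i
    using mult_mono[OF pw[of p] G[OF that]] K by (simp add: abs_mult mult.commute)
  have a2: "\<bar>real p * (g 0 t x ^ (p - 1) * g 1 t x * g 1 t x)\<bar> \<le> real p * K ^ (p + 1)"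
  proof -
    have "\<bar>g 0 t x ^ (p - 1) * g 1 t x * g 1 t x\<bar> \<le> K ^ (p - 1) * K * K"
      unfolding abs_mult using pw[of "p - 1"] G[of 1] K by (intro mult_mono) auto
    also have "K ^ (p - 1) * K * K = K ^ (p + 1)" using p by (cases p) (auto simp: mult_ac)
    finally show ?thesis by (simp add: abs_mult mult_left_mono)
  qed
  have N: "\<bar>N\<bar> \<le> (real p + 1)\<^sup>2 * K ^ (p + 1)"
  proof (cases "l = 1")
    case True
    have "\<bar>N\<bar> = (real p + 1) * \<bar>g 0 t x ^ p * g 1 t x\<bar>" using True by (simp add: N_def abs_mult)
    also have "\<dots> \<le> (real p + 1) * K ^ (p + 1)" using a1[of 1] by (intro mult_left_mono) auto
    also have "\<dots> \<le> (real p + 1)\<^sup>2 * K ^ (p + 1)" using K by (intro mult_right_mono) (auto simp: power2_eq_square)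
    finally show ?thesis .
  next
    case False
    have "\<bar>N\<bar> = (real p + 1) * \<bar>real p * (g 0 t x ^ (p - 1) * g 1 t x * g 1 t x) + g 0 t x ^ p * g 2 t x\<bar>"
      using False by (simp add: N_def abs_mult mult_ac)
    also have "\<dots> \<le> (real p + 1) * (real p * K ^ (p + 1) + K ^ (p + 1))"
      using a1[of 2] a2 by (intro mult_left_mono) auto
    also have "\<dots> = (real p + 1)\<^sup>2 * K ^ (p + 1)" by (simp add: power2_eq_square algebra_simps)
    finally show ?thesis .
  qed
  have "\<bar>\<eta> * N\<bar> \<le> 1 * \<bar>N\<bar>" unfolding abs_mult using \<eta> by (intro mult_right_mono) auto
  moreover have "q l t x = g (l + 2) t x - g l t x - \<eta> * N" using l by (auto simp: q_def N_def)
  ultimately show ?thesis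
    using G[of "l + 2"] G[of l] l N unfolding source_bound_def by auto
qed

lemma q_lipschitz:
  assumes "l < 2" "t \<in> {0..T}" "x \<in> {a..b}" "y \<in> {a..b}"
  shows "\<bar>q l t y - q l t x\<bar> \<le> K2 * \<bar>y - x\<bar>"
proof (rule lipschitz_of_bounded_derivative[where f="q l t" and f'="q (Suc l) t" and c=a and d=b])
  have l: "Suc l = 1 \<or> Suc l = 2" using assms(1) by linarith
  show "\<bar>q (Suc l) t z\<bar> \<le> K2" if "z \<in> {a..b}" for z by (rule q_bound[OF l assms(2) that])
qed (use assms q_deriv in auto)

lemma u_periodic: "t \<in> {0..T} \<Longrightarrow> u t a = u t b"
  using g_periodic[of 0 t] g_0[of t a] g_0[of t b] ab by simp

text \<open>The first time level is a Taylor polynomial in time. Its remainder is of third order, which is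
  needed since the energy divides it by \<open>\<tau>\<close>. For its differences in space second order suffices,
  so that one space derivative of \<open>u\<^sub>t\<^sub>t\<close> is enough.\<close>

lemma start_error:
  assumes \<tau>: "0 \<le> \<tau>" "\<tau> \<le> T" and x: "x \<in> {a..b}" and y: "y \<in> {a..b}"
  defines "e \<equiv> \<lambda>x. u \<tau> x - (u 0 x + \<tau> * v 1 0 x + \<tau>\<^sup>2 / 2 * v 2 0 x)"
  shows "\<bar>e x\<bar> \<le> K * \<tau> ^ 3" and "\<bar>e y - e x\<bar> \<le> 2 * K2 * \<tau>\<^sup>2 * \<bar>y - x\<bar>"
proof -
  have t: "0 \<in> {0..T}" "\<tau> \<in> {0..T}" using \<tau> by auto
  have "\<bar>v 0 \<tau> x - (\<Sum>l\<le>2. v l 0 x * (\<tau> - 0) ^ l / fact l)\<bar> \<le> K * \<bar>\<tau> - 0\<bar> ^ (2 + 1)"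
    by (rule taylor_bounded[where G="\<lambda>l s. v l s x" and m=2 and c=0 and d=T])
      (use v_deriv v_bound[of "Suc 2"] x t K in auto)
  moreover have "{..2::nat} = {0, 1, 2}" by auto
  ultimately show "\<bar>e x\<bar> \<le> K * \<tau> ^ 3"
    using \<tau> by (simp add: e_def v_0 mult_ac add.assoc numeral_2_eq_2[symmetric])
  define L where "L = K2 * \<bar>y - x\<bar>"
  have L0: "L \<ge> 0" using K2_nonneg by (simp add: L_def)
  have D2: "\<bar>v 2 s y - v 2 s x\<bar> \<le> L" if "s \<in> {0..T}" for s
    unfolding v2_eq_q[OF that x] v2_eq_q[OF that y] L_def by (rule q_lipschitz) (use that x y in auto)
  have "\<bar>(v 0 \<tau> y - v 0 \<tau> x) - (\<Sum>l\<le>1. (v l 0 y - v l 0 x) * (\<tau> - 0) ^ l / fact l)\<bar> \<le> L * \<bar>\<tau> - 0\<bar> ^ (1 + 1)"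
    by (rule taylor_bounded[where G="\<lambda>l s. v l s y - v l s x" and m=1 and c=0 and d=T])
      (use v_deriv D2 x y t L0 in \<open>auto intro!: derivative_intros simp: numeral_2_eq_2\<close>)
  then have main: "\<bar>(u \<tau> y - u \<tau> x) - ((u 0 y - u 0 x) + (v 1 0 y - v 1 0 x) * \<tau>)\<bar> \<le> L * \<tau>\<^sup>2"
    using \<tau> by (simp add: v_0 power2_eq_square)
  have rest: "\<bar>\<tau>\<^sup>2 / 2 * (v 2 0 y - v 2 0 x)\<bar> \<le> \<tau>\<^sup>2 * L"
  proof -
    have "\<bar>\<tau>\<^sup>2 / 2 * (v 2 0 y - v 2 0 x)\<bar> = \<tau>\<^sup>2 / 2 * \<bar>v 2 0 y - v 2 0 x\<bar>" by (simp add: abs_mult)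
    also have "\<dots> \<le> \<tau>\<^sup>2 * L" using D2[OF t(1)] by (intro mult_mono) auto
    finally show ?thesis .
  qed
  have "e y - e x = ((u \<tau> y - u \<tau> x) - ((u 0 y - u 0 x) + (v 1 0 y - v 1 0 x) * \<tau>))
      - \<tau>\<^sup>2 / 2 * (v 2 0 y - v 2 0 x)" by (simp add: e_def algebra_simps)
  then have "\<bar>e y - e x\<bar> \<le> L * \<tau>\<^sup>2 + \<tau>\<^sup>2 * L" using main rest by linarith
  then show "\<bar>e y - e x\<bar> \<le> 2 * K2 * \<tau>\<^sup>2 * \<bar>y - x\<bar>" by (simp add: L_def algebra_simps)
qed

lemma time_second_difference:
  assumes x: "x \<in> {a..b}" and t: "0 \<le> t - \<tau>" "t + \<tau> \<le> T" and \<tau>: "\<tau> > 0"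
  shows "\<bar>(u (t + \<tau>) x - 2 * u t x + u (t - \<tau>) x) / \<tau>\<^sup>2 - v 2 t x\<bar> \<le> 2 * K * \<tau>\<^sup>2"
proof -
  have m: "\<bar>v 0 s x - (\<Sum>l\<le>3. v l t x * (s - t) ^ l / fact l)\<bar> \<le> K * \<bar>s - t\<bar> ^ (3 + 1)" if "s \<in> {0..T}" for s
    by (rule taylor_bounded[where G="\<lambda>l s. v l s x" and m=3 and c=0 and d=T])
      (use v_deriv v_bound[of "Suc 3"] x t \<tau> K that in auto)
  have s3: "{..3::nat} = {0,1,2,3}" by auto
  have "\<bar>u (t + \<tau>) x - (u t x + v 1 t x * \<tau> + v 2 t x * \<tau>^2 / 2 + v 3 t x * \<tau>^3 / 6)\<bar> \<le> K * \<tau> ^ 4"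
    using m[of "t + \<tau>"] t \<tau> unfolding s3 by (simp add: fact_numeral v_0 add.assoc)
  moreover have "\<bar>u (t - \<tau>) x - (u t x - v 1 t x * \<tau> + v 2 t x * \<tau>^2 / 2 - v 3 t x * \<tau>^3 / 6)\<bar> \<le> K * \<tau> ^ 4"
    using m[of "t - \<tau>"] t \<tau> unfolding s3 by (simp add: fact_numeral v_0 add.assoc)
  ultimately have "\<bar>u (t + \<tau>) x - 2 * u t x + u (t - \<tau>) x - v 2 t x * \<tau>^2\<bar> \<le> 2 * (K * \<tau> ^ 4)"
    unfolding abs_le_iff by argo
  then have *: "\<bar>u (t + \<tau>) x - 2 * u t x + u (t - \<tau>) x - v 2 t x * \<tau>^2\<bar> \<le> (2 * K * \<tau>\<^sup>2) * \<tau>\<^sup>2"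
    by (simp add: eval_nat_numeral mult_ac)
  have "(u (t + \<tau>) x - 2 * u t x + u (t - \<tau>) x) / \<tau>\<^sup>2 - v 2 t x
      = (u (t + \<tau>) x - 2 * u t x + u (t - \<tau>) x - v 2 t x * \<tau>^2) / \<tau>\<^sup>2"
    using \<tau> by (simp add: diff_divide_distrib)
  then show ?thesis using * \<tau> by (simp add: abs_divide pos_divide_le_eq)
qed

text \<open>Replacing the power term by the equation at level \<open>n\<close> leaves four contributions to \<open>A \<xi>\<close>: the error
  \<open>E1\<close> of the second difference in time, the error \<open>E2\<close> of the time average, the second space
  difference of \<open>E2\<close>, and the compact approximation error of \<open>u\<^sub>x\<^sub>x\<close>. The third one is the error of
  a time average for the function \<open>\<delta>\<^sub>x\<^sup>2 u\<close> of \<open>t\<close>, whose second time derivative \<open>\<delta>\<^sub>x\<^sup>2 u\<^sub>t\<^sub>t\<close> is bounded.\<close>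

lemma consistency:
  assumes M: "M \<ge> 1" and h: "h = (b - a) / real M" and \<tau>: "\<tau> > 0"
    and n: "n \<ge> 1" "real (n + 1) * \<tau> \<le> T"
  defines "V \<equiv> \<lambda>n. grid_values a h M (u (real n * \<tau>))"
  defines "\<xi> \<equiv> \<lambda>j. scheme_op h \<tau> M V n j + \<eta> * V n j ^ (p + 1)"
  shows "\<xi> \<in> XM M" and "\<bar>compact_op h \<xi> j\<bar> \<le> (3 * K + 2 * K2) * (\<tau>\<^sup>2 + h ^ 4)"
proof -
  have h0: "h > 0" by (rule mesh_pos[OF ab M h])
  define t where "t = real n * \<tau>"
  have tm: "real (n - 1) * \<tau> = t - \<tau>" and tp: "real (n + 1) * \<tau> = t + \<tau>"
    using n(1) by (auto simp: t_def algebra_simps of_nat_diff)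
  have "\<tau> \<le> t" using n(1) \<tau> by (simp add: t_def)
  then have t0: "0 \<le> t - \<tau>" and tT: "t + \<tau> \<le> T" using n(2) by (simp_all add: tp[symmetric])
  have t: "t \<in> {0..T}" using t0 tT \<tau> by auto
  have VX: "V k \<in> XM M" for k unfolding V_def by (rule grid_values_XM)
  have avgX: "time_avg V n \<in> XM M"
    unfolding time_avg_def[abs_def] divide_inverse by (intro XM_mult XM_add XM_const VX)
  define W where "W = grid_values a h M (v 2 t)"
  define G where "G = grid_values a h M (g 2 t)"
  define E1 where "E1 j = delta_t2 \<tau> V n j - W j" for j
  define E2 where "E2 j = time_avg V n j - V n j" for j
  have in_ab: "grid a h (j mod int M) \<in> {a..b}" for j by (rule grid_mod_in[OF ab M h])
  have Vv: "V (n + 1) j = u (t + \<tau>) (grid a h (j mod int M))" "V (n - 1) j = u (t - \<tau>) (grid a h (j mod int M))"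
    "V n j = u t (grid a h (j mod int M))" for j
    by (simp_all only: V_def grid_values_def tm tp t_def[symmetric])
  have WG: "W j = G j - V n j - \<eta> * V n j ^ (p + 1)" for j
    unfolding Vv W_def G_def grid_values_def by (rule pde[OF t in_ab])
  have E1: "\<bar>E1 j\<bar> \<le> 2 * K * \<tau>\<^sup>2" for j
    unfolding E1_def delta_t2_def Vv W_def grid_values_def
    by (rule time_second_difference[OF in_ab t0 tT \<tau>])
  have E2: "\<bar>E2 j\<bar> \<le> K * \<tau>\<^sup>2" for j
  proof -
    let ?x = "grid a h (j mod int M)"
    have "\<bar>(v 0 (t + \<tau>) ?x + v 0 (t - \<tau>) ?x) / 2 - v 0 t ?x\<bar> \<le> K * \<tau>\<^sup>2"
      by (rule time_average_taylor[where T=T and G="\<lambda>l s. v l s ?x"])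
        (use v_deriv v_bound[of 2] in_ab t0 tT \<tau> K in auto)
    then show ?thesis unfolding E2_def time_avg_def Vv by (simp add: v_0)
  qed
  have DE2: "\<bar>delta_x2 h E2 j\<bar> \<le> 2 * K2 * \<tau>\<^sup>2" for j
  proof -
    define D where "D l s = delta_x2 h (grid_values a h M (v l s)) j" for l s
    have "(D l has_real_derivative D (Suc l) s) (at s within {0..T})" if "l \<le> 1" "s \<in> {0..T}" for l s
    proof -
      have gv: "((\<lambda>s. grid_values a h M (v l s) i) has_real_derivative grid_values a h M (v (Suc l) s) i) (at s within {0..T})" for i
        unfolding grid_values_def by (rule v_deriv) (use that in_ab in auto)
      show ?thesis
        unfolding D_def delta_x2_def divide_inverse
        by (rule DERIV_cmult_right[OF DERIV_add[OF DERIV_diff[OF gv DERIV_cmult[OF gv]] gv]])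
    qed
    moreover have "\<bar>D 2 s\<bar> \<le> 2 * K2" if s: "s \<in> {0..T}" for s
    proof -
      have "grid_values a h M (v 2 s) = grid_values a h M (q 0 s)"
        by (rule grid_values_cong[OF ab M h]) (rule v2_eq_q[OF s])
      moreover have "\<bar>delta_x2 h (grid_values a h M (q 0 s)) j\<bar> \<le> 2 * K2"
        by (rule second_difference_bound[OF ab M h, where G="\<lambda>l. q l s"])
          (use q_deriv[of 0 s] q_lipschitz[of 1 s] q_periodic[of _ s] s K2_nonneg in auto)
      ultimately show ?thesis by (simp add: D_def)
    qed
    ultimately have "\<bar>(D 0 (t + \<tau>) + D 0 (t - \<tau>)) / 2 - D 0 t\<bar> \<le> 2 * K2 * \<tau>\<^sup>2"
      by (intro time_average_taylor[where T=T]) (use t0 tT \<tau> K2_nonneg in auto)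
    moreover have "delta_x2 h E2 j = (D 0 (t + \<tau>) + D 0 (t - \<tau>)) / 2 - D 0 t"
      unfolding D_def delta_x2_def E2_def time_avg_def Vv grid_values_def v_0 divide_inverse
      by (simp add: algebra_simps)
    ultimately show ?thesis by simp
  qed
  have space: "\<bar>compact_op h G j - delta_x2 h (V n) j\<bar> \<le> 3 * K * h ^ 4" for j
  proof -
    have "grid_values a h M (g 0 t) = V n"
      unfolding V_def t_def[symmetric] by (rule grid_values_cong[OF ab M h]) (rule g_0[OF t])
    then show ?thesis
      using compact_consistency[OF ab M h, where G="\<lambda>l. g l t" and K=K and j=j]
        g_deriv[OF _ t] g_lipschitz[OF t] g_periodic[OF _ t] K
      by (simp add: G_def)
  qed
  have \<xi>: "\<xi> = (\<lambda>j. (E1 j + E2 j) + (G j - compact_op_inv h M (delta_x2 h (time_avg V n)) j))"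
    by (rule ext) (simp add: \<xi>_def scheme_op_def E1_def E2_def WG)
  have E1X: "E1 \<in> XM M"
    unfolding E1_def[abs_def] delta_t2_def divide_inverse W_def
    by (intro XM_mult XM_add XM_diff XM_const VX grid_values_XM)
  have E2X: "E2 \<in> XM M" unfolding E2_def[abs_def] by (intro XM_diff VX avgX)
  have GX: "G \<in> XM M" unfolding G_def by (rule grid_values_XM)
  have dX: "delta_x2 h (time_avg V n) \<in> XM M" by (rule XM_delta_x2[OF avgX])
  show "\<xi> \<in> XM M"
    unfolding \<xi> by (intro XM_add XM_diff E1X E2X GX compact_op_inv_in_XM(1)[OF dX M h0])
  have add: "compact_op h (\<lambda>j. f j + k j) j = compact_op h f j + compact_op h k j"
    "compact_op h (\<lambda>j. f j - k j) j = compact_op h f j - compact_op h k j" for f k j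
    unfolding compact_op_stencil[OF h0] by (simp_all add: field_simps)
  have avg: "delta_x2 h (time_avg V n) j = delta_x2 h E2 j + delta_x2 h (V n) j"
    unfolding delta_x2_def E2_def divide_inverse by (simp add: algebra_simps)
  have "compact_op h \<xi> j = compact_op h (\<lambda>j. E1 j + E2 j) j
      + (compact_op h G j - delta_x2 h (V n) j) - delta_x2 h E2 j"
    unfolding \<xi> add compact_op_compact_op_inv[OF dX M h0] avg by simp
  moreover have "\<bar>compact_op h (\<lambda>j. E1 j + E2 j) j\<bar> \<le> 3 * K * \<tau>\<^sup>2"
  proof (rule compact_op_sup_bound[OF h0])
    show "\<bar>E1 i + E2 i\<bar> \<le> 3 * K * \<tau>\<^sup>2" for i
      using abs_triangle_ineq[of "E1 i" "E2 i"] E1[of i] E2[of i] by linarith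
  qed
  ultimately have "\<bar>compact_op h \<xi> j\<bar> \<le> 3 * K * \<tau>\<^sup>2 + 3 * K * h ^ 4 + 2 * K2 * \<tau>\<^sup>2"
    using space[of j] DE2[of j] by linarith
  also have "\<dots> \<le> (3 * K + 2 * K2) * (\<tau>\<^sup>2 + h ^ 4)"
    using K2_nonneg h0 by (simp add: algebra_simps)
  finally show "\<bar>compact_op h \<xi> j\<bar> \<le> (3 * K + 2 * K2) * (\<tau>\<^sup>2 + h ^ 4)" .
qed

end

section \<open>Convergence of the scheme for one classical solution\<close>

lemma power_lipschitz:
  fixes x y :: real
  assumes "\<bar>x\<bar> \<le> R" "\<bar>y\<bar> \<le> R"
  shows "\<bar>x ^ (p + 1) - y ^ (p + 1)\<bar> \<le> (real p + 1) * R ^ p * \<bar>x - y\<bar>"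
proof -
  have R: "R \<ge> 0" using assms by linarith
  have "norm (y ^ (p + 1) - x ^ (p + 1)) \<le> (real p + 1) * R ^ p * norm (y - x)"
  proof (rule field_differentiable_bound[of "{-R..R}"])
    fix z assume "z \<in> {-R..R}"
    show "((\<lambda>z. z ^ (p + 1)) has_real_derivative (real p + 1) * z ^ p) (at z within {-R..R})"
      using DERIV_pow[of "p + 1" z "{-R..R}"] by (simp add: add.commute)
    have "\<bar>z\<bar> ^ p \<le> R ^ p" using \<open>z \<in> {-R..R}\<close> by (intro power_mono) auto
    then show "norm ((real p + 1) * z ^ p) \<le> (real p + 1) * R ^ p"
      by (simp add: abs_mult power_abs mult_left_mono)
  qed (use assms in auto)
  then show ?thesis by (simp add: abs_minus_commute)
qed

text \<open>The factor \<open>sqrt (b - a)\<close> turns maxima into grid norms, \<open>2 * K + 2 * source_bound p K\<close> bounds the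
  square root of the initial energy in units of \<open>\<tau>\<^sup>2\<close>, the term with \<open>T0\<close> the accumulated consistency error, and the exponential is the
  amplification by the power term, whose Lipschitz constant on \<open>[-R, R]\<close> is \<open>(p + 1) R\<^sup>p\<close>.\<close>

definition growth_constant :: "real \<Rightarrow> real \<Rightarrow> nat \<Rightarrow> real \<Rightarrow> real \<Rightarrow> real \<Rightarrow> real" where
  "growth_constant a b p K T0 R = exp (sqrt 2 * ((real p + 1) * R ^ p) * T0) * sqrt (b - a)
    * (2 * K + 2 * source_bound p K + T0 * (3 / 2 * (3 * K + 2 * source_bound p K)))"

context classical_solution
begin

text \<open>The error at level \<open>0\<close> vanishes, the energy of the first step comes from \<open>start_error\<close>, and the
  residual of the error is the consistency error plus a Lipschitz term as long as \<open>\<bar>e\<bar> \<le> 1\<close>: then the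
  exact and the numerical values both lie in \<open>[-R, R]\<close>.\<close>

lemma compact_scheme_convergence:
  assumes M: "M \<ge> 1" and h: "h = (b - a) / real M" and \<tau>: "0 < \<tau>" "\<tau> \<le> 1" "\<tau> \<le> T"
    and \<eta>0: "\<eta> > 0" and T: "T = T0 / \<eta>" and T0: "T0 > 0"
    and R: "\<And>t x. t \<in> {0..T} \<Longrightarrow> x \<in> {a..b} \<Longrightarrow> \<bar>u t x\<bar> + 1 \<le> R"
    and U: "\<And>n. U n \<in> XM M"
    and scheme: "\<And>n j. n \<ge> 1 \<Longrightarrow> j \<in> {0..<int M} \<Longrightarrow> scheme_op h \<tau> M U n j + \<eta> * U n j ^ (p + 1) = 0"
    and U0: "\<And>j. j \<in> {0..<int M} \<Longrightarrow> U 0 j = u 0 (grid a h j)"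
    and U1: "\<And>j. j \<in> {0..<int M} \<Longrightarrow> U 1 j = u 0 (grid a h j) + \<tau> * v 1 0 (grid a h j)
      + \<tau>\<^sup>2 / 2 * v 2 0 (grid a h j)"
    and small: "(1 / sqrt (b - a) + sqrt (b - a)) * (sqrt 2 * (growth_constant a b p K T0 R * ((\<tau>\<^sup>2 + h ^ 4) / \<eta>))) \<le> 1"
    and n: "real n * \<tau> \<le> T"
  defines "V \<equiv> \<lambda>n. grid_values a h M (u (real n * \<tau>))"
  defines "e \<equiv> \<lambda>n j. V n j - U n j"
  shows "l2_norm h M (e n) \<le> sqrt 2 * (growth_constant a b p K T0 R * ((\<tau>\<^sup>2 + h ^ 4) / \<eta>))"
    and "l2_norm h M (delta_x_plus h (e n)) \<le> sqrt 2 * (growth_constant a b p K T0 R * ((\<tau>\<^sup>2 + h ^ 4) / \<eta>))"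
    and "\<And>j. j \<in> {0..<int M} \<Longrightarrow> \<bar>e n j\<bar> \<le> 1"
proof -
  define len where "len = b - a"
  have len: "len > 0" using ab by (simp add: len_def)
  have h0: "h > 0" and hM: "h * real M = len" using mesh_pos[OF ab M h] mesh_total[OF ab M h] by (simp_all add: len_def)
  define \<delta> where "\<delta> = \<tau>\<^sup>2 + h ^ 4"
  have \<delta>: "\<delta> \<ge> 0" "\<tau>\<^sup>2 \<le> \<delta>" using h0 by (simp_all add: \<delta>_def)
  define L where "L = (real p + 1) * R ^ p"
  define c where "c = \<eta> * L"
  define B where "B = 3 / 2 * (sqrt len * ((3 * K + 2 * K2) * \<delta>))"
  define a0 where "a0 = sqrt len * (2 * K + 2 * K2) * \<tau>\<^sup>2"
  define G where "G = exp (sqrt 2 * c * T) * (a0 + T * B)"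
  have t0: "0 \<in> {0..T}" using \<tau> by simp
  have R1: "R \<ge> 1" using R[OF t0, of a] ab by fastforce
  have L0: "L \<ge> 0" using R1 by (simp add: L_def)
  have c0: "c \<ge> 0" using \<eta> L0 by (simp add: c_def)
  have B0: "B \<ge> 0" using K K2_nonneg \<delta> len by (simp add: B_def)
  have VX: "V k \<in> XM M" for k unfolding V_def by (rule grid_values_XM)
  have eX: "e k \<in> XM M" for k unfolding e_def by (intro XM_diff VX U)
  have in_ab: "grid a h (j mod int M) \<in> {a..b}" for j by (rule grid_mod_in[OF ab M h])
  have V_small: "\<bar>V k j\<bar> + 1 \<le> R" if "real k * \<tau> \<le> T" for k j
    unfolding V_def grid_values_def using that \<tau> by (intro R in_ab) auto

  have residual: "l2_norm h M (scheme_op h \<tau> M e k) \<le> c * l2_norm h M (e k) + B"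
    if k: "1 \<le> k" "real (k + 1) * \<tau> \<le> T" and e1: "\<And>j. j \<in> {0..<int M} \<Longrightarrow> \<bar>e k j\<bar> \<le> 1" for k
  proof -
    define \<xi> where "\<xi> = (\<lambda>j. scheme_op h \<tau> M V k j + \<eta> * V k j ^ (p + 1))"
    have \<xi>X: "\<xi> \<in> XM M"
      unfolding \<xi>_def V_def by (rule consistency(1)[OF M h \<tau>(1) k])
    have A\<xi>: "\<bar>compact_op h \<xi> j\<bar> \<le> (3 * K + 2 * K2) * \<delta>" for j
      unfolding \<xi>_def V_def \<delta>_def by (rule consistency(2)[OF M h \<tau>(1) k])
    have \<xi>: "l2_norm h M \<xi> \<le> B"
    proof -
      have "l2_norm h M \<xi> \<le> 3 / 2 * l2_norm h M (compact_op h \<xi>)"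
        by (rule l2_norm_le_compact_op[OF \<xi>X M h0])
      also have "l2_norm h M (compact_op h \<xi>) \<le> sqrt (h * real M) * ((3 * K + 2 * K2) * \<delta>)"
        using A\<xi> K K2_nonneg \<delta> h0 by (intro l2_norm_const_bound) auto
      finally show ?thesis by (simp add: B_def hM)
    qed
    have kT: "real k * \<tau> \<le> T" using k(2) \<tau> by (simp add: algebra_simps)
    have "l2_norm h M (scheme_op h \<tau> M e k) = l2_norm h M (\<lambda>j. \<xi> j + \<eta> * (U k j ^ (p + 1) - V k j ^ (p + 1)))"
    proof (rule l2_norm_cong)
      fix j assume "j \<in> {0..<int M}"
      from scheme[OF k(1) this]
      show "scheme_op h \<tau> M e k j = \<xi> j + \<eta> * (U k j ^ (p + 1) - V k j ^ (p + 1))"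
        unfolding e_def scheme_op_diff[where U=U and V=V, OF U VX M h0] \<xi>_def by (simp add: right_diff_distrib)
    qed
    also have "\<dots> \<le> l2_norm h M \<xi> + l2_norm h M (\<lambda>j. \<eta> * (U k j ^ (p + 1) - V k j ^ (p + 1)))"
      using h0 by (intro l2_norm_triangle) simp
    also have "l2_norm h M (\<lambda>j. \<eta> * (U k j ^ (p + 1) - V k j ^ (p + 1))) \<le> l2_norm h M (\<lambda>j. c * e k j)"
    proof (rule l2_norm_mono)
      fix j assume j: "j \<in> {0..<int M}"
      have "\<bar>V k j\<bar> \<le> R" "\<bar>U k j\<bar> \<le> R" using V_small[OF kT, of j] e1[OF j] by (auto simp: e_def)
      from power_lipschitz[OF this(2,1), of p]
      have "\<eta> * \<bar>U k j ^ (p + 1) - V k j ^ (p + 1)\<bar> \<le> \<eta> * (L * \<bar>U k j - V k j\<bar>)"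
        unfolding L_def using \<eta> by (intro mult_left_mono) auto
      then show "\<bar>\<eta> * (U k j ^ (p + 1) - V k j ^ (p + 1))\<bar> \<le> \<bar>c * e k j\<bar>"
        using \<eta> L0 by (simp add: abs_mult c_def e_def abs_minus_commute mult_ac)
    qed (use h0 in simp)
    also have "l2_norm h M (\<lambda>j. c * e k j) = c * l2_norm h M (e k)"
      using h0 c0 by (intro l2_norm_cmult) auto
    finally show ?thesis using \<xi> by linarith
  qed

  have e0: "e 0 = (\<lambda>_. 0)"
    by (rule XM_eqI[OF eX XM_const M]) (simp add: e_def V_def grid_values_def U0)
  have init: "sqrt (energy h \<tau> M e 0) \<le> a0"
  proof -
    define \<epsilon>1 where "\<epsilon>1 x = u \<tau> x - (u 0 x + \<tau> * v 1 0 x + \<tau>\<^sup>2 / 2 * v 2 0 x)" for x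
    have S: "\<bar>\<epsilon>1 x\<bar> \<le> K * \<tau> ^ 3" "\<bar>\<epsilon>1 y - \<epsilon>1 x\<bar> \<le> 2 * K2 * \<tau>\<^sup>2 * \<bar>y - x\<bar>"
      if "x \<in> {a..b}" "y \<in> {a..b}" for x y
      using start_error[OF _ \<tau>(3) that] \<tau> unfolding \<epsilon>1_def by auto
    have e1: "e 1 = grid_values a h M \<epsilon>1"
    proof (rule XM_eqI[OF eX grid_values_XM M])
      fix j assume "j \<in> {0..<int M}"
      with U1[OF this] show "e 1 j = grid_values a h M \<epsilon>1 j"
        by (simp add: e_def V_def grid_values_def \<epsilon>1_def)
    qed
    have per: "\<epsilon>1 a = \<epsilon>1 b"
    proof -
      have "v 2 0 a = v 2 0 b"
        using v2_eq_q[OF t0, of a] v2_eq_q[OF t0, of b] q_periodic[OF _ t0, of 0] ab by simp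
      moreover have "v 1 0 a = v 1 0 b"
      proof -
        have T': "0 < T" using \<tau> by linarith
        have d: "((\<lambda>s. u s x) has_real_derivative v 1 0 x) (at 0 within {0..T})" if "x \<in> {a..b}" for x
          using v_deriv[of 0 0 x] t0 that by (simp add: v_0)
        have "deriv_on {0..T} (\<lambda>s. u s a) 0 = v 1 0 a" "deriv_on {0..T} (\<lambda>s. u s a) 0 = v 1 0 b"
          by (rule deriv_on_Icc_eq[OF T' _ d t0]; use u_periodic ab in auto)+
        then show ?thesis by simp
      qed
      ultimately show ?thesis using u_periodic[OF t0] u_periodic[of \<tau>] \<tau> by (simp add: \<epsilon>1_def)
    qed
    have b1: "\<bar>e 1 j\<bar> \<le> K * \<tau> ^ 3" for j
      unfolding e1 grid_values_def by (rule S(1)[OF in_ab in_ab])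
    have n1: "l2_norm h M (e 1) \<le> sqrt len * (K * \<tau>\<^sup>2)"
    proof -
      have "\<tau> ^ 3 \<le> \<tau>\<^sup>2" using \<tau> by (intro power_decreasing) auto
      then have "\<bar>e 1 j\<bar> \<le> K * \<tau>\<^sup>2" for j using b1[of j] K by (meson mult_left_mono order_trans)
      then show ?thesis using h0 K unfolding hM[symmetric] by (intro l2_norm_const_bound) auto
    qed
    have n2: "l2_norm h M (\<lambda>j. (e (0 + 1) j - e 0 j) / \<tau>) \<le> sqrt len * (K * \<tau>\<^sup>2)"
      unfolding hM[symmetric]
    proof (rule l2_norm_const_bound)
      fix j
      have "\<bar>e 1 j\<bar> / \<tau> \<le> K * \<tau> ^ 3 / \<tau>" using b1[of j] \<tau> by (intro divide_right_mono) auto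
      also have "K * \<tau> ^ 3 / \<tau> = K * \<tau>\<^sup>2" using \<tau> by (simp add: power2_eq_square power3_eq_cube)
      finally show "\<bar>(e (0 + 1) j - e 0 j) / \<tau>\<bar> \<le> K * \<tau>\<^sup>2" using \<tau> by (simp add: e0 abs_divide)
    qed (use h0 K in auto)
    have n3: "l2_norm h M (delta_x_plus h (e 1)) \<le> sqrt len * (2 * K2 * \<tau>\<^sup>2)"
      unfolding hM[symmetric]
    proof (rule l2_norm_const_bound)
      fix j assume "j \<in> {0..<int M}"
      define x where "x = grid a h (j mod int M)"
      have "e 1 (j + 1) = \<epsilon>1 (x + h)" "e 1 j = \<epsilon>1 x" "x \<in> {a..b}" "x + h \<in> {a..b}"
        unfolding e1 x_def using grid_values_nbr_right[OF ab M h, where j=j] per in_ab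
        by (auto simp: grid_values_def)
      then have "\<bar>e 1 (j + 1) - e 1 j\<bar> \<le> 2 * K2 * \<tau>\<^sup>2 * h" using S(2)[of x "x + h"] h0 by simp
      then show "\<bar>delta_x_plus h (e 1) j\<bar> \<le> 2 * K2 * \<tau>\<^sup>2"
        using h0 by (simp add: delta_x_plus_def abs_divide pos_divide_le_eq)
    qed (use h0 K2_nonneg in auto)
    have st0: "stiffness h M (e 0) \<le> 0"
      using stiffness_bounds(2)[OF eX M h0, of 0] by (simp add: e0 delta_x_plus_def l2_norm_def)
    have st1: "stiffness h M (e 1) \<le> 3 / 2 * (sqrt len * (2 * K2 * \<tau>\<^sup>2))\<^sup>2"
      using stiffness_bounds(2)[OF eX M h0, of 1] power_mono[OF n3, of 2] h0 by (simp add: l2_norm_nonneg)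
    have "energy h \<tau> M e 0 \<le> (sqrt len * (K * \<tau>\<^sup>2))\<^sup>2 + (sqrt len * (K * \<tau>\<^sup>2))\<^sup>2 / 2
        + 3 / 2 * (sqrt len * (2 * K2 * \<tau>\<^sup>2))\<^sup>2 / 2"
    proof -
      have "(l2_norm h M (\<lambda>j. (e (0 + 1) j - e 0 j) / \<tau>))\<^sup>2 \<le> (sqrt len * (K * \<tau>\<^sup>2))\<^sup>2"
        "(l2_norm h M (e 1))\<^sup>2 \<le> (sqrt len * (K * \<tau>\<^sup>2))\<^sup>2"
        using n1 n2 h0 by (auto intro!: power_mono simp: l2_norm_nonneg)
      note bounds = this st1 st0
      have E: "energy h \<tau> M e 0 = (l2_norm h M (\<lambda>j. (e (0 + 1) j - e 0 j) / \<tau>))\<^sup>2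
          + (l2_norm h M (e 1))\<^sup>2 / 2 + (stiffness h M (e 1) + stiffness h M (e 0)) / 2"
        by (simp add: energy_def e0 l2_norm_def[of h M "\<lambda>_. 0"])
      have "A1 + A2 / 2 + (A3 + A4) / 2 \<le> X + X / 2 + 3 / 2 * Y / 2"
        if "A1 \<le> X" "A2 \<le> X" "A3 \<le> 3 / 2 * Y" "A4 \<le> 0" for A1 A2 A3 A4 X Y :: real
        using that by argo
      from this[OF bounds] show ?thesis unfolding E .
    qed
    also have "\<dots> = len * (\<tau>\<^sup>2)\<^sup>2 * (3 / 2 * K\<^sup>2 + 3 * K2\<^sup>2)"
      using len by (simp add: power_mult_distrib algebra_simps)
    also have "\<dots> \<le> len * (\<tau>\<^sup>2)\<^sup>2 * (2 * K + 2 * K2)\<^sup>2"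
    proof (rule mult_left_mono)
      show "3 / 2 * K\<^sup>2 + 3 * K2\<^sup>2 \<le> (2 * K + 2 * K2)\<^sup>2"
        using K K2_nonneg by (simp add: power2_eq_square algebra_simps)
    qed (use len in simp)
    also have "\<dots> = a0\<^sup>2"
    proof -
      have "a0\<^sup>2 = (sqrt len)\<^sup>2 * (2 * K + 2 * K2)\<^sup>2 * (\<tau>\<^sup>2)\<^sup>2"
        unfolding a0_def by (simp only: power_mult_distrib)
      then show ?thesis using len by simp
    qed
    finally show ?thesis using len K K2_nonneg by (intro real_le_lsqrt) (auto simp: a0_def)
  qed

  have G_le: "G \<le> growth_constant a b p K T0 R * (\<delta> / \<eta>)"
  proof -
    have cT: "sqrt 2 * c * T = sqrt 2 * L * T0" using \<eta>0 by (simp add: c_def T)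
    have "a0 + T * B \<le> sqrt len * (2 * K + 2 * K2 + T0 * (3 / 2 * (3 * K + 2 * K2))) * (\<delta> / \<eta>)"
    proof -
      have "\<tau>\<^sup>2 \<le> \<delta> / \<eta>"
        using \<delta> \<eta> \<eta>0 by (simp add: pos_le_divide_eq) (meson mult_left_le order_trans zero_le_power2)
      then have "a0 \<le> sqrt len * (2 * K + 2 * K2) * (\<delta> / \<eta>)"
        unfolding a0_def using len K K2_nonneg by (intro mult_left_mono) auto
      moreover have "T * B = sqrt len * (T0 * (3 / 2 * (3 * K + 2 * K2))) * (\<delta> / \<eta>)"
      proof -
        have "T0 / \<eta> * (3 / 2 * (sqrt len * (k * \<delta>))) = sqrt len * (T0 * (3 / 2 * k)) * (\<delta> / \<eta>)" for k
          by (simp add: mult_ac)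
        then show ?thesis unfolding T B_def .
      qed
      ultimately show ?thesis by (simp add: algebra_simps)
    qed
    then have "G \<le> exp (sqrt 2 * L * T0)
        * (sqrt len * (2 * K + 2 * K2 + T0 * (3 / 2 * (3 * K + 2 * K2))) * (\<delta> / \<eta>))"
      unfolding G_def cT by (intro mult_left_mono) auto
    then show ?thesis
      unfolding growth_constant_def len_def[symmetric] L_def[symmetric] by (simp only: mult.assoc)
  qed
  have G0: "G \<ge> 0"
    unfolding G_def using len K K2_nonneg B0 \<tau> by (simp add: a0_def)
  have small': "(1 / sqrt (h * real M) + sqrt (h * real M)) * (sqrt 2 * G) \<le> 1"
  proof -
    have "(1 / sqrt (h * real M) + sqrt (h * real M)) * (sqrt 2 * G)
        \<le> (1 / sqrt len + sqrt len) * (sqrt 2 * (growth_constant a b p K T0 R * (\<delta> / \<eta>)))"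
      unfolding hM using G_le len by (intro mult_left_mono) auto
    then show ?thesis using small unfolding \<delta>_def len_def by linarith
  qed
  have sG: "sqrt 2 * G \<le> sqrt 2 * (growth_constant a b p K T0 R * (\<delta> / \<eta>))"
    using G_le by (intro mult_left_mono) auto
  have "l2_norm h M (e n) \<le> sqrt 2 * G \<and> l2_norm h M (delta_x_plus h (e n)) \<le> sqrt 2 * G
    \<and> (\<forall>j\<in>{0..<int M}. \<bar>e n j\<bar> \<le> 1)"
  proof (cases n)
    case 0
    then show ?thesis using G0 by (simp add: e0 l2_norm_def delta_x_plus_def)
  next
    case (Suc k)
    then have k: "real (k + 1) * \<tau> \<le> T" using n by simp
    note bootstrap = energy_bootstrap[where e=e and T=T and c=c and B=B and G=G and n=k,
        OF eX M h0 \<tau>(1) c0 B0 _ init G_def small' k]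
    have "l2_norm h M (e (k + 1)) \<le> sqrt 2 * G" "l2_norm h M (delta_x_plus h (e (k + 1))) \<le> sqrt 2 * G"
      by (rule bootstrap, fact residual)+
    moreover have "\<bar>e (k + 1) j\<bar> \<le> 1" if "j \<in> {0..<int M}" for j
      by (rule bootstrap, fact residual, fact that)
    ultimately show ?thesis using Suc by simp
  qed
  then show "l2_norm h M (e n) \<le> sqrt 2 * (growth_constant a b p K T0 R * ((\<tau>\<^sup>2 + h ^ 4) / \<eta>))"
    "l2_norm h M (delta_x_plus h (e n)) \<le> sqrt 2 * (growth_constant a b p K T0 R * ((\<tau>\<^sup>2 + h ^ 4) / \<eta>))"
    "\<And>j. j \<in> {0..<int M} \<Longrightarrow> \<bar>e n j\<bar> \<le> 1"
    using sG unfolding \<delta>_def by (blast intro: order_trans)+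
qed

end

section \<open>Uniformity in the small parameter\<close>

theorem theorem3p2:
  fixes a b T0 M0 :: real and p :: nat
    and \<phi> \<gamma> :: "real \<Rightarrow> real"
    and u :: "real \<Rightarrow> real \<Rightarrow> real \<Rightarrow> real"
  assumes "a < b" and "p \<ge> 1" and "T0 > 0"
    and solution: "\<forall>\<epsilon>\<in>{0<..1}. exact_solution a b p \<phi> \<gamma> \<epsilon> (T0 / \<epsilon> ^ p) (u \<epsilon>)"
    and regularity: "\<forall>\<epsilon>\<in>{0<..1}.
          u \<epsilon> \<in> C_time (Winf_per a b 6) (Winf_norm a b 6) (T0 / \<epsilon> ^ p) 0
              \<inter> C_time (Winf a b 4) (Winf_norm a b 4) (T0 / \<epsilon> ^ p) 2
              \<inter> C_time (Winf a b 2) (Winf_norm a b 2) (T0 / \<epsilon> ^ p) 4"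
    and bounds: "\<exists>K. \<forall>\<epsilon>\<in>{0<..1}. \<forall>t\<in>{0..T0 / \<epsilon> ^ p}. \<forall>r q. r \<le> 4 \<and> r + q \<le> 6 \<longrightarrow>
          (\<exists>g. has_weak_deriv a b q (dt (T0 / \<epsilon> ^ p) r (u \<epsilon>) t) g \<and> Linf_norm a b g \<le> ereal K)"
    and M0: "M0 = real_of_ereal (SUP \<epsilon>\<in>{0<..1}. SUP t\<in>{0..T0 / \<epsilon> ^ p}. Linf_norm a b (u \<epsilon> t))"
  shows "\<exists>h0>0. \<exists>\<tau>0>0. \<exists>C>0. \<forall>\<epsilon>\<in>{0<..1}. \<forall>M\<ge>1. \<forall>h \<tau> U.
      h = (b - a) / real M \<and> h \<le> h0 * \<epsilon> powr (real p / 4) \<and>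
      0 < \<tau> \<and> \<tau> \<le> \<tau>0 * \<epsilon> powr (real p / 2) \<and>
      numerical_solution a b p \<phi> \<gamma> \<epsilon> M \<tau> U \<and>
      (sigma_max p (T0 / \<epsilon> ^ p) \<tau> M U > 1 / \<epsilon> ^ p \<longrightarrow>
         \<tau> < 2 / sqrt (\<epsilon> ^ p * sigma_max p (T0 / \<epsilon> ^ p) \<tau> M U - 1)) \<longrightarrow>
      (\<forall>n. real n \<le> (T0 / \<epsilon> ^ p) / \<tau> \<longrightarrow>
         l2_norm h M (grid_error a h \<tau> (u \<epsilon>) U n)
           + l2_norm h M (delta_x_plus h (grid_error a h \<tau> (u \<epsilon>) U n))
           \<le> C * (h ^ 4 / \<epsilon> ^ p + \<tau>\<^sup>2 / \<epsilon> ^ p) \<and>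
         linf_norm M (U n) \<le> 1 + M0)"
proof -
  obtain K0 where K0: "\<And>\<epsilon> t r q. \<epsilon> \<in> {0<..1} \<Longrightarrow> t \<in> {0..T0 / \<epsilon> ^ p} \<Longrightarrow> r \<le> 4 \<Longrightarrow> r + q \<le> 6 \<Longrightarrow>
      \<exists>g. has_weak_deriv a b q (dt (T0 / \<epsilon> ^ p) r (u \<epsilon>) t) g \<and> Linf_norm a b g \<le> ereal K0"
    using bounds by blast
  define K where "K = max 0 K0"
  have K: "K \<ge> 0" "ereal K0 \<le> ereal K" by (auto simp: K_def)
  have bdd: "\<exists>g. has_weak_deriv a b q (dt (T0 / \<epsilon> ^ p) r (u \<epsilon>) t) g \<and> Linf_norm a b g \<le> ereal K"
    if "\<epsilon> \<in> {0<..1}" "t \<in> {0..T0 / \<epsilon> ^ p}" "r \<le> 4" "r + q \<le> 6" for \<epsilon> t r q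
    using K0[OF that] K(2) by (meson order_trans)
  have T_pos: "T0 / \<epsilon> ^ p > 0" and eps_pow: "0 < \<epsilon> ^ p" "\<epsilon> ^ p \<le> 1" if "\<epsilon> \<in> {0<..1}" for \<epsilon>
    using that \<open>T0 > 0\<close> by (auto simp: power_le_one)
  have classical: "\<exists>v g. classical_solution a b (T0 / \<epsilon> ^ p) K (\<epsilon> ^ p) p (u \<epsilon>) v g \<and>
      (\<forall>x\<in>{a..b}. u \<epsilon> 0 x = \<phi> x \<and> v 1 0 x = \<gamma> x \<and> dx a b 2 \<phi> x = g 2 0 x)"
    if \<epsilon>: "\<epsilon> \<in> {0<..1}" for \<epsilon>
  proof -
    show ?thesis
    proof (rule exact_solution_classical[OF \<open>a < b\<close> T_pos[OF \<epsilon>] \<open>p \<ge> 1\<close>])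
      show "0 \<le> \<epsilon> ^ p" "\<epsilon> ^ p \<le> 1" using eps_pow[OF \<epsilon>] by auto
    qed (use solution regularity \<epsilon> K(1) bdd[OF \<epsilon>] in blast)+
  qed
  have u_le_M0: "\<bar>u \<epsilon> t x\<bar> \<le> M0"
    if \<epsilon>: "\<epsilon> \<in> {0<..1}" and t: "t \<in> {0..T0 / \<epsilon> ^ p}" and x: "x \<in> {a..b}" for \<epsilon> t x
  proof -
    define S where "S = (SUP \<epsilon>\<in>{0<..1}. SUP t\<in>{0..T0 / \<epsilon> ^ p}. Linf_norm a b (u \<epsilon> t))"
    have cont: "continuous_on {a..b} (u \<epsilon> t)" if "\<epsilon> \<in> {0<..1}" "t \<in> {0..T0 / \<epsilon> ^ p}" for \<epsilon> t
    proof -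
      have "u \<epsilon> \<in> C_time (Winf a b 2) (Winf_norm a b 2) (T0 / \<epsilon> ^ p) 4" using regularity that by blast
      from C_time_in_space[OF this that(2)] show ?thesis by (simp add: Winf_def)
    qed
    have "S \<le> ereal K"
      unfolding S_def
    proof (intro SUP_least)
      fix \<epsilon> t assume \<epsilon>: "\<epsilon> \<in> {0<..1::real}" and t: "t \<in> {0..T0 / \<epsilon> ^ p}"
      obtain v g where "classical_solution a b (T0 / \<epsilon> ^ p) K (\<epsilon> ^ p) p (u \<epsilon>) v g"
        using classical[OF \<epsilon>] by blast
      then interpret classical_solution a b "T0 / \<epsilon> ^ p" K "\<epsilon> ^ p" p "u \<epsilon>" v g .
      show "Linf_norm a b (u \<epsilon> t) \<le> ereal K"
        by (rule Linf_norm_le[OF cont[OF \<epsilon> t]]) (use v_bound[of 0 t] t in \<open>auto simp: v_0\<close>)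
    qed
    moreover have "ereal \<bar>u \<epsilon> t x\<bar> \<le> S"
    proof -
      have "ereal \<bar>u \<epsilon> t x\<bar> \<le> Linf_norm a b (u \<epsilon> t)"
        by (rule abs_le_Linf_norm_weak[OF \<open>a < b\<close> cont[OF \<epsilon> t] has_weak_deriv_refl[OF cont[OF \<epsilon> t]] x])
      also have "\<dots> \<le> (SUP t\<in>{0..T0 / \<epsilon> ^ p}. Linf_norm a b (u \<epsilon> t))" using t by (rule SUP_upper)
      also have "\<dots> \<le> S" unfolding S_def using \<epsilon> by (rule SUP_upper)
      finally show ?thesis .
    qed
    \<comment> \<open>The supremum is finite, so its conversion to a real number is faithful.\<close>
    ultimately have "S = ereal M0"
      using M0 unfolding S_def[symmetric] by (cases S) auto
    with \<open>ereal \<bar>u \<epsilon> t x\<bar> \<le> S\<close> show ?thesis by simp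
  qed
  define \<Gamma> where "\<Gamma> = growth_constant a b p K T0 (1 + M0)"
  have M0_nonneg: "M0 \<ge> 0"
    using u_le_M0[of 1 0 a] \<open>T0 > 0\<close> \<open>a < b\<close> by fastforce
  have \<Gamma>: "\<Gamma> \<ge> 0"
    unfolding \<Gamma>_def growth_constant_def source_bound_def using K \<open>T0 > 0\<close> \<open>a < b\<close> by simp
  define S where "S = 1 / sqrt (b - a) + sqrt (b - a)"
  have S: "S \<ge> 0" using \<open>a < b\<close> by (simp add: S_def)
  define X where "X = S * (sqrt 2 * (\<Gamma> * 2))"
  have X: "X \<ge> 0" using S \<Gamma> by (simp add: X_def)
  \<comment> \<open>The number \<open>\<kappa>\<close> serves as both step bounds. Because \<open>\<kappa> \<le> 1\<close>, both \<open>h\<^sup>4\<close> and \<open>\<tau>\<^sup>2\<close> are at most \<open>\<kappa> \<epsilon>\<^sup>p\<close>,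
    so the maximum norm of the error is at most \<open>X * \<kappa> \<le> 1\<close>; and \<open>\<kappa> \<le> T0\<close> places the first time
    level inside the time interval.\<close>
  define \<kappa> where "\<kappa> = min (min 1 T0) (1 / (X + 1))"
  have \<kappa>: "\<kappa> > 0" "\<kappa> \<le> 1" "\<kappa> \<le> T0" and X\<kappa>: "X * \<kappa> \<le> 1"
  proof -
    show "\<kappa> > 0" "\<kappa> \<le> 1" "\<kappa> \<le> T0" using X \<open>T0 > 0\<close> by (auto simp: \<kappa>_def)
    have "X * \<kappa> \<le> X * (1 / (X + 1))" using X by (intro mult_left_mono) (auto simp: \<kappa>_def)
    also have "\<dots> \<le> 1" using X by (simp add: divide_le_eq)
    finally show "X * \<kappa> \<le> 1" .
  qed
  \<comment> \<open>The summand \<open>1\<close> makes the constant positive even if \<open>\<Gamma> = 0\<close>.\<close>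
  define C where "C = 2 * (sqrt 2 * \<Gamma>) + 1"
  have C: "C > 0" using \<Gamma> by (simp add: C_def add_nonneg_pos)
  show ?thesis
  proof (rule exI[of _ \<kappa>], rule conjI[OF \<kappa>(1)], rule exI[of _ \<kappa>], rule conjI[OF \<kappa>(1)],
      rule exI[of _ C], rule conjI[OF C], intro ballI allI impI, elim conjE)
    fix \<epsilon> :: real and M :: nat and h \<tau> :: real and U n
    assume \<epsilon>: "\<epsilon> \<in> {0<..1}" and M: "1 \<le> M" and h: "h = (b - a) / real M"
      and h_le: "h \<le> \<kappa> * \<epsilon> powr (real p / 4)" and \<tau>: "0 < \<tau>" and \<tau>_le: "\<tau> \<le> \<kappa> * \<epsilon> powr (real p / 2)"
      and num: "numerical_solution a b p \<phi> \<gamma> \<epsilon> M \<tau> U" and n: "real n \<le> T0 / \<epsilon> ^ p / \<tau>"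
    define T where "T = T0 / \<epsilon> ^ p"
    obtain v g where cs: "classical_solution a b T K (\<epsilon> ^ p) p (u \<epsilon>) v g"
      and init: "\<And>x. x \<in> {a..b} \<Longrightarrow> u \<epsilon> 0 x = \<phi> x \<and> v 1 0 x = \<gamma> x \<and> dx a b 2 \<phi> x = g 2 0 x"
      using classical[OF \<epsilon>] unfolding T_def by blast
    interpret classical_solution a b T K "\<epsilon> ^ p" p "u \<epsilon>" v g by (rule cs)
    have \<epsilon>0: "\<epsilon> > 0" using \<epsilon> by simp
    have pow: "(\<epsilon> powr (real p / 4)) ^ 4 = \<epsilon> ^ p" "(\<epsilon> powr (real p / 2)) ^ 2 = \<epsilon> ^ p"
      using \<epsilon>0 by (simp_all add: powr_power powr_realpow)
    have h0: "h > 0" by (rule mesh_pos[OF \<open>a < b\<close> M h])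
    have h4: "h ^ 4 \<le> \<kappa> * \<epsilon> ^ p"
    proof -
      have "h ^ 4 \<le> (\<kappa> * \<epsilon> powr (real p / 4)) ^ 4" using h_le h0 by (intro power_mono) auto
      also have "\<dots> = \<kappa> ^ 4 * \<epsilon> ^ p" by (simp add: power_mult_distrib pow)
      also have "\<dots> \<le> \<kappa> ^ 1 * \<epsilon> ^ p" using \<kappa> \<epsilon>0 by (intro mult_right_mono power_decreasing) auto
      finally show ?thesis by simp
    qed
    have t2: "\<tau>\<^sup>2 \<le> \<kappa> * \<epsilon> ^ p"
    proof -
      have "\<tau>\<^sup>2 \<le> (\<kappa> * \<epsilon> powr (real p / 2)) ^ 2" using \<tau>_le \<tau> by (intro power_mono) auto
      also have "\<dots> = \<kappa> ^ 2 * \<epsilon> ^ p" by (simp add: power_mult_distrib pow)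
      also have "\<dots> \<le> \<kappa> ^ 1 * \<epsilon> ^ p" using \<kappa> \<epsilon>0 by (intro mult_right_mono power_decreasing) auto
      finally show ?thesis by simp
    qed
    have "\<epsilon> powr (real p / 2) \<le> 1" using \<epsilon> by (intro powr_le1) auto
    then have \<tau>\<kappa>: "\<tau> \<le> \<kappa>" using \<tau>_le \<kappa>(1) by (meson mult_left_le less_imp_le order_trans)
    have "T0 \<le> T" using eps_pow[of \<epsilon>] \<epsilon> \<open>T0 > 0\<close> by (simp add: T_def pos_le_divide_eq mult_left_le)
    then have \<tau>T: "\<tau> \<le> 1" "\<tau> \<le> T" using \<tau>\<kappa> \<kappa> by linarith+
    define \<rho> where "\<rho> = (\<tau>\<^sup>2 + h ^ 4) / \<epsilon> ^ p"
    have \<rho>: "\<rho> \<le> 2 * \<kappa>"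
      using h4 t2 \<epsilon>0 by (simp add: \<rho>_def pos_divide_le_eq)
    have small: "S * (sqrt 2 * (\<Gamma> * \<rho>)) \<le> 1"
    proof -
      have "S * (sqrt 2 * (\<Gamma> * \<rho>)) \<le> S * (sqrt 2 * (\<Gamma> * (2 * \<kappa>)))"
        using \<rho> S \<Gamma> by (intro mult_left_mono) auto
      also have "\<dots> = X * \<kappa>" by (simp add: X_def)
      finally show ?thesis using X\<kappa> by linarith
    qed
    have nT: "real n * \<tau> \<le> T" using n \<tau> unfolding T_def[symmetric] by (simp add: pos_le_divide_eq)
    have UX: "U k \<in> XM M" for k using num unfolding numerical_solution_def Let_def by blast
    have Ueq: "scheme_op h \<tau> M U k j + \<epsilon> ^ p * U k j ^ (p + 1) = 0" if "k \<ge> 1" "j \<in> {0..<int M}" for k j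
      using num that unfolding numerical_solution_def Let_def scheme_op_def h[symmetric] by auto
    have grid: "grid a h j \<in> {a..b}" if "j \<in> {0..<int M}" for j
      using grid_in[OF \<open>a < b\<close> M h, of j] that by simp
    have U0: "U 0 j = u \<epsilon> 0 (grid a h j)" if "j \<in> {0..<int M}" for j
      using num that init[OF grid[OF that]] unfolding numerical_solution_def Let_def h[symmetric] by auto
    have U1: "U 1 j = u \<epsilon> 0 (grid a h j) + \<tau> * v 1 0 (grid a h j) + \<tau>\<^sup>2 / 2 * v 2 0 (grid a h j)"
      if j: "j \<in> {0..<int M}" for j
    proof -
      have "U 1 j = \<phi> (grid a h j) + \<tau> * \<gamma> (grid a h j) + \<tau>\<^sup>2 / 2 * (dx a b 2 \<phi> (grid a h j)
          - \<phi> (grid a h j) - \<epsilon> ^ p * \<phi> (grid a h j) ^ (p + 1))"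
        using num j unfolding numerical_solution_def Let_def h[symmetric] by auto
      moreover have "v 2 0 (grid a h j) = g 2 0 (grid a h j) - u \<epsilon> 0 (grid a h j)
          - \<epsilon> ^ p * u \<epsilon> 0 (grid a h j) ^ (p + 1)"
        using \<tau> \<tau>T by (intro pde grid[OF j]) auto
      ultimately show ?thesis using init[OF grid[OF j]] by simp
    qed
    define e where "e k = (\<lambda>j. grid_values a h M (u \<epsilon> (real k * \<tau>)) j - U k j)" for k
    have R: "\<bar>u \<epsilon> t x\<bar> + 1 \<le> 1 + M0" if "t \<in> {0..T}" "x \<in> {a..b}" for t x
      using u_le_M0[OF \<epsilon>] that unfolding T_def by fastforce
    note conv_rules = compact_scheme_convergence[OF M h \<tau> \<tau>T eps_pow(1)[OF \<epsilon>] T_def \<open>T0 > 0\<close>,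
        where R="1 + M0" and U=U and n=n]
    have conv: "l2_norm h M (e n) \<le> sqrt 2 * (\<Gamma> * \<rho>)"
      "l2_norm h M (delta_x_plus h (e n)) \<le> sqrt 2 * (\<Gamma> * \<rho>)"
      unfolding e_def \<Gamma>_def \<rho>_def
      by (rule conv_rules; (assumption | rule R UX Ueq U0 U1 nT small[unfolded S_def \<Gamma>_def \<rho>_def])+)+
    have conv_sup: "\<bar>e n j\<bar> \<le> 1" if "j \<in> {0..<int M}" for j
      unfolding e_def
      by (rule conv_rules; (assumption | rule that R UX Ueq U0 U1 nT small[unfolded S_def \<Gamma>_def \<rho>_def])+)
    have tn: "real n * \<tau> \<in> {0..T}" using nT \<tau> by simp
    have err: "grid_error a h \<tau> (u \<epsilon>) U n j = e n j" if "j \<in> {0..int M}" for j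
    proof (cases "j = int M")
      case True
      have "grid a h (int M) = b" using mesh_total[OF \<open>a < b\<close> M h] by (simp add: grid_def mult.commute)
      then show ?thesis
        using True u_periodic[OF tn] by (simp add: grid_error_def e_def grid_values_def grid_def)
    next
      case False
      then have "j mod int M = j" using that by simp
      then show ?thesis by (simp add: grid_error_def e_def grid_values_def)
    qed
    have "l2_norm h M (grid_error a h \<tau> (u \<epsilon>) U n) = l2_norm h M (e n)"
      by (rule l2_norm_cong) (simp add: err)
    moreover have "l2_norm h M (delta_x_plus h (grid_error a h \<tau> (u \<epsilon>) U n)) = l2_norm h M (delta_x_plus h (e n))"
      by (rule l2_norm_cong) (simp add: err delta_x_plus_def)
    moreover have "sqrt 2 * (\<Gamma> * \<rho>) + sqrt 2 * (\<Gamma> * \<rho>) \<le> C * (h ^ 4 / \<epsilon> ^ p + \<tau>\<^sup>2 / \<epsilon> ^ p)"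
    proof -
      have "\<rho> \<ge> 0" using h0 \<epsilon>0 by (simp add: \<rho>_def)
      moreover have "h ^ 4 / \<epsilon> ^ p + \<tau>\<^sup>2 / \<epsilon> ^ p = \<rho>" by (simp add: \<rho>_def add_divide_distrib)
      ultimately show ?thesis by (simp add: C_def algebra_simps)
    qed
    moreover have "linf_norm M (U n) \<le> 1 + M0"
      unfolding linf_norm_def
    proof (rule Max.boundedI)
      fix y assume "y \<in> (\<lambda>j. \<bar>U n j\<bar>) ` {0..<int M}"
      then obtain j where j: "j \<in> {0..<int M}" and y: "y = \<bar>U n j\<bar>" by blast
      have "\<bar>grid_values a h M (u \<epsilon> (real n * \<tau>)) j\<bar> \<le> M0"
        unfolding grid_values_def
        using R[OF tn grid_mod_in[OF \<open>a < b\<close> M h, of j]] by simp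
      then show "y \<le> 1 + M0" using conv_sup[OF j] unfolding y e_def by linarith
    qed (use M in auto)
    ultimately show "l2_norm h M (grid_error a h \<tau> (u \<epsilon>) U n)
           + l2_norm h M (delta_x_plus h (grid_error a h \<tau> (u \<epsilon>) U n))
           \<le> C * (h ^ 4 / \<epsilon> ^ p + \<tau>\<^sup>2 / \<epsilon> ^ p) \<and> linf_norm M (U n) \<le> 1 + M0"
      using conv by linarith
  qed
qed

end
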